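(* Let $n\ge1$ be an integer, let $\ell\ge 1$, $\beta,\gamma>0$ and $\rho,\eta\in\mathbb{R}$. For $1\le p,q\le\infty$, the embedding $F^{p}_{\beta,\rho}\hookrightarrow F^{q}_{\gamma,\eta}$ holds if and only if one of the following three conditions is satisfied: (i) $\beta<\gamma$; (ii) $\beta=\gamma$, $q\ge p$ and $2n(\ell-1)\left(\frac1p-\frac1q\right)\le\rho-\eta$; (iii) $\beta=\gamma$, $q<p$ and $2n\left(\frac1q-\frac1p\right)<\rho-\eta$.
   Context: $dV$ is Lebesgue measure on $\mathbb{C}^n$ normalized so that the unit ball has measure 1, and $1/\infty=0$. For $1\le p<\infty$, $\alpha>0$, $\rho\in\mathbb{R}$, $F^p_{\alpha,\rho}$ (depending also on $\ell$) is the space of entire functions $f$ on $\mathbb{C}^n$ with $\|f\|^p_{F^p_{\alpha,\rho}}=\int_{\mathbb{C}^n}\bigl|f(z)(1+|z|)^{\rho}e^{-\frac{\alpha}{2}|z|^{2\ell}}\bigr|^p\,dV(z)<\infty$; $F^\infty_{\alpha,\rho}$ is the space of entire $f$ with $\|f\|_{F^\infty_{\alpha,\rho}}=\sup_{z}|f(z)|(1+|z|)^\rho e^{-\frac{\alpha}{2}|z|^{2\ell}}<\infty$. For normed spaces $X,Y$, $X\hookrightarrow Y$ means that $X\subset Y$ and the inclusion map $f\in X\mapsto f\in Y$ is bounded. *)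

theory Defs
  imports "HOL-Analysis.Analysis"
begin

definition entire :: "(complex ^ 'n \<Rightarrow> complex) \<Rightarrow> bool" where
  "entire f \<longleftrightarrow>
     (\<forall>z. \<exists>D. (f has_derivative D) (at z) \<and> (\<forall>c v. D (c *s v) = c * D v))"

text \<open>The Borel version of Lebesgue measure suffices, since all integrands
  below come from continuous functions.\<close>

definition dV :: "(complex ^ 'n) measure" where
  "dV = scale_measure (1 / emeasure lborel (ball (0 :: complex ^ 'n) 1)) lborel"

definition fock_weighted ::
    "real \<Rightarrow> real \<Rightarrow> real \<Rightarrow> (complex ^ 'n \<Rightarrow> complex) \<Rightarrow> complex ^ 'n \<Rightarrow> real" where
  "fock_weighted l \<alpha> \<rho> f z =
     norm (f z) * (1 + norm z) powr \<rho> * exp (- (\<alpha> / 2) * norm z powr (2 * l))"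

definition fock_space ::
    "real \<Rightarrow> ereal \<Rightarrow> real \<Rightarrow> real \<Rightarrow> (complex ^ 'n \<Rightarrow> complex) set" where
  "fock_space l p \<alpha> \<rho> =
     {f. entire f \<and>
         (if p = \<infinity> then bdd_above (range (fock_weighted l \<alpha> \<rho> f))
          else integrable dV (\<lambda>z. fock_weighted l \<alpha> \<rho> f z powr real_of_ereal p))}"

text \<open>Only meaningful for members of the corresponding space.\<close>

definition fock_norm ::
    "real \<Rightarrow> ereal \<Rightarrow> real \<Rightarrow> real \<Rightarrow> (complex ^ 'n \<Rightarrow> complex) \<Rightarrow> real" where
  "fock_norm l p \<alpha> \<rho> f =
     (if p = \<infinity> then (SUP z. fock_weighted l \<alpha> \<rho> f z)
      else (\<integral>z. fock_weighted l \<alpha> \<rho> f z powr real_of_ereal p \<partial>dV)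
             powr (1 / real_of_ereal p))"

text \<open>Both spaces consist of functions of the same type with the same pointwise operations,
  so the inclusion map is automatically linear and it suffices to bound it.\<close>

definition embeds :: "'a set \<Rightarrow> ('a \<Rightarrow> real) \<Rightarrow> 'a set \<Rightarrow> ('a \<Rightarrow> real) \<Rightarrow> bool" where
  "embeds X normX Y normY \<longleftrightarrow> X \<subseteq> Y \<and> (\<exists>C. \<forall>f\<in>X. normY f \<le> C * normX f)"

end

theory Submission
  imports Defs "HOL-Complex_Analysis.Cauchy_Integral_Formula"
begin

text \<open>Write \<open>W z = |f z| (1 + |z|)^\<rho> exp (- (\<beta> / 2) |z|^(2 l))\<close>. Multiplying \<open>f\<close> by the exponential of a
  complex linear form flattens the weight on the ball of radius about \<open>(1 + |w|)^(1 - l)\<close> around \<open>w\<close>, so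
  the sub-mean value inequality there bounds \<open>W w\<close> by \<open>(1 + |w|)^(2 n (l - 1) / p)\<close> times the norm of
  \<open>f\<close>. This gives (i) directly; (ii) follows by interpolating between this bound and the
  \<open>L^p\<close> norm, and (iii) from Hoelder's inequality.

  For the converse, the functions \<open>exp (\<beta> l |w|^(2 l - 2) \<langle>z, w\<rangle>)\<close>, whose weighted moduli are dominated by
  Gaussians of width \<open>|w|^(1 - l)\<close> centred at \<open>w\<close>, force \<open>\<beta> \<le> \<gamma>\<close> and the inequality in (ii). For
  (iii) take combinations of the monomials \<open>\<Prod>i. z_i^(j_i^2)\<close> with random signs. In the coordinates
  \<open>\<xi>_i = (\<beta> l)^(1/2) |z|^(l - 1) |z_i|\<close> the weighted modulus of such a monomial, divided by its maximum, is
  at most \<open>exp (- |j - \<xi>|^2 / (4 l))\<close>. Hence a combination can follow a prescribed radial profile from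
  above for all signs and, on average over the signs, from below; a profile with a logarithmic
  factor lies in \<open>L^p\<close> but not in \<open>L^q\<close> at the endpoint.\<close>

section \<open>Entire functions and the sub-mean value inequality\<close>

text \<open>Two test families are needed because the two losses have different origins. A peak
  function lives on one ball of radius about \<open>norm w powr (1 - l)\<close>; comparing exponents
  on it measures the volume of that ball, whence the factor \<open>l - 1\<close>. For
  \<open>q < p\<close> the critical functions must instead be of controlled size on a large part of
  space, and the loss is the growth of the volume of large balls, which does not see
  \<open>l\<close>. A holomorphic function of prescribed modulus is out of reach because of zeros
  and cancellation, so the lower bound holds only on average over signs. The average is a finite sum
  over subsets of a truncated index set, and all constants are independent of the truncation. Square
  exponents provide the right density: in the coordinates of the overview the monomial with
  exponents \<open>k_i\<close> peaks at \<open>sqrt k_i\<close> with width of order 1, so using all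
  exponents would crowd the peaks without bound. The squares leave the integer lattice, on which
  Gaussians have bounded sums. Hence the triangle inequality suffices for the upper bound and a
  single nearby term for the lower one.\<close>

lemma entire_const: "entire (\<lambda>z. c)"
  unfolding entire_def by (rule allI, rule exI[of _ "\<lambda>_. 0"]) auto

lemma entire_nth: "entire (\<lambda>z. z $ i)"
  unfolding entire_def
  by (rule allI, rule exI[of _ "\<lambda>v. v $ i"])
     (auto intro!: bounded_linear_imp_has_derivative bounded_linear_vec_nth)

lemma entire_add:
  assumes "entire f" "entire g" shows "entire (\<lambda>z. f z + g z)"
  unfolding entire_def
proof
  fix z
  obtain D E where "(f has_derivative D) (at z)" "\<forall>c v. D (c *s v) = c * D v"
    "(g has_derivative E) (at z)" "\<forall>c v. E (c *s v) = c * E v"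
    using assms unfolding entire_def by metis
  then show "\<exists>D. ((\<lambda>z. f z + g z) has_derivative D) (at z) \<and> (\<forall>c v. D (c *s v) = c * D v)"
    by (intro exI[of _ "\<lambda>v. D v + E v"]) (auto intro!: has_derivative_add simp: algebra_simps)
qed

lemma entire_mult:
  assumes "entire f" "entire g" shows "entire (\<lambda>z. f z * g z)"
  unfolding entire_def
proof
  fix z
  obtain D E where "(f has_derivative D) (at z)" "\<forall>c v. D (c *s v) = c * D v"
    "(g has_derivative E) (at z)" "\<forall>c v. E (c *s v) = c * E v"
    using assms unfolding entire_def by metis
  then show "\<exists>D. ((\<lambda>z. f z * g z) has_derivative D) (at z) \<and> (\<forall>c v. D (c *s v) = c * D v)"
    by (intro exI[of _ "\<lambda>v. f z * E v + D v * g z"] conjI has_derivative_mult) (auto simp: algebra_simps)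
qed

lemma entire_exp:
  assumes "entire f" shows "entire (\<lambda>z. exp (f z))"
  unfolding entire_def
proof
  fix z
  obtain D where D: "(f has_derivative D) (at z)" "\<forall>c v. D (c *s v) = c * D v"
    using assms unfolding entire_def by metis
  have "(exp has_derivative (\<lambda>h. exp (f z) * h)) (at (f z))"
    using DERIV_exp[of "f z"] by (simp add: has_field_derivative_def)
  from has_derivative_compose[OF D(1) this] D(2)
  show "\<exists>D. ((\<lambda>z. exp (f z)) has_derivative D) (at z) \<and> (\<forall>c v. D (c *s v) = c * D v)"
    by (intro exI[of _ "\<lambda>v. exp (f z) * D v"]) auto
qed

lemma entire_sum:
  "(\<And>i. i \<in> I \<Longrightarrow> entire (f i)) \<Longrightarrow> entire (\<lambda>z. \<Sum>i\<in>I. f i z)"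
  by (induction I rule: infinite_finite_induct) (auto intro!: entire_const entire_add)

lemma entire_prod:
  "(\<And>i. i \<in> I \<Longrightarrow> entire (f i)) \<Longrightarrow> entire (\<lambda>z. \<Prod>i\<in>I. f i z)"
  by (induction I rule: infinite_finite_induct) (auto intro!: entire_const entire_mult)

lemma entire_power: "entire f \<Longrightarrow> entire (\<lambda>z. f z ^ k)"
  by (induction k) (auto intro!: entire_const entire_mult)

lemma entire_continuous:
  assumes "entire f" shows "continuous_on UNIV f"
  using assms unfolding entire_def
  by (metis continuous_at_imp_continuous_on has_derivative_continuous)

lemma entire_measurable: "entire f \<Longrightarrow> f \<in> borel_measurable borel"
  by (intro borel_measurable_continuous_onI entire_continuous)

section \<open>Complex scalars and restriction to complex lines\<close>

lemma continuous_on_vector_scalar_mult: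
  fixes v :: "'a::t2_space \<Rightarrow> complex ^ 'n"
  assumes "continuous_on S s" "continuous_on S v"
  shows "continuous_on S (\<lambda>x. s x *s v x)"
  using assms unfolding continuous_on_def
  by (intro ballI vec_tendstoI) (simp only: vector_smult_component, intro tendsto_mult tendsto_vec_nth, auto)

lemma norm_vector_scalar_mult: "norm (c *s (v :: complex ^ 'n)) = norm c * norm v"
  by (simp add: norm_vec_def norm_mult L2_set_right_distrib)

lemma linear_vector_scalar_mult_left: "linear (\<lambda>c. c *s (v :: complex ^ 'n))"
  by (rule linearI) (auto simp: vec_eq_iff algebra_simps)

lemma linear_vector_scalar_mult_right: "linear (\<lambda>v. c *s (v :: complex ^ 'n))"
  by (rule linearI) (auto simp: vec_eq_iff algebra_simps)

text \<open>The entry point for one-variable theory: the derivative at \<open>w + s *s v\<close> is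
  complex linear, so along the line it acts as multiplication by \<open>D v\<close>.\<close>

lemma entire_slice:
  assumes "entire f" shows "(\<lambda>s. f (w + s *s v)) holomorphic_on UNIV"
proof (rule holomorphic_onI)
  fix s :: complex
  obtain D where D: "(f has_derivative D) (at (w + s *s v))" "\<forall>c v. D (c *s v) = c * D v"
    using assms unfolding entire_def by metis
  have "((\<lambda>s. w + s *s v) has_derivative (\<lambda>s. s *s v)) (at s)"
    by (auto intro!: derivative_eq_intros linear_imp_has_derivative linear_vector_scalar_mult_left)
  from has_derivative_compose[OF this D(1)]
  have "((\<lambda>s. f (w + s *s v)) has_field_derivative D v) (at s)"
    using D(2) unfolding has_field_derivative_def by (simp add: mult.commute[of "D v", abs_def])
  then show "(\<lambda>s. f (w + s *s v)) field_differentiable at s within UNIV"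
    using field_differentiable_def by blast
qed

section \<open>Lebesgue measure under translations, dilations and isometries\<close>

lemma nn_integral_lborel_translate:
  fixes g :: "'a::euclidean_space \<Rightarrow> ennreal"
  assumes [measurable]: "g \<in> borel_measurable borel"
  shows "(\<integral>\<^sup>+x. g (c + x) \<partial>lborel) = (\<integral>\<^sup>+x. g x \<partial>lborel)"
proof -
  have "(\<integral>\<^sup>+x. g x \<partial>lborel) = (\<integral>\<^sup>+x. g x \<partial>distr lborel borel ((+) c))"
    by (simp add: lborel_distr_plus)
  also have "\<dots> = (\<integral>\<^sup>+x. g (c + x) \<partial>lborel)"
    by (subst nn_integral_distr) auto
  finally show ?thesis by simp
qed

lemma nn_integral_lborel_scale:
  fixes g :: "'a::euclidean_space \<Rightarrow> ennreal"
  assumes [measurable]: "g \<in> borel_measurable borel" and "c > 0"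
  shows "(\<integral>\<^sup>+x. g x \<partial>lborel) = ennreal (c ^ DIM('a)) * (\<integral>\<^sup>+x. g (t + c *\<^sub>R x) \<partial>lborel)"
proof -
  have "(\<integral>\<^sup>+x. g x \<partial>lborel) =
     (\<integral>\<^sup>+x. g x \<partial>density (distr lborel borel (\<lambda>x. t + c *\<^sub>R x)) (\<lambda>_. ennreal (\<bar>c\<bar> ^ DIM('a))))"
    using lborel_affine[of c t] assms(2) by simp
  also have "\<dots> = ennreal (c ^ DIM('a)) * (\<integral>\<^sup>+x. g (t + c *\<^sub>R x) \<partial>lborel)"
    using assms(2) by (subst nn_integral_density) (auto simp: nn_integral_cmult nn_integral_distr)
  finally show ?thesis .
qed

text \<open>The image of Lebesgue measure is translation invariant, hence a multiple of Lebesgue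
  measure by the usual Fubini argument; testing on the unit ball, which \<open>T\<close> preserves, shows that
  the factor is 1.\<close>

lemma nn_integral_lborel_isometry:
  fixes T :: "'a::euclidean_space \<Rightarrow> 'a" and g :: "'a \<Rightarrow> ennreal"
  assumes T: "linear T" "surj T" "\<And>x. norm (T x) = norm x"
    and [measurable]: "g \<in> borel_measurable borel"
  shows "(\<integral>\<^sup>+x. g (T x) \<partial>lborel) = (\<integral>\<^sup>+x. g x \<partial>lborel)"
proof -
  define b :: "'a \<Rightarrow> ennreal" where "b = indicator (ball 0 1)"
  define V where "V = (\<integral>\<^sup>+x. b x \<partial>lborel)"
  have bT: "b (T x) = b x" for x
    by (simp add: b_def indicator_def T(3))
  have [measurable]: "b \<in> borel_measurable borel"
    unfolding b_def by (rule borel_measurable_indicator) simp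
  have [measurable]: "T \<in> borel_measurable borel"
    by (intro borel_measurable_continuous_onI linear_continuous_on T(1)[unfolded linear_conv_bounded_linear])
  have V_eq: "V = ennreal (unit_ball_vol (real DIM('a)))"
    by (simp add: V_def b_def emeasure_ball)
  have "(\<integral>\<^sup>+x. b (y - T x) \<partial>lborel) = V" for y
  proof -
    obtain y' where y: "y = T y'" using T(2) by (metis surjD)
    have "(\<integral>\<^sup>+x. b (y - T x) \<partial>lborel) = (\<integral>\<^sup>+x. b (- y' + x) \<partial>lborel)"
      by (intro nn_integral_cong)
         (simp add: y b_def indicator_def T(3) norm_minus_commute flip: linear_diff[OF T(1)])
    also have "\<dots> = V"
      unfolding V_def by (rule nn_integral_lborel_translate) measurable
    finally show ?thesis .
  qed note bV = this
  have tr: "(\<integral>\<^sup>+x. g (T x) \<partial>lborel) = (\<integral>\<^sup>+x. g (T x + y) \<partial>lborel)" for y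
  proof -
    obtain y' where y: "y = T y'" using T(2) by (metis surjD)
    have "(\<integral>\<^sup>+x. g (T x + y) \<partial>lborel) = (\<integral>\<^sup>+x. g (T (y' + x)) \<partial>lborel)"
      by (intro nn_integral_cong) (simp add: y linear_add[OF T(1)] add.commute)
    also have "\<dots> = (\<integral>\<^sup>+x. g (T x) \<partial>lborel)"
      by (subst nn_integral_lborel_translate[where g="\<lambda>x. g (T x)"]) auto
    finally show ?thesis by simp
  qed
  have "V * (\<integral>\<^sup>+x. g (T x) \<partial>lborel) = (\<integral>\<^sup>+y. b y * (\<integral>\<^sup>+x. g (T x) \<partial>lborel) \<partial>lborel)"
    by (simp add: V_def nn_integral_multc)
  also have "\<dots> = (\<integral>\<^sup>+y. (\<integral>\<^sup>+x. b y * g (T x + y) \<partial>lborel) \<partial>lborel)"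
    by (intro nn_integral_cong) (simp add: nn_integral_cmult flip: tr)
  also have "\<dots> = (\<integral>\<^sup>+x. (\<integral>\<^sup>+y. b y * g (T x + y) \<partial>lborel) \<partial>lborel)"
    by (rule lborel_pair.Fubini') simp
  also have "\<dots> = (\<integral>\<^sup>+x. (\<integral>\<^sup>+y. b (y - T x) * g y \<partial>lborel) \<partial>lborel)"
  proof (rule nn_integral_cong)
    fix x
    show "(\<integral>\<^sup>+y. b y * g (T x + y) \<partial>lborel) = (\<integral>\<^sup>+y. b (y - T x) * g y \<partial>lborel)"
      using nn_integral_lborel_translate[where g="\<lambda>y. b (y - T x) * g y" and c="T x"] by simp
  qed
  also have "\<dots> = (\<integral>\<^sup>+y. (\<integral>\<^sup>+x. b (y - T x) * g y \<partial>lborel) \<partial>lborel)"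
    by (rule lborel_pair.Fubini') simp
  also have "\<dots> = V * (\<integral>\<^sup>+y. g y \<partial>lborel)"
    by (simp add: nn_integral_multc bV nn_integral_cmult)
  moreover have "V \<noteq> 0" "V \<noteq> \<infinity>"
    unfolding V_eq using unit_ball_vol_pos[of "real DIM('a)"]
    by (auto simp: ennreal_eq_0_iff simp del: unit_ball_vol_pos)
  ultimately show ?thesis
    by (simp add: ennreal_mult_cancel_left)
qed

section \<open>Mean values over circles and balls\<close>

lemma circle_mean:
  assumes "h holomorphic_on UNIV"
  shows "((\<lambda>t. h (cis (2 * pi * t))) has_integral h 0) {0..1}"
proof -
  have "((\<lambda>u. h u / (u - 0)) has_contour_integral (2 * of_real pi * \<i> * h 0)) (circlepath 0 1)"
    by (rule Cauchy_integral_circlepath_simple) (auto intro: holomorphic_on_subset[OF assms])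
  then have "((\<lambda>t. h (circlepath 0 1 t) / circlepath 0 1 t *
      vector_derivative (circlepath 0 1) (at t within {0..1})) has_integral (2 * of_real pi * \<i> * h 0)) {0..1}"
    by (simp add: has_contour_integral_def)
  then have "((\<lambda>t. (2 * of_real pi * \<i>) * h (cis (2 * pi * t))) has_integral (2 * of_real pi * \<i> * h 0)) {0..1}"
    by (rule has_integral_eq[rotated])
       (simp add: vector_derivative_circlepath01, simp add: circlepath cis_conv_exp mult_ac)
  from has_integral_mult_right[OF this, of "inverse (2 * of_real pi * \<i>)"]
  show ?thesis by (simp add: field_simps)
qed

text \<open>Bernoulli's inequality for real exponents, from \<open>ln x \<ge> 1 - 1 / x\<close> and
  \<open>exp t \<ge> 1 + t\<close> applied to \<open>x * exp ((p - 1) * ln x)\<close>.\<close>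

lemma powr_ge_one_add:
  fixes x p :: real
  assumes "x \<ge> 0" "p \<ge> 1" shows "x powr p \<ge> 1 + p * (x - 1)"
proof (cases "x = 0")
  case False
  then have x: "x > 0" using assms by simp
  have "ln (1/x) * (p - 1) \<le> (1 / x - 1) * (p - 1)"
    using x assms by (intro mult_right_mono ln_le_minus_one) auto
  then have a: "(p - 1) * ln x \<ge> (p - 1) * (1 - 1 / x)"
    using x by (simp add: ln_div algebra_simps)
  have "x powr p = x * exp ((p - 1) * ln x)"
    using x by (simp add: powr_def algebra_simps exp_diff exp_add)
  also have "\<dots> \<ge> x * (1 + (p - 1) * (1 - 1 / x))"
    using x a exp_ge_add_one_self[of "(p - 1) * ln x"] by (intro mult_left_mono) linarith+
  also have "x * (1 + (p - 1) * (1 - 1 / x)) = 1 + p * (x - 1)"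
    using x by (simp add: field_simps)
  finally show ?thesis .
qed (use assms in auto)

text \<open>Convexity in tangent form, by scaling the previous bound. It serves twice: in place of
  Jensen's inequality for circle means, and, with exponent \<open>l\<close> at squared norms, to
  bound the weight from below.\<close>

lemma powr_ge_tangent:
  fixes x a p :: real
  assumes "x \<ge> 0" "a > 0" "p \<ge> 1"
  shows "x powr p \<ge> a powr p + p * a powr (p - 1) * (x - a)"
proof -
  have "a powr p * (x / a) powr p \<ge> a powr p * (1 + p * (x / a - 1))"
    using assms by (intro mult_left_mono powr_ge_one_add) auto
  then show ?thesis
    using assms by (simp add: powr_divide powr_diff field_simps)
qed

text \<open>Integrate the tangent of \<open>x powr p\<close> at \<open>norm (h 0)\<close>: its
  linear term has nonnegative integral by the mean value property. The tangent needs
  \<open>norm (h 0) > 0\<close>, and otherwise the left-hand side is 0. The right-hand side is a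
  nonnegative integral so that Fubini can be applied to it directly.\<close>

lemma circle_mean_powr:
  assumes "h holomorphic_on UNIV" "p \<ge> 1"
  shows "ennreal (norm (h 0) powr p) \<le> (\<integral>\<^sup>+t\<in>{0..1}. ennreal (norm (h (cis (2 * pi * t))) powr p) \<partial>lborel)"
proof (cases "h 0 = 0")
  case False
  let ?g = "\<lambda>t. h (cis (2 * pi * t))"
  have conth: "continuous_on UNIV h"
    using assms(1) by (rule holomorphic_on_imp_continuous_on)
  have ch: "continuous_on {0..1} (\<lambda>t. norm (?g t))"
    by (intro continuous_intros continuous_on_compose2[OF conth]) auto
  have chp: "continuous_on {0..1} (\<lambda>t. norm (?g t) powr p)"
    by (intro continuous_intros continuous_on_powr' ch) (use assms in auto)
  let ?a = "norm (h 0)"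
  have 1: "?a \<le> integral {0..1} (\<lambda>t. norm (?g t))"
    using integral_norm_bound_integral[of ?g "{0..1}" "\<lambda>t. norm (?g t)"]
      circle_mean[OF assms(1)] integrable_continuous_real[OF ch]
    by (auto simp: has_integral_iff)
  have "?a powr p \<le> ?a powr p + p * ?a powr (p - 1) * (integral {0..1} (\<lambda>t. norm (?g t)) - ?a)"
    using 1 assms(2) by auto
  also have "\<dots> = integral {0..1} (\<lambda>t. ?a powr p + p * ?a powr (p - 1) * (norm (?g t) - ?a))"
  proof -
    have "((\<lambda>t. ?a powr p + p * ?a powr (p - 1) * (norm (?g t) - ?a)) has_integral
        ((1 - 0) *\<^sub>R (?a powr p) + p * ?a powr (p - 1) * (integral {0..1} (\<lambda>t. norm (?g t)) - (1 - 0) *\<^sub>R ?a))) {0..1}"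
      using integrable_integral[OF integrable_continuous_real[OF ch]] has_integral_const_real[of _ 0 1]
      by (intro has_integral_add has_integral_mult_right has_integral_diff) auto
    then show ?thesis by (simp add: integral_unique)
  qed
  also have "\<dots> \<le> integral {0..1} (\<lambda>t. norm (?g t) powr p)"
  proof (rule integral_le)
    show "(\<lambda>t. ?a powr p + p * ?a powr (p - 1) * (norm (?g t) - ?a)) integrable_on {0..1}"
      by (intro integrable_continuous_real continuous_intros ch)
    show "(\<lambda>t. norm (?g t) powr p) integrable_on {0..1}"
      by (intro integrable_continuous_real chp)
  qed (use False assms in \<open>auto intro!: powr_ge_tangent\<close>)
  finally have "ennreal (?a powr p) \<le> ennreal (integral {0..1} (\<lambda>t. norm (?g t) powr p))"
    by (rule ennreal_leI)
  also have "((\<lambda>t. norm (?g t) powr p) has_integral integral {0..1} (\<lambda>t. norm (?g t) powr p)) {0..1}"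
    by (intro integrable_integral integrable_continuous_real chp)
  then have "ennreal (integral {0..1} (\<lambda>t. norm (?g t) powr p)) = (\<integral>\<^sup>+t\<in>{0..1}. ennreal (norm (?g t) powr p) \<partial>lborel)"
    by (intro nn_integral_has_integral_lebesgue'[symmetric]) auto
  finally show ?thesis .
qed (use assms in auto)

text \<open>This avoids polar coordinates: the circle bound is integrated over all \<open>v\<close>
  in the ball and the integrals are exchanged. For a fixed angle the rotation
  \<open>cis (2 * pi * t) *s v\<close> is an isometry, so the inner integral does not depend on
  \<open>t\<close>.\<close>

lemma entire_submean:
  fixes f :: "complex ^ 'n \<Rightarrow> complex"
  assumes f: "entire f" and p: "p \<ge> 1"
  shows "ennreal (norm (f w) powr p) * emeasure lborel (ball (0 :: complex ^ 'n) r)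
     \<le> (\<integral>\<^sup>+z\<in>ball w r. ennreal (norm (f z) powr p) \<partial>lborel)"
proof -
  let ?G = "\<lambda>v t. ennreal (norm (f (w + cis (2 * pi * t) *s v)) powr p)"
  have [measurable]: "f \<in> borel_measurable borel" using f by (rule entire_measurable)
  have [measurable]: "ball x r \<in> sets borel" for x :: "complex ^ 'n" by simp
  have [measurable]: "(\<lambda>(t, v). w + cis (2 * pi * t) *s (v :: complex ^ 'n)) \<in> borel_measurable (borel \<Otimes>\<^sub>M borel)"
    "(\<lambda>(v, t). w + cis (2 * pi * t) *s (v :: complex ^ 'n)) \<in> borel_measurable (borel \<Otimes>\<^sub>M borel)"
    unfolding borel_prod split_beta
    by (intro borel_measurable_continuous_onI continuous_on_vector_scalar_mult continuous_intros)+
  have [measurable]: "(\<lambda>t. w + cis (2 * pi * t) *s (v :: complex ^ 'n)) \<in> borel_measurable borel" for v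
    by (intro borel_measurable_continuous_onI continuous_on_vector_scalar_mult continuous_intros)
  have [measurable]: "(\<lambda>v. w + cis (2 * pi * t) *s (v :: complex ^ 'n)) \<in> borel_measurable borel" for t
    by (intro borel_measurable_continuous_onI continuous_on_vector_scalar_mult continuous_intros)
  have "ennreal (norm (f w) powr p) * emeasure lborel (ball (0 :: complex ^ 'n) r)
      = (\<integral>\<^sup>+v\<in>ball (0 :: complex ^ 'n) r. ennreal (norm (f w) powr p) \<partial>lborel)"
    by (simp add: nn_integral_cmult_indicator)
  also have "\<dots> \<le> (\<integral>\<^sup>+v\<in>ball (0 :: complex ^ 'n) r. (\<integral>\<^sup>+t\<in>{0..1}. ?G v t \<partial>lborel) \<partial>lborel)"
  proof (intro nn_integral_mono mult_right_mono)
    show "ennreal (norm (f w) powr p) \<le> (\<integral>\<^sup>+t\<in>{0..1}. ?G v t \<partial>lborel)" for v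
      using circle_mean_powr[OF entire_slice[OF f, of w v] p] by simp
  qed simp
  also have "\<dots> = (\<integral>\<^sup>+v. (\<integral>\<^sup>+t. ?G v t * indicator {0..1} t * indicator (ball 0 r) v \<partial>lborel) \<partial>lborel)"
    by (simp add: nn_integral_multc)
  also have "\<dots> = (\<integral>\<^sup>+t. (\<integral>\<^sup>+v. ?G v t * indicator {0..1} t * indicator (ball 0 r) v \<partial>lborel) \<partial>lborel)"
    by (rule lborel_pair.Fubini') measurable
  also have "\<dots> = (\<integral>\<^sup>+t. (\<integral>\<^sup>+v\<in>ball 0 r. ?G v t \<partial>lborel) * indicator {0..1} t \<partial>lborel)"
  proof (rule nn_integral_cong)
    fix t :: real
    have "(\<integral>\<^sup>+v. ?G v t * indicator {0..1} t * indicator (ball 0 r) v \<partial>lborel)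
      = (\<integral>\<^sup>+v. ?G v t * indicator (ball 0 r) v * indicator {0..1} t \<partial>lborel)"
      by (intro nn_integral_cong) (simp only: mult_ac)
    then show "(\<integral>\<^sup>+v. ?G v t * indicator {0..1} t * indicator (ball 0 r) v \<partial>lborel)
      = (\<integral>\<^sup>+v\<in>ball 0 r. ?G v t \<partial>lborel) * indicator {0..1} t"
      by (simp add: nn_integral_multc)
  qed
  also have "\<dots> = (\<integral>\<^sup>+t. (\<integral>\<^sup>+z\<in>ball w r. ennreal (norm (f z) powr p) \<partial>lborel) * indicator {0..1 :: real} t \<partial>lborel)"
  proof (rule nn_integral_cong)
    fix t :: real
    let ?g = "\<lambda>v. ennreal (norm (f (w + v)) powr p) * indicator (ball 0 r) v"
    have "(\<integral>\<^sup>+v\<in>ball 0 r. ?G v t \<partial>lborel) = (\<integral>\<^sup>+v. ?g (cis (2 * pi * t) *s v) \<partial>lborel)"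
      by (intro nn_integral_cong) (simp add: indicator_def norm_vector_scalar_mult)
    also have "\<dots> = (\<integral>\<^sup>+v. ?g v \<partial>lborel)"
    proof (rule nn_integral_lborel_isometry)
      have "y = cis (2 * pi * t) *s (cis (- (2 * pi * t)) *s y)" for y :: "complex ^ 'n"
        by (simp add: vec_eq_iff mult.assoc[symmetric] cis_mult)
      then show "surj (\<lambda>v :: complex ^ 'n. cis (2 * pi * t) *s v)" by (metis surjI)
    qed (auto simp: norm_vector_scalar_mult linear_vector_scalar_mult_right)
    also have "\<dots> = (\<integral>\<^sup>+v. (\<lambda>z. ennreal (norm (f z) powr p) * indicator (ball w r) z) (w + v) \<partial>lborel)"
      by (intro nn_integral_cong) (simp add: indicator_def dist_norm)
    also have "\<dots> = (\<integral>\<^sup>+z\<in>ball w r. ennreal (norm (f z) powr p) \<partial>lborel)"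
      by (rule nn_integral_lborel_translate) measurable
    finally show "(\<integral>\<^sup>+v\<in>ball 0 r. ?G v t \<partial>lborel) * indicator {0..1} t
      = (\<integral>\<^sup>+z\<in>ball w r. ennreal (norm (f z) powr p) \<partial>lborel) * indicator {0..1} t"
      by simp
  qed
  also have "\<dots> = (\<integral>\<^sup>+z\<in>ball w r. ennreal (norm (f z) powr p) \<partial>lborel)"
    by (simp add: nn_integral_cmult)
  finally show ?thesis .
qed

text \<open>Decompose into the dyadic shells \<open>2^m \<le> 1 + |x| < 2^(m+1)\<close>.\<close>

lemma nn_integral_radial_le:
  fixes g :: "real \<Rightarrow> real"
  assumes anti: "\<And>s t. 1 \<le> s \<Longrightarrow> s \<le> t \<Longrightarrow> g t \<le> g s"
  shows "(\<integral>\<^sup>+x. ennreal (g (1 + norm (x::'a::euclidean_space))) \<partial>lborel)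
     \<le> (\<Sum>m. ennreal (g (2 ^ m)) * ennreal (unit_ball_vol (real DIM('a)) * (2 ^ Suc m) ^ DIM('a)))"
proof -
  have [measurable]: "ball x r \<in> sets borel" for x :: 'a and r by simp
  have "(\<integral>\<^sup>+x. ennreal (g (1 + norm (x::'a))) \<partial>lborel)
     \<le> (\<integral>\<^sup>+x. (\<Sum>m. ennreal (g (2 ^ m)) * indicator (ball 0 (2 ^ Suc m)) (x::'a)) \<partial>lborel)"
  proof (rule nn_integral_mono)
    fix x :: 'a
    obtain m where "2 ^ m \<le> 1 + norm x" "1 + norm x < 2 ^ Suc m"
    proof -
      define m where "m = (LEAST m. 1 + norm x < 2 ^ Suc m)"
      obtain k where "1 + norm x < 2 ^ k"
        using real_arch_pow[of 2 "1 + norm x"] by auto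
      also have "(2::real) ^ k \<le> 2 ^ Suc k" by simp
      finally have a: "1 + norm x < 2 ^ Suc m" unfolding m_def by (rule LeastI)
      have b: "2 ^ m \<le> 1 + norm x"
      proof (cases m)
        case (Suc i)
        then have "\<not> 1 + norm x < 2 ^ Suc i"
          using not_less_Least[of i "\<lambda>m. 1 + norm x < 2 ^ Suc m"] m_def by auto
        then show ?thesis using Suc by simp
      qed simp
      show ?thesis using a b that by blast
    qed
    then have "ennreal (g (1 + norm x)) \<le> ennreal (g (2 ^ m)) * indicator (ball 0 (2 ^ Suc m)) x"
      by (auto intro!: ennreal_leI anti)
    also have "\<dots> = (\<Sum>k\<in>{m}. ennreal (g (2 ^ k)) * indicator (ball 0 (2 ^ Suc k)) x)"
      by (subst sum.insert) auto
    also have "\<dots> \<le> (\<Sum>k. ennreal (g (2 ^ k)) * indicator (ball 0 (2 ^ Suc k)) x)"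
      by (intro sum_le_suminf) auto
    finally show "ennreal (g (1 + norm x)) \<le> (\<Sum>k. ennreal (g (2 ^ k)) * indicator (ball 0 (2 ^ Suc k)) x)" .
  qed
  also have "\<dots> = (\<Sum>m. ennreal (g (2 ^ m)) * emeasure lborel (ball (0::'a) (2 ^ Suc m)))"
    by (subst nn_integral_suminf) (measurable, simp add: nn_integral_cmult_indicator)
  finally show ?thesis by (simp add: emeasure_ball)
qed

section \<open>Fock norms with respect to Lebesgue measure\<close>

lemma fock_weighted_nonneg [simp]: "fock_weighted l \<alpha> \<rho> f z \<ge> 0"
  by (simp add: fock_weighted_def)

lemma fock_weighted_measurable:
  assumes "entire f" shows "fock_weighted l \<alpha> \<rho> f \<in> borel_measurable borel"
proof -
  have [measurable]: "f \<in> borel_measurable borel" using assms by (rule entire_measurable)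
  show ?thesis unfolding fock_weighted_def[abs_def] by measurable
qed

lemma fock_weighted_scale:
  "fock_weighted l \<alpha> \<rho> (\<lambda>z. c * f z) z = norm c * fock_weighted l \<alpha> \<rho> f z"
  by (simp add: fock_weighted_def norm_mult)

text \<open>Membership and a norm bound in one inequality: a finite bound on a nonnegative integral
  already contains integrability. Working with \<open>lborel\<close> keeps the normalizing constant
  out of all estimates.\<close>

definition fock_le ::
    "real \<Rightarrow> ereal \<Rightarrow> real \<Rightarrow> real \<Rightarrow> (complex ^ 'n \<Rightarrow> complex) \<Rightarrow> real \<Rightarrow> bool" where
  "fock_le l p \<alpha> \<rho> f B \<longleftrightarrow> entire f \<and>
     (if p = \<infinity> then \<forall>z. fock_weighted l \<alpha> \<rho> f z \<le> B
      else (\<integral>\<^sup>+z. ennreal (fock_weighted l \<alpha> \<rho> f z powr real_of_ereal p) \<partial>lborel)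
             \<le> ennreal (B powr real_of_ereal p))"

definition dV_factor :: "'n::finite itself \<Rightarrow> real" where
  "dV_factor _ = 1 / unit_ball_vol (real DIM(complex ^ 'n))"

lemma dV_factor_pos: "dV_factor TYPE('n::finite) > 0"
  unfolding dV_factor_def by (intro divide_pos_pos unit_ball_vol_pos) auto

lemma dV_eq: "(dV :: (complex ^ 'n) measure) = scale_measure (ennreal (dV_factor TYPE('n))) lborel"
proof -
  have "unit_ball_vol (real DIM(complex ^ 'n)) > 0" by (intro unit_ball_vol_pos) simp
  then show ?thesis
    unfolding dV_def dV_factor_def
    by (simp add: emeasure_ball divide_ennreal flip: ennreal_1)
qed

lemma sets_dV [measurable_cong]: "sets dV = sets borel"
  by (simp add: dV_def)

lemma nn_integral_dV:
  fixes f :: "complex ^ 'n \<Rightarrow> ennreal"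
  assumes "f \<in> borel_measurable borel"
  shows "(\<integral>\<^sup>+z. f z \<partial>dV) = ennreal (dV_factor TYPE('n)) * (\<integral>\<^sup>+z. f z \<partial>lborel)"
  unfolding dV_eq using assms by (simp add: nn_integral_scale_measure)

lemma ereal_ge_one_cases:
  assumes "1 \<le> (p::ereal)"
  obtains (infinite) "p = \<infinity>" | (finite) P where "p = ereal P" "1 \<le> P"
  using assms by (cases p) auto

lemma real_of_ereal_inverse: "P \<ge> 1 \<Longrightarrow> real_of_ereal (1 / ereal P) = 1 / P"
  by (simp add: one_ereal_def)

text \<open>Passing from \<open>lborel\<close> to \<open>dV\<close> multiplies the integral by
  \<open>dV_factor\<close>, hence the norm by its power \<open>1 / p\<close>. For
  \<open>p = \<infinity>\<close> that exponent is 0 and the factor is 1, as it must be for a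
  supremum.\<close>

lemma fock_le_iff:
  fixes f :: "complex ^ 'n \<Rightarrow> complex"
  assumes p: "1 \<le> p" and B: "B > 0"
  shows "fock_le l p \<alpha> \<rho> f B \<longleftrightarrow>
    f \<in> fock_space l p \<alpha> \<rho> \<and>
    fock_norm l p \<alpha> \<rho> f \<le> dV_factor TYPE('n) powr real_of_ereal (1 / p) * B"
  using p
proof (cases rule: ereal_ge_one_cases)
  case infinite
  show ?thesis
  proof (cases "bdd_above (range (fock_weighted l \<alpha> \<rho> f))")
    case True
    then show ?thesis
      using dV_factor_pos[where 'n='n]
      by (simp add: infinite fock_le_def fock_space_def fock_norm_def cSUP_le_iff)
  next
    case False
    then show ?thesis
      by (auto simp: infinite fock_le_def fock_space_def bdd_above_def)
  qed
next
  case (finite P)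
  let ?W = "fock_weighted l \<alpha> \<rho> f" and ?\<kappa> = "dV_factor TYPE('n)"
  let ?I = "\<integral>\<^sup>+z. ennreal (?W z powr P) \<partial>lborel"
  have \<kappa>: "?\<kappa> > 0" by (rule dV_factor_pos)
  show ?thesis
  proof (cases "entire f")
    case True
    have [measurable]: "?W \<in> borel_measurable borel"
      using True by (rule fock_weighted_measurable)
    have dV: "(\<integral>\<^sup>+z. ennreal (?W z powr P) \<partial>dV) = ennreal ?\<kappa> * ?I"
      by (intro nn_integral_dV) measurable
    have mem: "f \<in> fock_space l p \<alpha> \<rho> \<longleftrightarrow> ?I < \<infinity>"
      using True \<kappa> by (auto simp: finite fock_space_def integrable_iff_bounded dV ennreal_mult_less_top)
    show ?thesis
    proof (cases "?I < \<infinity>")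
      case fin: True
      then obtain J where J: "?I = ennreal J" "J \<ge> 0" by (cases ?I) auto
      have "(\<integral>z. ?W z powr P \<partial>dV) = enn2real (ennreal ?\<kappa> * ?I)"
        by (subst integral_eq_nn_integral) (auto simp: dV)
      also have "\<dots> = ?\<kappa> * J"
        using \<kappa> J by (simp flip: ennreal_mult)
      finally have norm: "fock_norm l p \<alpha> \<rho> f = ?\<kappa> powr (1 / P) * J powr (1 / P)"
        using \<kappa> J by (simp add: finite fock_norm_def powr_mult)
      have "J powr (1 / P) \<le> B \<longleftrightarrow> J \<le> B powr P"
      proof
        assume "J powr (1 / P) \<le> B"
        then have "(J powr (1 / P)) powr P \<le> B powr P"
          using finite by (intro powr_mono2) auto
        then show "J \<le> B powr P" using J finite by (simp add: powr_powr)
      next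
        assume "J \<le> B powr P"
        then have "J powr (1 / P) \<le> (B powr P) powr (1 / P)"
          using J finite by (intro powr_mono2) auto
        then show "J powr (1 / P) \<le> B" using B finite by (simp add: powr_powr)
      qed
      moreover have "fock_le l p \<alpha> \<rho> f B \<longleftrightarrow> J \<le> B powr P"
        using True J by (simp add: fock_le_def finite(1))
      moreover have "fock_norm l p \<alpha> \<rho> f \<le> ?\<kappa> powr real_of_ereal (1 / p) * B \<longleftrightarrow> J powr (1 / P) \<le> B"
        using \<kappa> by (simp add: norm) (simp add: finite real_of_ereal_inverse)
      ultimately show ?thesis using mem fin by blast
    next
      case False
      then have "?I = \<infinity>" by (metis infinity_ennreal_def less_top)
      then show ?thesis using mem by (simp add: fock_le_def finite top_unique)
    qed
  qed (simp add: fock_le_def fock_space_def)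
qed

lemma fock_le_scale:
  assumes "fock_le l p \<alpha> \<rho> f B" "1 \<le> p" "c > 0" "B > 0"
  shows "fock_le l p \<alpha> \<rho> (\<lambda>z. of_real c * f z) (c * B)"
  using assms(2)
proof (cases rule: ereal_ge_one_cases)
  case infinite
  with assms show ?thesis
    by (auto simp: fock_le_def fock_weighted_scale intro!: entire_mult entire_const mult_left_mono)
next
  case (finite P)
  have [measurable]: "fock_weighted l \<alpha> \<rho> f \<in> borel_measurable borel"
    using assms(1) by (auto simp: fock_le_def fock_weighted_measurable)
  have "(\<integral>\<^sup>+z. ennreal (fock_weighted l \<alpha> \<rho> (\<lambda>z. of_real c * f z) z powr P) \<partial>lborel)
     = ennreal (c powr P) * (\<integral>\<^sup>+z. ennreal (fock_weighted l \<alpha> \<rho> f z powr P) \<partial>lborel)"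
    using assms(3)
    by (subst nn_integral_cmult[symmetric]) (auto simp: fock_weighted_scale powr_mult simp flip: ennreal_mult)
  also have "\<dots> \<le> ennreal (c powr P) * ennreal (B powr P)"
    using assms(1) by (intro mult_left_mono) (auto simp: fock_le_def finite)
  also have "\<dots> = ennreal ((c * B) powr P)"
    using assms by (simp add: powr_mult flip: ennreal_mult)
  finally show ?thesis
    using assms(1) by (auto simp: fock_le_def finite intro!: entire_mult entire_const)
qed

lemma fock_norm_nonneg:
  assumes "f \<in> fock_space l p \<alpha> \<rho>" shows "fock_norm l p \<alpha> \<rho> f \<ge> 0"
proof (cases "p = \<infinity>")
  case True
  have "0 \<le> fock_weighted l \<alpha> \<rho> f 0" by simp
  also have "\<dots> \<le> (SUP z. fock_weighted l \<alpha> \<rho> f z)"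
    using assms True by (intro cSUP_upper) (auto simp: fock_space_def)
  finally show ?thesis by (simp add: fock_norm_def True)
qed (simp add: fock_norm_def)

text \<open>By homogeneity it suffices to treat the unit ball, which spares all later estimates a
  norm variable.\<close>

lemma embeds_fockI:
  assumes "1 \<le> p" "1 \<le> q" "C > 0"
    and bound: "\<And>f :: complex ^ 'n \<Rightarrow> complex. fock_le l p \<beta> \<rho> f 1 \<Longrightarrow> fock_le l q \<gamma> \<eta> f C"
  shows "embeds (fock_space l p \<beta> \<rho> :: (complex ^ 'n \<Rightarrow> complex) set) (fock_norm l p \<beta> \<rho>)
                (fock_space l q \<gamma> \<eta>) (fock_norm l q \<gamma> \<eta>)"
proof -
  define k where "k = dV_factor TYPE('n) powr real_of_ereal (1 / p)"
  define k' where "k' = dV_factor TYPE('n) powr real_of_ereal (1 / q)"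
  have k: "k > 0" "k' > 0" using dV_factor_pos[where 'n='n] by (auto simp: k_def k'_def)
  have *: "f \<in> fock_space l q \<gamma> \<eta> \<and> fock_norm l q \<gamma> \<eta> f \<le> k' * (C * B)"
    if "f \<in> fock_space l p \<beta> \<rho>" "fock_norm l p \<beta> \<rho> f \<le> k * B" "B > 0"
    for f :: "complex ^ 'n \<Rightarrow> complex" and B
  proof -
    have "fock_le l p \<beta> \<rho> f B" using that assms by (simp add: fock_le_iff k_def)
    then have "fock_le l p \<beta> \<rho> (\<lambda>z. of_real (1 / B) * f z) ((1 / B) * B)"
      using that assms by (intro fock_le_scale) auto
    then have "fock_le l q \<gamma> \<eta> (\<lambda>z. of_real (1 / B) * f z) C"
      using that by (auto intro: bound)
    then have "fock_le l q \<gamma> \<eta> (\<lambda>z. of_real B * (of_real (1 / B) * f z)) (B * C)"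
      using that assms by (intro fock_le_scale) auto
    moreover have "(\<lambda>z. of_real B * (of_real (1 / B) * f z)) = f"
      using that by auto
    ultimately show ?thesis
      using that assms by (simp add: fock_le_iff k'_def mult.commute[of B C])
  qed
  have "f \<in> fock_space l q \<gamma> \<eta> \<and> fock_norm l q \<gamma> \<eta> f \<le> (k' * C / k) * fock_norm l p \<beta> \<rho> f"
    if f: "f \<in> fock_space l p \<beta> \<rho>" for f :: "complex ^ 'n \<Rightarrow> complex"
  proof (cases "fock_norm l p \<beta> \<rho> f > 0")
    case True
    then show ?thesis using *[OF f, of "fock_norm l p \<beta> \<rho> f / k"] k by simp
  next
    case False
    have nn: "fock_norm l p \<beta> \<rho> f \<ge> 0" using f by (rule fock_norm_nonneg)
    with False have 0: "fock_norm l p \<beta> \<rho> f = 0" by simp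
    \<comment> \<open>A function of norm 0 cannot be rescaled to norm 1. It satisfies the hypothesis
      of \<open>*\<close> for every \<open>B > 0\<close>, and letting \<open>B\<close> tend to 0
      gives the claim.\<close>
    have "fock_norm l q \<gamma> \<eta> f \<le> 0"
    proof (rule field_le_epsilon)
      fix e :: real assume "e > 0"
      then show "fock_norm l q \<gamma> \<eta> f \<le> 0 + e"
        using *[OF f, of "e / (k' * C)"] k assms 0 by simp
    qed
    then show ?thesis using *[OF f, of 1] k 0 by simp
  qed
  then show ?thesis unfolding embeds_def by blast
qed

lemma embeds_fockD:
  assumes emb: "embeds (fock_space l p \<beta> \<rho> :: (complex ^ 'n \<Rightarrow> complex) set) (fock_norm l p \<beta> \<rho>)
                (fock_space l q \<gamma> \<eta>) (fock_norm l q \<gamma> \<eta>)"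
    and pq: "1 \<le> p" "1 \<le> q"
  obtains C where "C > 0"
    "\<And>f :: complex ^ 'n \<Rightarrow> complex. \<And>B. B > 0 \<Longrightarrow> fock_le l p \<beta> \<rho> f B \<Longrightarrow> fock_le l q \<gamma> \<eta> f (C * B)"
proof -
  define k where "k = dV_factor TYPE('n) powr real_of_ereal (1 / p)"
  define k' where "k' = dV_factor TYPE('n) powr real_of_ereal (1 / q)"
  have k: "k > 0" "k' > 0" using dV_factor_pos[where 'n='n] by (auto simp: k_def k'_def)
  obtain C where C: "f \<in> fock_space l q \<gamma> \<eta>" "fock_norm l q \<gamma> \<eta> f \<le> C * fock_norm l p \<beta> \<rho> f"
    if "f \<in> fock_space l p \<beta> \<rho>" for f :: "complex ^ 'n \<Rightarrow> complex"
    using emb unfolding embeds_def by blast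
  \<comment> \<open>The constant in \<open>embeds\<close> may have any sign;
    \<open>\<bar>C\<bar> + 1\<close> is a positive majorant, and \<open>k / k'\<close> accounts for
    the two normalizations.\<close>
  define C' where "C' = (\<bar>C\<bar> + 1) * k / k'"
  show ?thesis
  proof (rule that)
    show "C' > 0" using k by (auto simp: C'_def intro!: divide_pos_pos mult_pos_pos)
  next
    fix f :: "complex ^ 'n \<Rightarrow> complex" and B :: real
    assume B: "B > 0" and f: "fock_le l p \<beta> \<rho> f B"
    then have f: "f \<in> fock_space l p \<beta> \<rho>" "fock_norm l p \<beta> \<rho> f \<le> k * B"
      using pq by (auto simp: fock_le_iff k_def)
    have nn: "fock_norm l p \<beta> \<rho> f \<ge> 0" using f(1) by (rule fock_norm_nonneg)
    have "fock_norm l q \<gamma> \<eta> f \<le> C * fock_norm l p \<beta> \<rho> f" using C f by blast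
    also have "\<dots> \<le> (\<bar>C\<bar> + 1) * fock_norm l p \<beta> \<rho> f"
      using nn by (intro mult_right_mono) auto
    also have "\<dots> \<le> (\<bar>C\<bar> + 1) * (k * B)"
      using f by (intro mult_left_mono) auto
    also have "\<dots> = k' * (C' * B)"
      using k by (simp add: C'_def)
    finally show "fock_le l q \<gamma> \<eta> f (C' * B)"
      using C f pq B k by (subst fock_le_iff) (auto simp: k'_def C'_def intro!: divide_pos_pos mult_pos_pos)
  qed
qed

section \<open>The pointwise estimate\<close>

lemma peetre_powr:
  fixes a b s :: real
  assumes "a \<ge> 0" "b \<ge> 0"
  shows "(1 + a) powr s \<le> (1 + \<bar>a - b\<bar>) powr \<bar>s\<bar> * (1 + b) powr s"
proof (cases "s \<ge> 0")
  case True
  have "0 \<le> \<bar>a - b\<bar> * b" "a \<le> b + \<bar>a - b\<bar>" using assms by auto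
  then have "1 + a \<le> (1 + \<bar>a - b\<bar>) * (1 + b)" by (simp add: distrib_left distrib_right)
  then have "(1 + a) powr s \<le> ((1 + \<bar>a - b\<bar>) * (1 + b)) powr s"
    using assms True by (intro powr_mono2) auto
  then show ?thesis using assms True by (simp add: powr_mult)
next
  case False
  have "0 \<le> \<bar>a - b\<bar> * a" "b \<le> a + \<bar>a - b\<bar>" using assms by auto
  then have "1 + b \<le> (1 + \<bar>a - b\<bar>) * (1 + a)" by (simp add: distrib_left distrib_right)
  then have "(1 + b) powr (-s) \<le> ((1 + \<bar>a - b\<bar>) * (1 + a)) powr (-s)"
    using assms False by (intro powr_mono2) auto
  then have "(1 + b) powr (-s) \<le> (1 + \<bar>a - b\<bar>) powr (-s) * (1 + a) powr (-s)"
    using assms by (simp add: powr_mult)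
  then show ?thesis using assms False by (simp add: powr_minus field_simps)
qed

text \<open>From \<open>ln (1 + r) \<le> r\<close> by completing the square. Since \<open>d\<close>
  may be arbitrarily small, a Gaussian absorbs any polynomial loss at the price of a small part of
  its rate.\<close>

lemma powr_le_exp_square:
  fixes r A d :: real
  assumes "r \<ge> 0" "d > 0"
  shows "(1 + r) powr A \<le> exp (A\<^sup>2 / (4 * d)) * exp (d * r\<^sup>2)"
proof -
  have "A * ln (1 + r) \<le> \<bar>A\<bar> * r"
  proof -
    have "A * ln (1 + r) \<le> \<bar>A\<bar> * ln (1 + r)" using assms by (intro mult_right_mono) auto
    also have "\<dots> \<le> \<bar>A\<bar> * r" using assms ln_add_one_self_le_self by (intro mult_left_mono) auto
    finally show ?thesis .
  qed
  also have "\<dots> \<le> A\<^sup>2 / (4 * d) + d * r\<^sup>2"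
  proof -
    have "0 \<le> (\<bar>A\<bar> - 2 * d * r)\<^sup>2" by simp
    then show ?thesis using assms by (simp add: field_simps power2_eq_square)
  qed
  finally show ?thesis
    using assms by (simp add: powr_def mult.commute flip: exp_add)
qed

lemma powr_two_mult: "x \<ge> 0 \<Longrightarrow> (x\<^sup>2) powr l = (x::real) powr (2 * l)"
  by (cases "x = 0") (auto simp: powr_powr simp flip: powr_numeral)

lemma norm_powr_ge:
  fixes z w :: "'a::real_normed_vector"
  assumes "l \<ge> 1" "w \<noteq> 0"
  shows "norm z powr (2 * l) \<ge>
    norm w powr (2 * l) + l * norm w powr (2 * l - 2) * ((norm z)\<^sup>2 - (norm w)\<^sup>2)"
  using powr_ge_tangent[of "(norm z)\<^sup>2" "(norm w)\<^sup>2" l] assms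
  by (simp add: powr_two_mult algebra_simps)

lemma exp_le_quadratic:
  fixes x :: real
  assumes "x \<le> 1" shows "exp x \<le> 1 + x + x\<^sup>2"
proof (cases "x \<ge> 0")
  case True then show ?thesis using assms by (rule exp_bound)
next
  case False
  have "1 \<le> (1 - x) * (1 + x + x\<^sup>2)"
  proof -
    have "x ^ 3 \<le> 0" using False by (simp add: power_le_zero_eq)
    then show ?thesis by (simp add: algebra_simps power2_eq_square power3_eq_cube)
  qed
  then have "1 / (1 - x) \<le> 1 + x + x\<^sup>2" using False by (simp add: field_simps)
  moreover have "exp x \<le> 1 / (1 - x)"
    using exp_ge_add_one_self[of "-x"] False by (simp add: exp_minus field_simps)
  ultimately show ?thesis by linarith
qed

text \<open>Write \<open>(norm z)\<^sup>2 = N\<^sup>2 * (1 + s)\<close> and expand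
  \<open>(1 + s) powr l\<close> to second order; \<open>3 * l * d \<le> 1\<close> keeps
  \<open>l * s\<close> in the range of the exponential bound. As
  \<open>\<bar>s\<bar> \<le> 3 * d / N\<close>, the quadratic term is at most
  \<open>9 * l\<^sup>2 * (d * N powr (l - 1))\<^sup>2\<close>, so
  \<open>d * norm w powr (l - 1) \<le> 1\<close> is the condition under which the weight is affine
  up to a bounded error. An affine exponent can be removed by a holomorphic factor.\<close>

lemma norm_powr_le:
  fixes z w :: "'a::real_inner"
  assumes l: "l \<ge> 1" and w: "norm w \<ge> 1" and zw: "norm (z - w) \<le> d"
    and d: "3 * l * d \<le> 1" "d * norm w powr (l - 1) \<le> 1"
  shows "norm z powr (2 * l) \<le>
    norm w powr (2 * l) + 2 * l * norm w powr (2 * l - 2) * ((z - w) \<bullet> w) + (9 * l\<^sup>2 + l)"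
proof -
  define N h s where "N = norm w" and "h = 2 * ((z - w) \<bullet> w) + (norm (z - w))\<^sup>2" and "s = h / N\<^sup>2"
  have N: "N \<ge> 1" using w by (simp add: N_def)
  have d0: "d \<ge> 0" using zw norm_ge_zero order_trans by blast
  have "3 * 1 * d \<le> 3 * l * d" using l d0 by (intro mult_right_mono) auto
  then have d1: "d \<le> 1" using d by linarith
  have dN: "d * d \<le> d * N" using d1 N d0 by (intro mult_left_mono) auto
  have z2: "(norm z)\<^sup>2 = N\<^sup>2 + h"
    by (simp add: N_def h_def power2_norm_eq_inner inner_diff_left inner_diff_right inner_commute algebra_simps)
  have zz: "(norm (z - w))\<^sup>2 \<le> d\<^sup>2" using zw by (intro power_mono) auto
  have "\<bar>(z - w) \<bullet> w\<bar> \<le> d * N"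
    using Cauchy_Schwarz_ineq2[of "z - w" w] mult_right_mono[OF zw, of "norm w"] by (simp add: N_def)
  moreover have "(norm (z - w))\<^sup>2 \<le> d * N" using zz dN by (simp add: power2_eq_square)
  \<comment> \<open>The inner product contributes \<open>2 * d * N\<close>, the square at most
    \<open>d * N\<close> because \<open>d \<le> 1 \<le> N\<close>.\<close>
  ultimately have h: "\<bar>h\<bar> \<le> 3 * d * N"
    unfolding h_def using zero_le_power2[of "norm (z - w)"] by linarith
  have s: "\<bar>s\<bar> \<le> 3 * d / N"
    using h N by (simp add: s_def abs_div field_simps power2_eq_square)
  have s1: "l * s \<le> 1"
  proof -
    have "l * s \<le> l * (3 * d / N)" using s l by (intro mult_left_mono) auto
    also have "\<dots> \<le> l * (3 * d / 1)" using N l d0 by (intro mult_left_mono divide_left_mono) auto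
    finally show ?thesis using d by simp
  qed
  have Ns: "(norm z)\<^sup>2 = N\<^sup>2 * (1 + s)" using N by (simp add: z2 s_def field_simps)
  have s0: "1 + s \<ge> 0" using Ns N
    by (metis mult_nonneg_nonneg zero_le_power2 zero_le_mult_iff not_one_le_zero power2_less_0
        zero_less_power2 linorder_not_le)
  have "(1 + s) powr l \<le> exp s powr l"
    using s0 l exp_ge_add_one_self[of s] by (intro powr_mono2) auto
  also have "exp s powr l = exp (l * s)" by (simp add: powr_def)
  also have "\<dots> \<le> 1 + l * s + (l * s)\<^sup>2" using s1 by (rule exp_le_quadratic)
  finally have s2: "(1 + s) powr l \<le> 1 + l * s + (l * s)\<^sup>2" .
  have "norm z powr (2 * l) = (N\<^sup>2 * (1 + s)) powr l" by (simp add: powr_two_mult flip: Ns)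
  also have "\<dots> = N powr (2 * l) * (1 + s) powr l"
    using N s0 by (simp add: powr_mult powr_two_mult)
  also have "\<dots> \<le> N powr (2 * l) * (1 + l * s + (l * s)\<^sup>2)"
    by (intro mult_left_mono s2) auto
  also have "\<dots> = N powr (2 * l) + l * N powr (2 * l - 2) * h + l\<^sup>2 * (N powr (2 * l) * s\<^sup>2)"
    using N by (simp add: s_def powr_diff power_mult_distrib power_divide distrib_left mult_ac)
  also have "N powr (2 * l) * s\<^sup>2 \<le> 9"
  proof -
    have "s\<^sup>2 \<le> (3 * d / N)\<^sup>2" using s by (metis abs_ge_zero power2_abs power_mono)
    then have "N powr (2 * l) * s\<^sup>2 \<le> N powr (2 * l) * (3 * d / N)\<^sup>2"
      by (intro mult_left_mono) auto
    also have "\<dots> = 9 * (d * N powr (l - 1))\<^sup>2"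
    proof -
      have "(N powr l)\<^sup>2 = N powr (2 * l)" using N by (simp add: power2_eq_square flip: powr_add)
      then have "(N powr (l - 1))\<^sup>2 = N powr (2 * l) / N\<^sup>2"
        using N by (simp add: powr_diff power_divide)
      then show ?thesis by (simp add: power_mult_distrib power_divide)
    qed
    also have "\<dots> \<le> 9 * 1" using d d0 by (intro mult_left_mono power_le_one) (auto simp: N_def)
    finally show ?thesis by simp
  qed
  also have "l * N powr (2 * l - 2) * h \<le> 2 * l * N powr (2 * l - 2) * ((z - w) \<bullet> w) + l"
  proof -
    have e: "N powr (2 * l - 2) = (N powr (l - 1))\<^sup>2"
      using N by (simp add: power2_eq_square flip: powr_add)
    have "N powr (2 * l - 2) * (norm (z - w))\<^sup>2 \<le> N powr (2 * l - 2) * d\<^sup>2"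
      using zz by (intro mult_left_mono) auto
    also have "\<dots> = (d * N powr (l - 1))\<^sup>2" by (simp add: power_mult_distrib e)
    also have "\<dots> \<le> 1" using d d0 by (intro power_le_one) (auto simp: N_def)
    finally have "l * (N powr (2 * l - 2) * (norm (z - w))\<^sup>2) \<le> l * 1"
      using l by (intro mult_left_mono) auto
    then show ?thesis by (simp add: h_def algebra_simps)
  qed
  finally show ?thesis using l by (simp add: N_def mult_ac)
qed

text \<open>Conjugating the second argument makes the real functional \<open>z \<bullet> w\<close>
  the real part of a function that is entire in \<open>z\<close>.\<close>

definition cinner :: "complex ^ 'n \<Rightarrow> complex ^ 'n \<Rightarrow> complex" where
  "cinner z w = (\<Sum>i\<in>UNIV. z $ i * cnj (w $ i))"

lemma Re_cinner: "Re (cinner z w) = z \<bullet> w"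
  by (simp add: cinner_def inner_vec_def inner_complex_def)

lemma cinner_diff_left: "cinner (z - y) w = cinner z w - cinner y w"
  by (simp add: cinner_def algebra_simps sum_subtractf)

lemma entire_cinner: "entire (\<lambda>z. cinner z w)"
  unfolding cinner_def by (intro entire_sum entire_mult entire_const entire_nth)

lemma norm_exp_cinner: "norm (exp (of_real c * cinner z w)) = exp (c * (z \<bullet> w))"
  by (simp add: norm_exp_eq_Re Re_cinner)

lemma fock_pointwise_finite:
  assumes l: "l \<ge> 1" and \<beta>: "\<beta> > 0" and P: "P \<ge> 1"
  obtains C where "C > 0"
    "\<And>f :: complex ^ 'n \<Rightarrow> complex. \<And>w. fock_le l (ereal P) \<beta> \<rho> f 1 \<Longrightarrow>
       fock_weighted l \<beta> (\<rho> - 2 * real CARD('n) * (l - 1) / P) f w \<le> C"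
proof -
  define D where "D = DIM(complex ^ 'n)"
  define V where "V = unit_ball_vol (real D)"
  have V: "V > 0" unfolding V_def by (intro unit_ball_vol_pos) simp
  \<comment> \<open>The first two summands are the error of the expansion, available for
    \<open>norm w \<ge> 1\<close>. For \<open>norm w < 1\<close> the ball stays within norm 2, and
    the last summand bounds the weight exponent without any linear correction.\<close>
  define K where "K = 9 * l\<^sup>2 + l + 2 powr (2 * l)"
  define K1 where "K1 = exp (\<beta> / 2 * K) * 2 powr \<bar>\<rho>\<bar>"
  have K1: "K1 > 0" by (simp add: K1_def)
  define C where "C = (K1 powr P / V * (3 * l) powr D) powr (1 / P)"
  have C: "C > 0" using V K1 l by (auto simp: C_def)
  show ?thesis
  proof (rule that[OF C])
    fix f :: "complex ^ 'n \<Rightarrow> complex" and w :: "complex ^ 'n"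
    assume "fock_le l (ereal P) \<beta> \<rho> f 1"
    then have f: "entire f" and int: "(\<integral>\<^sup>+z. ennreal (fock_weighted l \<beta> \<rho> f z powr P) \<partial>lborel) \<le> 1"
      by (auto simp: fock_le_def)
    define N where "N = norm w"
    have N: "N \<ge> 0" by (simp add: N_def)
    \<comment> \<open>The two factors provide the two smallness conditions of
      \<open>norm_powr_le\<close>.\<close>
    define d where "d = (1 / (3 * l)) * (1 + N) powr (1 - l)"
    define c where "c = (if N \<ge> 1 then \<beta> * l * N powr (2 * l - 2) else 0)"
    \<comment> \<open>The correcting factor is 1 at \<open>w\<close>. On the ball
      \<open>norm (g z) * E\<close> is at most \<open>K1\<close> times the weighted modulus of
      \<open>f\<close>, and at \<open>w\<close> it equals that modulus.\<close>
    define g where "g z = f z * exp (of_real (- c) * cinner (z - w) w)" for z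
    define E where "E = (1 + N) powr \<rho> * exp (- (\<beta> / 2) * N powr (2 * l))"
    have E: "E > 0" using N by (auto simp: E_def)
    have g: "entire g" unfolding g_def cinner_diff_left diff_conv_add_uminus[of "cinner _ _"]
      by (intro entire_mult f entire_exp entire_add entire_cinner entire_const)
    have d0: "d > 0" using l N by (auto simp: d_def)
    have "(1 + N) powr (1 - l) \<le> (1 + N) powr 0" using l N by (intro powr_mono) auto
    then have "(1 + N) powr (1 - l) \<le> 1" using N by simp
    then have "3 * l * d \<le> 1" using l by (simp add: d_def)
    have "3 * 1 * d \<le> 3 * l * d" using l d0 by (intro mult_right_mono) auto
    then have d1: "d \<le> 1" using d0 \<open>3 * l * d \<le> 1\<close> by linarith
    have dN: "d * N powr (l - 1) \<le> 1"
    proof -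
      have "d * N powr (l - 1) \<le> (1 / (3 * l)) * (1 + N) powr (1 - l) * (1 + N) powr (l - 1)"
        unfolding d_def using l N by (intro mult_left_mono powr_mono2) auto
      also have "\<dots> = 1 / (3 * l)" using N by (simp flip: powr_add)
      also have "\<dots> \<le> 1" using l by simp
      finally show ?thesis .
    qed
    have gW: "norm (g z) * E \<le> K1 * fock_weighted l \<beta> \<rho> f z" if "z \<in> ball w d" for z
    proof -
      have zw: "norm (z - w) \<le> d" using that by (simp add: dist_norm norm_minus_commute)
      have "(1 + N) powr \<rho> \<le> (1 + \<bar>N - norm z\<bar>) powr \<bar>\<rho>\<bar> * (1 + norm z) powr \<rho>"
        using N by (intro peetre_powr) auto
      also have "\<dots> \<le> 2 powr \<bar>\<rho>\<bar> * (1 + norm z) powr \<rho>"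
        using zw d1 norm_triangle_ineq3[of w z]
        by (intro mult_right_mono powr_mono2) (auto simp: N_def norm_minus_commute)
      finally have a: "(1 + N) powr \<rho> \<le> 2 powr \<bar>\<rho>\<bar> * (1 + norm z) powr \<rho>" .
      have "norm z powr (2 * l) \<le> N powr (2 * l) + (2 / \<beta>) * c * ((z - w) \<bullet> w) + K"
      proof (cases "N \<ge> 1")
        case True
        have "norm z powr (2 * l) \<le>
           norm w powr (2 * l) + 2 * l * norm w powr (2 * l - 2) * ((z - w) \<bullet> w) + (9 * l\<^sup>2 + l)"
          using True dN \<open>3 * l * d \<le> 1\<close> l zw by (intro norm_powr_le) (auto simp: N_def)
        then show ?thesis using \<beta> True powr_ge_zero[of 2 "2 * l"] by (simp add: c_def K_def N_def mult.assoc del: powr_ge_zero)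
      next
        case False
        have "norm z \<le> 2" using False zw d1 norm_triangle_ineq2[of z w] by (simp add: N_def)
        then have "norm z powr (2 * l) \<le> 2 powr (2 * l)" using l by (intro powr_mono2) auto
        moreover have "9 * l\<^sup>2 + l \<ge> 0" "N powr (2 * l) \<ge> 0" using l by auto
        ultimately have "norm z powr (2 * l) \<le> N powr (2 * l) + K" unfolding K_def by linarith
        then show ?thesis using False by (simp add: c_def)
      qed
      then have *: "\<beta> / 2 * norm z powr (2 * l) \<le> \<beta> / 2 * (N powr (2 * l) + (2 / \<beta>) * c * ((z - w) \<bullet> w) + K)"
        using \<beta> by (intro mult_left_mono) auto
      have "- c * ((z - w) \<bullet> w) - \<beta> / 2 * N powr (2 * l) \<le> \<beta> / 2 * K - \<beta> / 2 * norm z powr (2 * l)"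
      proof -
        have "\<beta> / 2 * (N powr (2 * l) + (2 / \<beta>) * c * ((z - w) \<bullet> w) + K)
          = \<beta> / 2 * N powr (2 * l) + c * ((z - w) \<bullet> w) + \<beta> / 2 * K"
          using \<beta> by (simp add: distrib_left)
        with * show ?thesis by linarith
      qed
      then have "exp (- c * ((z - w) \<bullet> w) - \<beta> / 2 * N powr (2 * l)) \<le> exp (\<beta> / 2 * K - \<beta> / 2 * norm z powr (2 * l))"
        by simp
      then have b: "exp (- c * ((z - w) \<bullet> w)) * exp (- (\<beta> / 2) * N powr (2 * l))
          \<le> exp (\<beta> / 2 * K) * exp (- (\<beta> / 2) * norm z powr (2 * l))"
        by (simp flip: exp_add)
      have ng: "norm (g z) = norm (f z) * exp (- c * ((z - w) \<bullet> w))"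
        by (simp only: g_def norm_mult norm_exp_cinner)
      have "norm (g z) * E = norm (f z) * ((1 + N) powr \<rho> * (exp (- c * ((z - w) \<bullet> w)) * exp (- (\<beta> / 2) * N powr (2 * l))))"
        by (simp add: ng E_def mult_ac)
      also have "\<dots> \<le> norm (f z) * ((2 powr \<bar>\<rho>\<bar> * (1 + norm z) powr \<rho>) * (exp (\<beta> / 2 * K) * exp (- (\<beta> / 2) * norm z powr (2 * l))))"
        by (intro mult_left_mono mult_mono a b) auto
      also have "\<dots> = K1 * fock_weighted l \<beta> \<rho> f z"
        by (simp add: K1_def fock_weighted_def mult_ac)
      finally show ?thesis .
    qed
    let ?W = "fock_weighted l \<beta> \<rho> f"
    have Ww: "norm (g w) * E = ?W w"
      by (simp add: g_def E_def fock_weighted_def cinner_def N_def)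
    have [measurable]: "?W \<in> borel_measurable borel" "g \<in> borel_measurable borel"
      using f g by (auto simp: fock_weighted_measurable entire_measurable)
    have [measurable]: "ball x r \<in> sets borel" for x :: "complex ^ 'n" and r by simp
    \<comment> \<open>The ball has volume \<open>V * d ^ D\<close> with \<open>D\<close> the real
      dimension; dividing by it costs \<open>(1 + N) powr ((l - 1) * D)\<close>, whose power
      \<open>1 / P\<close> is the loss in the exponent.\<close>
    have "ennreal (?W w powr P) * ennreal (V * d ^ D)
       = ennreal (E powr P) * (ennreal (norm (g w) powr P) * emeasure lborel (ball (0 :: complex ^ 'n) d))"
      using d0 E V by (simp add: Ww[symmetric] powr_mult emeasure_ball V_def D_def mult_ac flip: ennreal_mult)
    also have "\<dots> \<le> ennreal (E powr P) * (\<integral>\<^sup>+z\<in>ball w d. ennreal (norm (g z) powr P) \<partial>lborel)"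
      by (intro mult_left_mono entire_submean g P) auto
    also have "\<dots> = (\<integral>\<^sup>+z\<in>ball w d. ennreal ((norm (g z) * E) powr P) \<partial>lborel)"
      using E by (subst nn_integral_cmult[symmetric])
         (auto simp: powr_mult mult_ac ennreal_mult intro!: nn_integral_cong)
    also have "\<dots> \<le> (\<integral>\<^sup>+z. ennreal (K1 powr P) * ennreal (?W z powr P) \<partial>lborel)"
    proof (rule nn_integral_mono)
      fix z
      have "(norm (g z) * E) powr P \<le> (K1 * ?W z) powr P" if "z \<in> ball w d"
        using gW[OF that] E P by (intro powr_mono2) auto
      then show "ennreal ((norm (g z) * E) powr P) * indicator (ball w d) z \<le> ennreal (K1 powr P) * ennreal (?W z powr P)"
        using K1 by (auto simp: indicator_def powr_mult intro!: ennreal_leI simp flip: ennreal_mult)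
    qed
    also have "\<dots> = ennreal (K1 powr P) * (\<integral>\<^sup>+z. ennreal (?W z powr P) \<partial>lborel)"
      by (rule nn_integral_cmult) measurable
    also have "\<dots> \<le> ennreal (K1 powr P) * 1"
      using int by (intro mult_left_mono) auto
    finally have "?W w powr P * (V * d ^ D) \<le> K1 powr P"
      using V d0 by (simp flip: ennreal_mult)
    then have "?W w powr P \<le> K1 powr P / V / d ^ D" using V d0 by (simp add: field_simps)
    also have "\<dots> = K1 powr P / V * (3 * l) powr D * (1 + N) powr ((l - 1) * D)"
    proof -
      have "1 / d = 3 * l * (1 + N) powr (l - 1)"
        using l N by (simp add: d_def powr_diff field_simps)
      then have "(1 / d) powr D = (3 * l) powr D * (1 + N) powr ((l - 1) * D)"
        using l N by (simp add: powr_mult powr_powr)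
      moreover have "(1 / d) powr D = 1 / d ^ D"
        using d0 by (simp add: powr_divide powr_realpow)
      ultimately have "1 / d ^ D = (3 * l) powr D * (1 + N) powr ((l - 1) * D)" by simp
      then have "K1 powr P / V * (1 / d ^ D) = K1 powr P / V * ((3 * l) powr D * (1 + N) powr ((l - 1) * D))"
        by (rule arg_cong)
      then show ?thesis by simp
    qed
    finally have "(?W w powr P) powr (1 / P) \<le> (K1 powr P / V * (3 * l) powr D * (1 + N) powr ((l - 1) * D)) powr (1 / P)"
      using P by (intro powr_mono2) auto
    moreover have "(?W w powr P) powr (1 / P) = ?W w" using P by (simp add: powr_powr)
    moreover have "(K1 powr P / V * (3 * l) powr D * (1 + N) powr ((l - 1) * D)) powr (1 / P)
       = C * (1 + N) powr ((l - 1) * D / P)"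
      unfolding C_def by (subst powr_mult) (simp only: powr_powr times_divide_eq_right mult_1_right)
    ultimately have *: "?W w \<le> C * (1 + N) powr ((l - 1) * D / P)" by simp
    have "\<rho> - 2 * real CARD('n) * (l - 1) / P = \<rho> + - ((l - 1) * D / P)" by (simp add: D_def)
    then have "fock_weighted l \<beta> (\<rho> - 2 * real CARD('n) * (l - 1) / P) f w = ?W w * (1 + N) powr (- ((l - 1) * D / P))"
      by (simp only: fock_weighted_def N_def powr_add mult_ac)
    also have "\<dots> \<le> C * (1 + N) powr ((l - 1) * D / P) * (1 + N) powr (- ((l - 1) * D / P))"
      using * by (intro mult_right_mono) auto
    also have "\<dots> = C" using N by (simp add: powr_minus)
    finally show "fock_weighted l \<beta> (\<rho> - 2 * real CARD('n) * (l - 1) / P) f w \<le> C" .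
  qed
qed

lemma fock_pointwise:
  assumes l: "l \<ge> 1" and \<beta>: "\<beta> > 0" and p: "1 \<le> p"
  obtains C where "C > 0"
    "\<And>f :: complex ^ 'n \<Rightarrow> complex. \<And>w. fock_le l p \<beta> \<rho> f 1 \<Longrightarrow>
       fock_weighted l \<beta> (\<rho> - 2 * real CARD('n) * (l - 1) * real_of_ereal (1 / p)) f w \<le> C"
  using p
proof (cases rule: ereal_ge_one_cases)
  case infinite
  show ?thesis using that[of 1] by (auto simp: infinite fock_le_def)
next
  case (finite P)
  show ?thesis
    using fock_pointwise_finite[OF l \<beta> finite(2), where \<rho>=\<rho> and 'n='n] that
    by (auto simp: finite real_of_ereal_inverse)
qed

section \<open>Sufficiency\<close>

lemma one_add_norm_pos [simp]: "0 < 1 + norm z"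
  by (simp add: add_pos_nonneg)

lemma one_add_norm_neq_0 [simp]: "1 + norm z \<noteq> 0"
  using one_add_norm_pos[of z] by linarith

lemma nn_integral_powr_lt_top:
  assumes "s < - real DIM('a::euclidean_space)"
  shows "(\<integral>\<^sup>+x. ennreal ((1 + norm (x :: 'a)) powr s) \<partial>lborel) < \<infinity>"
proof -
  define D where "D = real DIM('a)"
  define V where "V = unit_ball_vol D"
  have V: "V \<ge> 0" by (simp add: V_def D_def)
  have s: "s + D < 0" using assms by (simp add: D_def)
  have q: "2 powr (s + D) < 1" using s by (simp add: powr_less_one)
  have eq: "(2 ^ m) powr s * (V * (2 ^ Suc m) ^ DIM('a)) = V * 2 powr D * (2 powr (s + D)) ^ m" for m
  proof -
    have "((2::real) ^ Suc m) ^ DIM('a) = (2 powr D) * (2 powr D) ^ m"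
      by (simp add: D_def powr_realpow power_mult_distrib mult.commute flip: power_mult)
    moreover have "(2 ^ m) powr s = ((2::real) powr s) ^ m"
      by (simp add: powr_powr mult.commute flip: powr_realpow)
    ultimately show ?thesis by (simp add: powr_add power_mult_distrib)
  qed
  have "(\<integral>\<^sup>+x. ennreal ((1 + norm (x :: 'a)) powr s) \<partial>lborel)
     \<le> (\<Sum>m. ennreal ((2 ^ m) powr s) * ennreal (V * (2 ^ Suc m) ^ DIM('a)))"
    unfolding V_def D_def by (rule nn_integral_radial_le) (use s in \<open>auto intro!: powr_mono2' simp: D_def\<close>)
  also have "\<dots> = (\<Sum>m. ennreal (V * 2 powr D * (2 powr (s + D)) ^ m))"
    using V by (intro suminf_cong) (simp only: ennreal_mult[symmetric] eq[symmetric] powr_ge_zero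
      mult_nonneg_nonneg zero_le_power zero_le_numeral)
  also have "\<dots> < \<infinity>"
    using q V by (simp add: top.not_eq_extremum[symmetric])
       (intro ennreal_suminf_neq_top summable_mult summable_geometric, auto)
  finally show ?thesis .
qed

text \<open>The crude bound \<open>1 + R\<close> avoids taking a root:
  \<open>R \<le> (1 + R) powr Q\<close> because \<open>Q \<ge> 1\<close>.\<close>

lemma fock_le_finiteI:
  assumes "entire f" "Q \<ge> 1" "R \<ge> 0"
    and "(\<integral>\<^sup>+z. ennreal (fock_weighted l \<alpha> \<rho> f z powr Q) \<partial>lborel) \<le> ennreal R"
  shows "fock_le l (ereal Q) \<alpha> \<rho> f (1 + R)"
proof -
  have "R \<le> (1 + R) powr 1" using assms by simp
  also have "\<dots> \<le> (1 + R) powr Q" using assms by (intro powr_mono) auto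
  finally have "ennreal R \<le> ennreal ((1 + R) powr Q)" by (rule ennreal_leI)
  then show ?thesis using assms by (auto simp: fock_le_def intro: order_trans)
qed

lemma fock_le_of_pointwise:
  assumes "1 \<le> q" "C > 0" "s < - 2 * real CARD('n)"
  obtains C' where "C' > 0"
    "\<And>f :: complex ^ 'n \<Rightarrow> complex. entire f \<Longrightarrow>
       (\<And>z. fock_weighted l \<gamma> \<eta> f z \<le> C * (1 + norm z) powr s) \<Longrightarrow> fock_le l q \<gamma> \<eta> f C'"
  using assms(1)
proof (cases rule: ereal_ge_one_cases)
  case infinite
  show ?thesis
  proof (rule that[OF \<open>C > 0\<close>])
    fix f :: "complex ^ 'n \<Rightarrow> complex"
    assume f: "entire f" "\<And>z. fock_weighted l \<gamma> \<eta> f z \<le> C * (1 + norm z) powr s"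
    have "fock_weighted l \<gamma> \<eta> f z \<le> C" for z
    proof -
      have "(1 + norm z) powr s \<le> (1 + norm z) powr 0" using assms by (intro powr_mono) auto
      then have "C * (1 + norm z) powr s \<le> C * 1" using assms by (intro mult_left_mono) auto
      then show ?thesis using f(2)[of z] by simp
    qed
    then show "fock_le l q \<gamma> \<eta> f C" using f by (simp add: infinite fock_le_def)
  qed
next
  case (finite Q)
  let ?I = "\<integral>\<^sup>+x. ennreal ((1 + norm (x :: complex ^ 'n)) powr s) \<partial>lborel"
  have "?I < \<infinity>" using assms by (intro nn_integral_powr_lt_top) simp
  then obtain R where R: "?I = ennreal R" "R \<ge> 0" by (cases ?I) auto
  show ?thesis
  proof (rule that)
    show "1 + C powr Q * R > 0" using R by (simp add: add_pos_nonneg)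
    fix f :: "complex ^ 'n \<Rightarrow> complex"
    assume f: "entire f" "\<And>z. fock_weighted l \<gamma> \<eta> f z \<le> C * (1 + norm z) powr s"
    have "(\<integral>\<^sup>+z. ennreal (fock_weighted l \<gamma> \<eta> f z powr Q) \<partial>lborel)
       \<le> (\<integral>\<^sup>+z. ennreal (C powr Q) * ennreal ((1 + norm (z :: complex ^ 'n)) powr s) \<partial>lborel)"
    proof (rule nn_integral_mono)
      fix z
      have "fock_weighted l \<gamma> \<eta> f z powr Q \<le> (C * (1 + norm z) powr s) powr Q"
        using f finite by (intro powr_mono2) auto
      also have "\<dots> = C powr Q * (1 + norm z) powr (s * Q)" using assms by (simp add: powr_mult powr_powr)
      \<comment> \<open>Since \<open>s < 0\<close> and \<open>Q \<ge> 1\<close>, also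
        \<open>s * Q \<le> s\<close>; one integrable power serves every \<open>Q\<close>.\<close>
      also have "\<dots> \<le> C powr Q * (1 + norm z) powr s"
        using finite assms mult_left_mono_neg[of 1 Q s] by (intro mult_left_mono powr_mono) auto
      finally show "ennreal (fock_weighted l \<gamma> \<eta> f z powr Q) \<le> ennreal (C powr Q) * ennreal ((1 + norm z) powr s)"
        by (simp flip: ennreal_mult)
    qed
    also have "\<dots> = ennreal (C powr Q) * ?I"
      by (intro nn_integral_cmult) measurable
    also have "\<dots> = ennreal (C powr Q * R)" using R by (simp flip: ennreal_mult)
    finally show "fock_le l q \<gamma> \<eta> f (1 + C powr Q * R)"
      using f finite R by (simp add: fock_le_finiteI)
  qed
qed

lemma fock_weighted_change:
  "fock_weighted l \<gamma> \<eta> f z = fock_weighted l \<beta> \<rho> f z * (1 + norm z) powr (\<eta> - \<rho>)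
     * exp (- ((\<gamma> - \<beta>) / 2) * norm z powr (2 * l))"
proof -
  have "(1 + norm z) powr \<eta> = (1 + norm z) powr \<rho> * (1 + norm z) powr (\<eta> - \<rho>)"
    by (simp flip: powr_add)
  moreover have "exp (- (\<gamma> / 2) * norm z powr (2 * l)) =
      exp (- (\<beta> / 2) * norm z powr (2 * l)) * exp (- ((\<gamma> - \<beta>) / 2) * norm z powr (2 * l))"
    by (simp add: field_simps flip: exp_add)
  ultimately show ?thesis by (simp only: fock_weighted_def mult_ac)
qed

lemma fock_weighted_change_power:
  "fock_weighted l \<beta> \<eta> f z = fock_weighted l \<beta> \<rho> f z * (1 + norm z) powr (\<eta> - \<rho>)"
  using fock_weighted_change[of l \<beta> \<eta> f z \<beta> \<rho>] by simp

lemma fock_embeds_less: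
  assumes l: "l \<ge> 1" and \<beta>: "\<beta> > 0" and p: "1 \<le> p" and q: "1 \<le> q" and less: "\<beta> < \<gamma>"
  shows "embeds (fock_space l p \<beta> \<rho> :: (complex ^ 'n \<Rightarrow> complex) set) (fock_norm l p \<beta> \<rho>)
                (fock_space l q \<gamma> \<eta>) (fock_norm l q \<gamma> \<eta>)"
proof -
  define \<rho>' where "\<rho>' = \<rho> - 2 * real CARD('n) * (l - 1) * real_of_ereal (1 / p)"
  obtain C where C: "C > 0" "\<And>f :: complex ^ 'n \<Rightarrow> complex. \<And>w. fock_le l p \<beta> \<rho> f 1 \<Longrightarrow> fock_weighted l \<beta> \<rho>' f w \<le> C"
    unfolding \<rho>'_def using fock_pointwise[OF l \<beta> p, where 'n='n] by metis
  define k where "k = (\<gamma> - \<beta>) / 2"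
  have k: "k > 0" using less by (simp add: k_def)
  \<comment> \<open>Any exponent below \<open>- 2 * real CARD('n)\<close> is integrable; the
    remaining power \<open>A\<close> is left to the exponential gain.\<close>
  define s where "s = - 2 * real CARD('n) - 1"
  define A where "A = \<eta> - \<rho>' - s"
  define C2 where "C2 = exp k * exp (A\<^sup>2 / (4 * k))"
  have C2: "C2 > 0" by (simp add: C2_def)
  have bd: "(1 + r) powr A * exp (- k * r powr (2 * l)) \<le> C2" if r: "r \<ge> 0" for r
  proof -
    \<comment> \<open>This reduces the gain to a Gaussian. The summand 1 covers \<open>r < 1\<close>
      and becomes the factor \<open>exp k\<close> of \<open>C2\<close>.\<close>
    have "r\<^sup>2 \<le> r powr (2 * l) + 1"
    proof (cases "r \<ge> 1")
      case True
      then have "r powr 2 \<le> r powr (2 * l)" using l by (intro powr_mono) auto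
      then show ?thesis using r True by simp
    next
      case False
      then have "r\<^sup>2 \<le> 1" using r by (simp add: power_le_one)
      then show ?thesis by (meson add_increasing powr_ge_zero)
    qed
    then have "k * r\<^sup>2 \<le> k * (r powr (2 * l) + 1)" using k by (intro mult_left_mono) auto
    then have "exp (k * r\<^sup>2) * exp (- k * r powr (2 * l)) \<le> exp k"
      by (simp add: distrib_left flip: exp_add)
    have "(1 + r) powr A * exp (- k * r powr (2 * l))
       \<le> exp (A\<^sup>2 / (4 * k)) * exp (k * r\<^sup>2) * exp (- k * r powr (2 * l))"
      using r k by (intro mult_right_mono powr_le_exp_square) auto
    also have "\<dots> = exp (A\<^sup>2 / (4 * k)) * (exp (k * r\<^sup>2) * exp (- k * r powr (2 * l)))" by simp
    also have "\<dots> \<le> exp (A\<^sup>2 / (4 * k)) * exp k"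
      by (intro mult_left_mono) (fact, simp)
    finally show ?thesis by (simp add: C2_def mult.commute)
  qed
  have "C * C2 > 0" using C C2 by simp
  moreover have "s < - 2 * real CARD('n)" by (simp add: s_def)
  ultimately obtain C' where C': "C' > 0" "\<And>f :: complex ^ 'n \<Rightarrow> complex. entire f \<Longrightarrow>
       (\<And>z. fock_weighted l \<gamma> \<eta> f z \<le> C * C2 * (1 + norm z) powr s) \<Longrightarrow> fock_le l q \<gamma> \<eta> f C'"
    using fock_le_of_pointwise[OF q, where 'n='n and l=l and \<gamma>=\<gamma> and \<eta>=\<eta>] by metis
  show ?thesis
  proof (rule embeds_fockI[OF p q C'(1)])
    fix f :: "complex ^ 'n \<Rightarrow> complex"
    assume f: "fock_le l p \<beta> \<rho> f 1"
    show "fock_le l q \<gamma> \<eta> f C'"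
    proof (rule C'(2))
      show "entire f" using f by (simp add: fock_le_def)
      fix z
      have "fock_weighted l \<gamma> \<eta> f z = fock_weighted l \<beta> \<rho>' f z * ((1 + norm z) powr (A + s) * exp (- k * norm z powr (2 * l)))"
        using fock_weighted_change[of l \<gamma> \<eta> f z \<beta> \<rho>'] by (simp add: A_def k_def)
      also have "\<dots> = fock_weighted l \<beta> \<rho>' f z * ((1 + norm z) powr A * exp (- k * norm z powr (2 * l))) * (1 + norm z) powr s"
        by (simp only: powr_add mult_ac)
      also have "\<dots> \<le> C * C2 * (1 + norm z) powr s"
        using C f C2 by (intro mult_right_mono mult_mono bd) auto
      finally show "fock_weighted l \<gamma> \<eta> f z \<le> C * C2 * (1 + norm z) powr s" .
    qed
  qed
qed

lemma fock_embeds_le: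
  assumes l: "l \<ge> 1" and \<beta>: "\<beta> > 0" and p: "1 \<le> p" and pq: "p \<le> q"
    and le: "2 * real CARD('n) * (l - 1) * (real_of_ereal (1 / p) - real_of_ereal (1 / q)) \<le> \<rho> - \<eta>"
  shows "embeds (fock_space l p \<beta> \<rho> :: (complex ^ 'n \<Rightarrow> complex) set) (fock_norm l p \<beta> \<rho>)
                (fock_space l q \<beta> \<eta>) (fock_norm l q \<beta> \<eta>)"
proof -
  define D where "D = 2 * real CARD('n) * (l - 1)"
  define \<rho>' where "\<rho>' = \<rho> - D * real_of_ereal (1 / p)"
  obtain C where C: "C > 0" "\<And>f :: complex ^ 'n \<Rightarrow> complex. \<And>w. fock_le l p \<beta> \<rho> f 1 \<Longrightarrow> fock_weighted l \<beta> \<rho>' f w \<le> C"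
    unfolding \<rho>'_def D_def using fock_pointwise[OF l \<beta> p, where 'n='n] by metis
  have q: "1 \<le> q" using p pq by (rule order_trans)
  have mono: "fock_weighted l \<beta> \<eta> f z \<le> fock_weighted l \<beta> \<eta>' f z" if "\<eta> \<le> \<eta>'" for f :: "complex ^ 'n \<Rightarrow> complex" and z \<eta>'
    unfolding fock_weighted_def using that by (intro mult_right_mono mult_left_mono powr_mono) auto
  show ?thesis
    using q
  proof (cases rule: ereal_ge_one_cases)
    case infinite
    have "\<eta> \<le> \<rho>'" using le by (simp add: infinite \<rho>'_def D_def)
    then have "fock_le l q \<beta> \<eta> f C" if "fock_le l p \<beta> \<rho> f 1" for f :: "complex ^ 'n \<Rightarrow> complex"
      using that order_trans[OF mono C(2)[OF that]] by (simp add: infinite fock_le_def)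
    then show ?thesis by (intro embeds_fockI[OF p q C(1)])
  next
    case (finite Q)
    then obtain P where P: "p = ereal P" "P \<ge> 1" "P \<le> Q"
      using p pq by (cases p) auto
    define R where "R = C powr (Q - P)"
    have pos: "1 + R > 0" by (simp add: R_def add_pos_nonneg)
    show ?thesis
    proof (rule embeds_fockI[OF p q pos])
      fix f :: "complex ^ 'n \<Rightarrow> complex"
      assume f: "fock_le l p \<beta> \<rho> f 1"
      then have ent: "entire f" by (simp add: fock_le_def)
      have [measurable]: "fock_weighted l \<beta> \<rho> f \<in> borel_measurable borel"
        using ent by (rule fock_weighted_measurable)
      \<comment> \<open>The largest admissible \<open>\<eta>\<close>. For it the \<open>Q\<close>-th
        power splits exactly into the power \<open>Q - P\<close> of the pointwise bounded weight
        with exponent \<open>\<rho>'\<close> and the power \<open>P\<close> of the integrable one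
        with exponent \<open>\<rho>\<close>.\<close>
      define \<eta>' where "\<eta>' = \<rho> - D * (1 / P - 1 / Q)"
      have \<eta>': "\<eta> \<le> \<eta>'"
        using le P finite by (simp add: \<eta>'_def D_def real_of_ereal_inverse)
      have "(\<integral>\<^sup>+z. ennreal (fock_weighted l \<beta> \<eta> f z powr Q) \<partial>lborel)
         \<le> (\<integral>\<^sup>+z. ennreal R * ennreal (fock_weighted l \<beta> \<rho> f z powr P) \<partial>lborel)"
      proof (rule nn_integral_mono)
        fix z
        let ?x = "1 + norm z" and ?W = "fock_weighted l \<beta> \<rho> f z"
        have "fock_weighted l \<beta> \<eta> f z powr Q \<le> fock_weighted l \<beta> \<eta>' f z powr Q"
          using mono[OF \<eta>'] finite by (intro powr_mono2) auto
        also have "\<dots> = ?W powr Q * ?x powr ((\<eta>' - \<rho>) * Q)"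
          by (simp add: fock_weighted_change_power[of l \<beta> \<eta>' f z \<rho>] powr_mult powr_powr)
        also have "(\<eta>' - \<rho>) * Q = (\<rho>' - \<rho>) * (Q - P)"
          using P finite by (simp add: \<eta>'_def \<rho>'_def real_of_ereal_inverse field_simps)
        also have "?W powr Q * ?x powr ((\<rho>' - \<rho>) * (Q - P)) = (?W * ?x powr (\<rho>' - \<rho>)) powr (Q - P) * ?W powr P"
          by (simp add: powr_mult powr_powr mult_ac flip: powr_add)
        also have "\<dots> = fock_weighted l \<beta> \<rho>' f z powr (Q - P) * ?W powr P"
          by (simp add: fock_weighted_change_power[of l \<beta> \<rho>' f z \<rho>])
        also have "\<dots> \<le> R * ?W powr P"
          unfolding R_def using C(2)[OF f] P by (intro mult_right_mono powr_mono2) auto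
        finally show "ennreal (fock_weighted l \<beta> \<eta> f z powr Q) \<le> ennreal R * ennreal (?W powr P)"
          by (simp add: R_def flip: ennreal_mult)
      qed
      also have "\<dots> = ennreal R * (\<integral>\<^sup>+z. ennreal (fock_weighted l \<beta> \<rho> f z powr P) \<partial>lborel)"
        by (rule nn_integral_cmult) measurable
      also have "\<dots> \<le> ennreal R * 1"
        using f by (intro mult_left_mono) (auto simp: fock_le_def P)
      finally show "fock_le l q \<beta> \<eta> f (1 + R)"
        using ent finite by (simp add: fock_le_finiteI R_def)
    qed
  qed
qed

lemma fock_embeds_gt:
  assumes p: "1 \<le> p" and q: "1 \<le> q" and qp: "q < p"
    and less: "2 * real CARD('n) * (real_of_ereal (1 / q) - real_of_ereal (1 / p)) < \<rho> - \<eta>"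
  shows "embeds (fock_space l p \<beta> \<rho> :: (complex ^ 'n \<Rightarrow> complex) set) (fock_norm l p \<beta> \<rho>)
                (fock_space l q \<beta> \<eta>) (fock_norm l q \<beta> \<eta>)"
proof -
  define D where "D = 2 * real CARD('n)"
  obtain Q where Q: "q = ereal Q" "Q \<ge> 1"
    using q qp by (cases rule: ereal_ge_one_cases) auto
  show ?thesis
    using p
  proof (cases rule: ereal_ge_one_cases)
    case infinite
    let ?s = "(\<eta> - \<rho>) * Q"
    have "?s < - D"
      using less Q by (simp add: infinite D_def real_of_ereal_inverse field_simps)
    then have "(\<integral>\<^sup>+x. ennreal ((1 + norm (x :: complex ^ 'n)) powr ?s) \<partial>lborel) < \<infinity>"
      by (intro nn_integral_powr_lt_top) (simp add: D_def)
    then obtain R where R: "(\<integral>\<^sup>+x. ennreal ((1 + norm (x :: complex ^ 'n)) powr ?s) \<partial>lborel) = ennreal R" "R \<ge> 0"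
      by (cases "(\<integral>\<^sup>+x. ennreal ((1 + norm (x :: complex ^ 'n)) powr ?s) \<partial>lborel)") auto
    have pos: "1 + R > 0" using R by simp
    show ?thesis
    proof (rule embeds_fockI[OF p q pos])
      fix f :: "complex ^ 'n \<Rightarrow> complex"
      assume f: "fock_le l p \<beta> \<rho> f 1"
      have "(\<integral>\<^sup>+z. ennreal (fock_weighted l \<beta> \<eta> f z powr Q) \<partial>lborel)
         \<le> (\<integral>\<^sup>+z. ennreal ((1 + norm (z :: complex ^ 'n)) powr ?s) \<partial>lborel)"
      proof (rule nn_integral_mono)
        fix z
        have "fock_weighted l \<beta> \<eta> f z = fock_weighted l \<beta> \<rho> f z * (1 + norm z) powr (\<eta> - \<rho>)"
          by (rule fock_weighted_change_power)
        also have "\<dots> \<le> 1 * (1 + norm z) powr (\<eta> - \<rho>)"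
          using f by (intro mult_right_mono) (auto simp: fock_le_def infinite)
        finally have "fock_weighted l \<beta> \<eta> f z powr Q \<le> ((1 + norm z) powr (\<eta> - \<rho>)) powr Q"
          using Q by (intro powr_mono2) auto
        then show "ennreal (fock_weighted l \<beta> \<eta> f z powr Q) \<le> ennreal ((1 + norm z) powr ?s)"
          by (simp add: powr_powr ennreal_leI)
      qed
      then show "fock_le l q \<beta> \<eta> f (1 + R)"
        using f R Q by (simp add: fock_le_finiteI fock_le_def[of l p])
    qed
  next
    case (finite P)
    with Q qp have QP: "Q < P" by simp
    \<comment> \<open>\<open>Q * P / (P - Q)\<close> is the Hoelder exponent \<open>r\<close> with
      \<open>1 / r = 1 / Q - 1 / P\<close>; the hypothesis puts
      \<open>(1 + norm z) powr (\<eta> - \<rho>)\<close> into \<open>L^r\<close>.\<close>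
    let ?s = "(\<eta> - \<rho>) * (Q * P / (P - Q))"
    have "D * ((P - Q) / (Q * P)) < \<rho> - \<eta>"
      using less Q finite by (simp add: D_def real_of_ereal_inverse field_simps)
    then have "D * ((P - Q) / (Q * P)) * (Q * P / (P - Q)) < (\<rho> - \<eta>) * (Q * P / (P - Q))"
      using QP Q finite by (intro mult_strict_right_mono) auto
    then have "D < (\<rho> - \<eta>) * (Q * P / (P - Q))" using QP Q finite by simp
    moreover have "?s = - ((\<rho> - \<eta>) * (Q * P / (P - Q)))" by (simp only: minus_mult_left minus_diff_eq)
    ultimately have "?s < - D" by simp
    then have "(\<integral>\<^sup>+x. ennreal ((1 + norm (x :: complex ^ 'n)) powr ?s) \<partial>lborel) < \<infinity>"
      by (intro nn_integral_powr_lt_top) (simp add: D_def)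
    then obtain R where R: "(\<integral>\<^sup>+x. ennreal ((1 + norm (x :: complex ^ 'n)) powr ?s) \<partial>lborel) = ennreal R" "R \<ge> 0"
      by (cases "(\<integral>\<^sup>+x. ennreal ((1 + norm (x :: complex ^ 'n)) powr ?s) \<partial>lborel)") auto
    have pos: "1 + (1 + R) > 0" using R by simp
    show ?thesis
    proof (rule embeds_fockI[OF p q pos])
      fix f :: "complex ^ 'n \<Rightarrow> complex"
      assume f: "fock_le l p \<beta> \<rho> f 1"
      then have ent: "entire f" by (simp add: fock_le_def)
      have [measurable]: "fock_weighted l \<beta> \<rho> f \<in> borel_measurable borel"
        using ent by (rule fock_weighted_measurable)
      have "(\<integral>\<^sup>+z. ennreal (fock_weighted l \<beta> \<eta> f z powr Q) \<partial>lborel)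
         \<le> (\<integral>\<^sup>+z. ennreal (fock_weighted l \<beta> \<rho> f z powr P) + ennreal ((1 + norm z) powr ?s) \<partial>lborel)"
      proof (intro nn_integral_mono)
        fix z
        define a b where "a = fock_weighted l \<beta> \<rho> f z" and "b = (1 + norm z) powr (\<eta> - \<rho>)"
        have ab: "a \<ge> 0" "b > 0" by (auto simp: a_def b_def add_pos_nonneg)
        have bs: "(1 + norm z) powr ?s = b powr (Q * P / (P - Q))" by (simp add: b_def powr_powr)
        \<comment> \<open>Young's inequality without sharp constants, by deciding which term
          dominates. Integrated over the unit ball of the source space it does the work of Hoelder's
          inequality.\<close>
        have "(a * b) powr Q \<le> a powr P + b powr (Q * P / (P - Q))"
        proof (cases "b powr Q \<le> a powr (P - Q)")
          case True
          have "(a * b) powr Q \<le> a powr Q * a powr (P - Q)"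
            using True ab by (auto simp: powr_mult intro!: mult_left_mono)
          also have "\<dots> = a powr P" by (simp flip: powr_add)
          finally show ?thesis by (simp add: add_increasing2)
        next
          case False
          then have "(a powr (P - Q)) powr (Q / (P - Q)) \<le> (b powr Q) powr (Q / (P - Q))"
            using Q QP by (intro powr_mono2) auto
          then have "a powr Q \<le> b powr (Q * Q / (P - Q))" using QP by (simp add: powr_powr)
          then have "(a * b) powr Q \<le> b powr (Q * Q / (P - Q)) * b powr Q"
            using ab by (auto simp: powr_mult intro!: mult_right_mono)
          also have "\<dots> = b powr (Q * P / (P - Q))"
            using QP by (simp add: field_simps flip: powr_add)
          finally show ?thesis by (simp add: add_increasing)
        qed
        then show "ennreal (fock_weighted l \<beta> \<eta> f z powr Q)
            \<le> ennreal (fock_weighted l \<beta> \<rho> f z powr P) + ennreal ((1 + norm z) powr ?s)"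
          unfolding bs fock_weighted_change_power[of l \<beta> \<eta> f z \<rho>]
          by (simp add: a_def b_def flip: ennreal_plus)
      qed
      also have "\<dots> = (\<integral>\<^sup>+z. ennreal (fock_weighted l \<beta> \<rho> f z powr P) \<partial>lborel) + ennreal R"
        by (subst nn_integral_add) (measurable, simp only: R)
      also have "\<dots> \<le> 1 + ennreal R"
        using f by (intro add_right_mono) (auto simp: fock_le_def finite)
      also have "\<dots> = ennreal (1 + R)" using R by (simp add: ennreal_plus)
      finally show "fock_le l q \<beta> \<eta> f (1 + (1 + R))"
        using ent R Q by (simp only: fock_le_finiteI)
    qed
  qed
qed

section \<open>Necessity: peak functions\<close>

lemma nn_integral_powr_exp_lt_top:
  assumes "k > 0"
  shows "(\<integral>\<^sup>+x. ennreal ((1 + norm (x :: 'a::euclidean_space)) powr A * exp (- k * (norm x)\<^sup>2)) \<partial>lborel) < \<infinity>"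
proof -
  define s where "s = - real DIM('a) - 1"
  define M where "M = exp ((A - s)\<^sup>2 / (4 * k))"
  have "(\<integral>\<^sup>+x. ennreal ((1 + norm (x :: 'a)) powr A * exp (- k * (norm x)\<^sup>2)) \<partial>lborel)
    \<le> (\<integral>\<^sup>+x. ennreal M * ennreal ((1 + norm (x :: 'a)) powr s) \<partial>lborel)"
  proof (rule nn_integral_mono)
    fix x :: 'a
    have "(1 + norm x) powr A * exp (- k * (norm x)\<^sup>2) = (1 + norm x) powr (A - s) * exp (- k * (norm x)\<^sup>2) * (1 + norm x) powr s"
      by (simp add: mult_ac flip: powr_add)
    also have "\<dots> \<le> M * exp (k * (norm x)\<^sup>2) * exp (- k * (norm x)\<^sup>2) * (1 + norm x) powr s"
      unfolding M_def using assms by (intro mult_right_mono powr_le_exp_square) auto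
    also have "\<dots> = M * (1 + norm x) powr s" by (simp flip: exp_add)
    finally show "ennreal ((1 + norm x) powr A * exp (- k * (norm x)\<^sup>2)) \<le> ennreal M * ennreal ((1 + norm x) powr s)"
      by (simp add: M_def ennreal_leI flip: ennreal_mult)
  qed
  also have "\<dots> = ennreal M * (\<integral>\<^sup>+x. ennreal ((1 + norm (x :: 'a)) powr s) \<partial>lborel)"
    by (intro nn_integral_cmult) measurable
  also have "\<dots> < \<infinity>"
    using nn_integral_powr_lt_top[where s=s and 'a='a] by (simp add: s_def ennreal_mult_less_top)
  finally show ?thesis .
qed

text \<open>The factor by which \<open>w\<close> must be multiplied to give the gradient of
  \<open>\<beta> / 2 * norm z powr (2 * l)\<close> at \<open>z = w\<close>; with it the exponent of
  the peak function and the weight are tangent at \<open>w\<close>.\<close>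

definition peak_coeff :: "real \<Rightarrow> real \<Rightarrow> complex ^ 'n \<Rightarrow> real" where
  "peak_coeff l \<beta> w = \<beta> * l * norm w powr (2 * l - 2)"

definition peak_fun :: "real \<Rightarrow> real \<Rightarrow> complex ^ 'n \<Rightarrow> complex ^ 'n \<Rightarrow> complex" where
  "peak_fun l \<beta> w z = exp (of_real (peak_coeff l \<beta> w) * cinner z w)"

text \<open>The logarithm of the weighted modulus of the peak function at \<open>w\<close>, apart
  from the polynomial factor. It occurs in both norms and cancels in the comparison.\<close>

definition peak_exponent :: "real \<Rightarrow> real \<Rightarrow> complex ^ 'n \<Rightarrow> real" where
  "peak_exponent l \<beta> w = peak_coeff l \<beta> w * (norm w)\<^sup>2 - \<beta> / 2 * norm w powr (2 * l)"

lemma entire_peak_fun: "entire (peak_fun l \<beta> w)"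
  unfolding peak_fun_def by (intro entire_exp entire_mult entire_const entire_cinner)

text \<open>Convexity of \<open>t \<mapsto> t^l\<close> makes the weight dominate its tangent at \<open>w\<close>, which turns
  the exponential into a Gaussian centred at \<open>w\<close>.\<close>

lemma fock_weighted_peak_fun_le:
  assumes "l \<ge> 1" "\<beta> > 0" "w \<noteq> 0"
  shows "fock_weighted l \<beta> \<rho> (peak_fun l \<beta> w) z \<le>
    exp (peak_exponent l \<beta> w) * (1 + norm w) powr \<rho> *
    ((1 + norm (z - w)) powr \<bar>\<rho>\<bar> * exp (- (peak_coeff l \<beta> w / 2) * (norm (z - w))\<^sup>2))"
proof -
  let ?c = "peak_coeff l \<beta> w"
  have "\<beta> / 2 * (norm w powr (2 * l) + l * norm w powr (2 * l - 2) * ((norm z)\<^sup>2 - (norm w)\<^sup>2)) \<le> \<beta> / 2 * norm z powr (2 * l)"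
    using assms by (intro mult_left_mono norm_powr_ge) auto
  moreover have "\<beta> / 2 * (norm w powr (2 * l) + l * norm w powr (2 * l - 2) * ((norm z)\<^sup>2 - (norm w)\<^sup>2))
     = \<beta> / 2 * norm w powr (2 * l) + ?c / 2 * ((norm z)\<^sup>2 - (norm w)\<^sup>2)"
    by (simp add: peak_coeff_def distrib_left)
  moreover have "?c * (z \<bullet> w) - ?c / 2 * ((norm z)\<^sup>2 - (norm w)\<^sup>2)
     = ?c * (norm w)\<^sup>2 - ?c / 2 * (norm (z - w))\<^sup>2"
    by (simp add: power2_norm_eq_inner inner_diff_left inner_diff_right inner_commute field_simps)
  ultimately have e: "?c * (z \<bullet> w) - \<beta> / 2 * norm z powr (2 * l)
      \<le> peak_exponent l \<beta> w - ?c / 2 * (norm (z - w))\<^sup>2"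
    unfolding peak_exponent_def by linarith
  have "fock_weighted l \<beta> \<rho> (peak_fun l \<beta> w) z
     = (1 + norm z) powr \<rho> * exp (?c * (z \<bullet> w) - \<beta> / 2 * norm z powr (2 * l))"
    unfolding fock_weighted_def peak_fun_def norm_exp_cinner diff_conv_add_uminus exp_add by (simp add: mult_ac)
  also have "\<dots> \<le> ((1 + norm (z - w)) powr \<bar>\<rho>\<bar> * (1 + norm w) powr \<rho>) *
     exp (peak_exponent l \<beta> w - ?c / 2 * (norm (z - w))\<^sup>2)"
  proof (rule mult_mono)
    have "(1 + norm z) powr \<rho> \<le> (1 + \<bar>norm z - norm w\<bar>) powr \<bar>\<rho>\<bar> * (1 + norm w) powr \<rho>"
      by (intro peetre_powr) auto
    also have "\<dots> \<le> (1 + norm (z - w)) powr \<bar>\<rho>\<bar> * (1 + norm w) powr \<rho>"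
      using norm_triangle_ineq3[of z w] by (intro mult_right_mono powr_mono2) auto
    finally show "(1 + norm z) powr \<rho> \<le> (1 + norm (z - w)) powr \<bar>\<rho>\<bar> * (1 + norm w) powr \<rho>" .
  qed (use e in auto)
  also have "\<dots> = exp (peak_exponent l \<beta> w) * (1 + norm w) powr \<rho> *
    ((1 + norm (z - w)) powr \<bar>\<rho>\<bar> * exp (- (?c / 2) * (norm (z - w))\<^sup>2))"
    by (simp add: diff_conv_add_uminus exp_add mult_ac del: add_uminus_conv_diff)
  finally show ?thesis .
qed

lemma fock_weighted_peak_fun_center:
  "fock_weighted l \<gamma> \<eta> (peak_fun l \<beta> w) w =
    exp (peak_exponent l \<beta> w) * (1 + norm w) powr \<eta> * exp ((\<beta> - \<gamma>) / 2 * norm w powr (2 * l))"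
proof -
  have "exp (peak_coeff l \<beta> w * (norm w)\<^sup>2) * exp (- (\<gamma> / 2) * norm w powr (2 * l))
     = exp (peak_exponent l \<beta> w) * exp ((\<beta> - \<gamma>) / 2 * norm w powr (2 * l))"
    unfolding peak_exponent_def exp_add[symmetric] by (simp add: field_simps)
  moreover have "norm (peak_fun l \<beta> w w) = exp (peak_coeff l \<beta> w * (norm w)\<^sup>2)"
    unfolding peak_fun_def norm_exp_cinner power2_norm_eq_inner ..
  ultimately show ?thesis by (simp add: fock_weighted_def mult_ac)
qed

text \<open>Rescaling by the width \<open>norm w powr (1 - l)\<close> leads to a Gaussian
  independent of \<open>w\<close>; the Jacobian, raised to the power \<open>1 / p\<close>, is the
  last factor. For \<open>norm w \<ge> 1\<close> the rescaling does not expand, so the polynomial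
  factor stays under control.\<close>

lemma fock_le_peak_fun:
  assumes l: "l \<ge> 1" and \<beta>: "\<beta> > 0" and p: "1 \<le> p"
  obtains K where "K > 0"
    "\<And>w :: complex ^ 'n. norm w \<ge> 1 \<Longrightarrow> fock_le l p \<beta> \<rho> (peak_fun l \<beta> w)
       (K * (exp (peak_exponent l \<beta> w) * (1 + norm w) powr \<rho> *
         norm w powr (- 2 * real CARD('n) * (l - 1) * real_of_ereal (1 / p))))"
proof -
  have c: "peak_coeff l \<beta> w \<ge> \<beta> * l" if "norm w \<ge> 1" for w :: "complex ^ 'n"
    using that l \<beta> ge_one_powr_ge_zero[of "norm w" "2 * l - 2"]
    by (simp add: peak_coeff_def)
  have k: "\<beta> * l / 2 > 0" using \<beta> l by simp
  show ?thesis
    using p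
  proof (cases rule: ereal_ge_one_cases)
    case infinite
    define K where "K = exp (\<bar>\<rho>\<bar>\<^sup>2 / (4 * (\<beta> * l / 2)))"
    show ?thesis
    proof (rule that)
      show "K > 0" by (simp add: K_def)
      fix w :: "complex ^ 'n" assume w: "norm w \<ge> 1"
      have "fock_weighted l \<beta> \<rho> (peak_fun l \<beta> w) z \<le> K * (exp (peak_exponent l \<beta> w) * (1 + norm w) powr \<rho>)" for z
      proof -
        let ?t = "norm (z - w)"
        have "(1 + ?t) powr \<bar>\<rho>\<bar> * exp (- (peak_coeff l \<beta> w / 2) * ?t\<^sup>2)
          \<le> (K * exp (\<beta> * l / 2 * ?t\<^sup>2)) * exp (- (\<beta> * l / 2) * ?t\<^sup>2)"
          unfolding K_def using k c[OF w] by (intro mult_mono powr_le_exp_square) (auto intro: mult_right_mono)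
        also have "\<dots> = K" by (simp flip: exp_add)
        finally have *: "(1 + ?t) powr \<bar>\<rho>\<bar> * exp (- (peak_coeff l \<beta> w / 2) * ?t\<^sup>2) \<le> K" .
        have "fock_weighted l \<beta> \<rho> (peak_fun l \<beta> w) z \<le> exp (peak_exponent l \<beta> w) * (1 + norm w) powr \<rho> *
           ((1 + ?t) powr \<bar>\<rho>\<bar> * exp (- (peak_coeff l \<beta> w / 2) * ?t\<^sup>2))"
          using w l \<beta> by (intro fock_weighted_peak_fun_le) auto
        also have "\<dots> \<le> exp (peak_exponent l \<beta> w) * (1 + norm w) powr \<rho> * K"
          by (intro mult_left_mono *) auto
        finally show ?thesis by (simp add: mult_ac)
      qed
      moreover have "w \<noteq> 0" using w by auto
      ultimately show "fock_le l p \<beta> \<rho> (peak_fun l \<beta> w)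
       (K * (exp (peak_exponent l \<beta> w) * (1 + norm w) powr \<rho> *
         norm w powr (- 2 * real CARD('n) * (l - 1) * real_of_ereal (1 / p))))"
        by (simp add: fock_le_def infinite entire_peak_fun)
    qed
  next
    case (finite P)
    define D where "D = DIM(complex ^ 'n)"
    define k where "k = P * (\<beta> * l / 2)"
    have k: "k > 0" using k finite by (simp add: k_def)
    let ?G = "\<lambda>v :: complex ^ 'n. (1 + norm v) powr (\<bar>\<rho>\<bar> * P) * exp (- k * (norm v)\<^sup>2)"
    have "(\<integral>\<^sup>+v. ennreal (?G v) \<partial>lborel) < \<infinity>" using k by (rule nn_integral_powr_exp_lt_top)
    then obtain R where R: "(\<integral>\<^sup>+v. ennreal (?G v) \<partial>lborel) = ennreal R" "R \<ge> 0"
      by (cases "(\<integral>\<^sup>+v. ennreal (?G v) \<partial>lborel)") auto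
    define K where "K = (1 + R) powr (1 / P)"
    show ?thesis
    proof (rule that)
      show "K > 0" using R by (simp add: K_def add_pos_nonneg)
      fix w :: "complex ^ 'n" assume w: "norm w \<ge> 1"
      define N where "N = norm w"
      have N: "N \<ge> 1" using w by (simp add: N_def)
      define a where "a = N powr (1 - l)"
      have a: "a > 0" using N by (simp add: a_def)
      have "N powr (1 - l) \<le> N powr 0" using N l by (intro powr_mono) auto
      then have a1: "a \<le> 1" using N by (simp add: a_def)
      have ac: "P * (peak_coeff l \<beta> w / 2) * a\<^sup>2 = k"
        using N by (simp add: peak_coeff_def k_def a_def N_def[symmetric] power2_eq_square flip: powr_add)
      define M where "M = exp (peak_exponent l \<beta> w) * (1 + N) powr \<rho>"
      have M: "M > 0" using N by (simp add: M_def)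
      let ?W = "fock_weighted l \<beta> \<rho> (peak_fun l \<beta> w)"
      let ?g = "\<lambda>v :: complex ^ 'n. ennreal ((1 + norm (v - w)) powr (\<bar>\<rho>\<bar> * P) * exp (- (P * (peak_coeff l \<beta> w / 2)) * (norm (v - w))\<^sup>2))"
      have "(\<integral>\<^sup>+z. ennreal (?W z powr P) \<partial>lborel) \<le> (\<integral>\<^sup>+z. ennreal (M powr P) * ?g z \<partial>lborel)"
      proof (rule nn_integral_mono)
        fix z
        have "?W z powr P \<le> (M * ((1 + norm (z - w)) powr \<bar>\<rho>\<bar> * exp (- (peak_coeff l \<beta> w / 2) * (norm (z - w))\<^sup>2))) powr P"
          unfolding M_def N_def using w l \<beta> finite by (intro powr_mono2 fock_weighted_peak_fun_le) auto
        also have "\<dots> = M powr P * ((1 + norm (z - w)) powr (\<bar>\<rho>\<bar> * P) * exp (- (P * (peak_coeff l \<beta> w / 2)) * (norm (z - w))\<^sup>2))"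
          using M by (simp add: powr_mult powr_powr powr_def[of "exp _"] mult_ac)
        finally show "ennreal (?W z powr P) \<le> ennreal (M powr P) * ?g z"
          by (simp add: ennreal_leI flip: ennreal_mult)
      qed
      also have "\<dots> = ennreal (M powr P) * (\<integral>\<^sup>+z. ?g z \<partial>lborel)"
        by (intro nn_integral_cmult) measurable
      finally have int: "(\<integral>\<^sup>+z. ennreal (?W z powr P) \<partial>lborel) \<le> ennreal (M powr P) * (\<integral>\<^sup>+z. ?g z \<partial>lborel)" .
      have "(\<integral>\<^sup>+z. ?g z \<partial>lborel) = ennreal (a ^ D) * (\<integral>\<^sup>+v. ?g (w + a *\<^sub>R v) \<partial>lborel)"
        unfolding D_def using a by (intro nn_integral_lborel_scale) auto
      also have "\<dots> \<le> ennreal (a ^ D) * (\<integral>\<^sup>+v. ennreal (?G v) \<partial>lborel)"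
      proof (intro mult_left_mono nn_integral_mono ennreal_leI mult_mono)
        fix v :: "complex ^ 'n"
        have "a * norm v \<le> 1 * norm v" using a1 by (intro mult_right_mono) auto
        then show "(1 + norm (w + a *\<^sub>R v - w)) powr (\<bar>\<rho>\<bar> * P) \<le> (1 + norm v) powr (\<bar>\<rho>\<bar> * P)"
          using a finite by (intro powr_mono2) auto
        have "- (P * (peak_coeff l \<beta> w / 2)) * (norm (w + a *\<^sub>R v - w))\<^sup>2 = - (P * (peak_coeff l \<beta> w / 2) * a\<^sup>2) * (norm v)\<^sup>2"
          by (simp add: power_mult_distrib)
        then show "exp (- (P * (peak_coeff l \<beta> w / 2)) * (norm (w + a *\<^sub>R v - w))\<^sup>2) \<le> exp (- k * (norm v)\<^sup>2)"
          unfolding ac by simp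
      qed auto
      also have "(\<integral>\<^sup>+v. ennreal (?G v) \<partial>lborel) = ennreal R" by (rule R)
      finally have "(\<integral>\<^sup>+z. ennreal (?W z powr P) \<partial>lborel) \<le> ennreal (M powr P) * (ennreal (a ^ D) * ennreal R)"
        using int by (meson order_trans mult_left_mono zero_le)
      also have "\<dots> = ennreal (M powr P * a ^ D * R)"
        using a R by (simp add: mult.assoc flip: ennreal_mult)
      also have "\<dots> \<le> ennreal (M powr P * a ^ D * (1 + R))"
        using a by (intro ennreal_leI mult_left_mono) auto
      also have "M powr P * a ^ D * (1 + R) = (K * (M * a powr (D / P))) powr P"
        using a R M finite by (simp add: K_def powr_mult powr_powr powr_realpow)
      also have "a powr (D / P) = N powr (- 2 * real CARD('n) * (l - 1) * real_of_ereal (1 / p))"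
        using finite N by (simp add: a_def powr_powr D_def real_of_ereal_inverse field_simps)
      finally show "fock_le l p \<beta> \<rho> (peak_fun l \<beta> w)
       (K * (exp (peak_exponent l \<beta> w) * (1 + norm w) powr \<rho> *
         norm w powr (- 2 * real CARD('n) * (l - 1) * real_of_ereal (1 / p))))"
        by (simp add: fock_le_def finite(1) entire_peak_fun M_def N_def ennreal_leI)
    qed
  qed
qed

text \<open>The target norm of a peak function is bounded below by its value at the centre through
  the pointwise estimate, so no integral has to be bounded from below. The losses
  \<open>d / p\<close> and \<open>d / q\<close> both come from the volume of the same ball and
  combine to the stated difference.\<close>

lemma fock_embeds_necessary:
  assumes l: "l \<ge> 1" and \<beta>: "\<beta> > 0" and \<gamma>: "\<gamma> > 0" and p: "1 \<le> p" and q: "1 \<le> q"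
    and emb: "embeds (fock_space l p \<beta> \<rho> :: (complex ^ 'n \<Rightarrow> complex) set) (fock_norm l p \<beta> \<rho>)
                (fock_space l q \<gamma> \<eta>) (fock_norm l q \<gamma> \<eta>)"
  shows "\<beta> < \<gamma> \<or> \<beta> = \<gamma> \<and>
    2 * real CARD('n) * (l - 1) * (real_of_ereal (1 / p) - real_of_ereal (1 / q)) \<le> \<rho> - \<eta>"
proof -
  define d where "d = 2 * real CARD('n) * (l - 1)"
  have d0: "d \<ge> 0" using l by (simp add: d_def)
  define \<eta>' where "\<eta>' = \<eta> - d * real_of_ereal (1 / q)"
  define x where "x = d * real_of_ereal (1 / p)"
  have x0: "x \<ge> 0" using d0 p by (cases p) (auto simp: x_def real_of_ereal_inverse)
  define \<sigma> where "\<sigma> = \<rho> - \<eta>' - x"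
  obtain C1 where C1: "C1 > 0"
    "\<And>f :: complex ^ 'n \<Rightarrow> complex. \<And>B. B > 0 \<Longrightarrow> fock_le l p \<beta> \<rho> f B \<Longrightarrow> fock_le l q \<gamma> \<eta> f (C1 * B)"
    using embeds_fockD[OF emb p q] by metis
  obtain C2 where C2: "C2 > 0"
    "\<And>f :: complex ^ 'n \<Rightarrow> complex. \<And>w. fock_le l q \<gamma> \<eta> f 1 \<Longrightarrow> fock_weighted l \<gamma> \<eta>' f w \<le> C2"
    unfolding \<eta>'_def d_def using fock_pointwise[OF l \<gamma> q, where 'n='n] by metis
  obtain K where K: "K > 0"
    "\<And>w :: complex ^ 'n. norm w \<ge> 1 \<Longrightarrow> fock_le l p \<beta> \<rho> (peak_fun l \<beta> w)
       (K * (exp (peak_exponent l \<beta> w) * (1 + norm w) powr \<rho> * norm w powr (- x)))"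
    using fock_le_peak_fun[OF l \<beta> p, where 'n='n and \<rho>=\<rho>] unfolding x_def d_def by (auto simp: mult.assoc)
  define L where "L = C1 * C2 * K * 2 powr x"
  have L: "L > 0" using C1 C2 K by (simp add: L_def)
  have main: "exp ((\<beta> - \<gamma>) / 2 * R powr (2 * l)) \<le> L * (1 + R) powr \<sigma>" if R: "R \<ge> 1" for R
  proof -
    define w :: "complex ^ 'n" where "w = of_real R *s axis undefined 1"
    have w: "norm w = R" using R by (simp add: w_def norm_vector_scalar_mult norm_axis_1)
    define M where "M = exp (peak_exponent l \<beta> w)"
    have M: "M > 0" by (simp add: M_def)
    define B where "B = K * (M * (1 + R) powr \<rho> * R powr (- x))"
    have B: "B > 0" using K M R by (simp add: B_def)
    let ?f = "peak_fun l \<beta> w"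
    have "fock_le l p \<beta> \<rho> ?f B" unfolding B_def M_def using K(2)[of w] R by (simp add: w)
    then have "fock_le l q \<gamma> \<eta> ?f (C1 * B)" using C1 B by blast
    then have "fock_le l q \<gamma> \<eta> (\<lambda>z. of_real (1 / (C1 * B)) * ?f z) (1 / (C1 * B) * (C1 * B))"
      using C1 B q by (intro fock_le_scale) auto
    moreover have "1 / (C1 * B) * (C1 * B) = 1" using C1 B by simp
    ultimately have "fock_weighted l \<gamma> \<eta>' (\<lambda>z. of_real (1 / (C1 * B)) * ?f z) w \<le> C2" by (simp only: C2)
    then have "fock_weighted l \<gamma> \<eta>' ?f w \<le> C1 * C2 * B"
      using C1 B unfolding fock_weighted_scale by (simp add: norm_divide norm_mult field_simps)
    then have "M * (1 + R) powr \<eta>' * exp ((\<beta> - \<gamma>) / 2 * R powr (2 * l)) \<le> C1 * C2 * B"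
      unfolding fock_weighted_peak_fun_center by (simp add: w M_def)
    also have "C1 * C2 * B = M * (1 + R) powr \<eta>' * (C1 * C2 * K * (1 + R) powr (\<rho> - \<eta>') * R powr (- x))"
      using R by (simp add: B_def powr_diff)
    finally have "exp ((\<beta> - \<gamma>) / 2 * R powr (2 * l)) \<le> C1 * C2 * K * (1 + R) powr (\<rho> - \<eta>') * R powr (- x)"
      using M R by (subst (asm) mult_le_cancel_left_pos) auto
    \<comment> \<open>Replacing \<open>R\<close> by the smaller \<open>(1 + R) / 2\<close> leaves a
      single power of \<open>1 + R\<close>; as \<open>x \<ge> 0\<close>, the cost is the factor
      \<open>2 powr x\<close> in \<open>L\<close>.\<close>
    also have "\<dots> \<le> C1 * C2 * K * (1 + R) powr (\<rho> - \<eta>') * ((1 + R) / 2) powr (- x)"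
      using R x0 C1 C2 K by (intro mult_left_mono powr_mono2') auto
    also have "((1 + R) / 2) powr (- x) = 2 powr x * (1 + R) powr (- x)"
      using R by (simp add: powr_divide powr_minus field_simps)
    also have "C1 * C2 * K * (1 + R) powr (\<rho> - \<eta>') * (2 powr x * (1 + R) powr (- x)) = L * (1 + R) powr \<sigma>"
      using R by (simp add: L_def \<sigma>_def powr_diff powr_minus powr_add field_simps)
    finally show ?thesis .
  qed
  have "\<beta> \<le> \<gamma>"
  proof (rule ccontr)
    assume "\<not> \<beta> \<le> \<gamma>"
    \<comment> \<open>Half of the available rate \<open>(\<beta> - \<gamma>) / 2\<close>; the other
      half absorbs the power of \<open>1 + R\<close>.\<close>
    define k where "k = (\<beta> - \<gamma>) / 4"
    have k: "k > 0" using \<open>\<not> \<beta> \<le> \<gamma>\<close> by (simp add: k_def)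
    define H where "H = L * exp (\<sigma>\<^sup>2 / (4 * k))"
    have H: "H > 0" using L by (simp add: H_def)
    \<comment> \<open>Then \<open>k * R\<^sup>2 \<ge> k * R = k + H\<close>, against
      \<open>1 + k * R\<^sup>2 \<le> exp (k * R\<^sup>2) \<le> H\<close>.\<close>
    define R where "R = 1 + H / k"
    have R: "R \<ge> 1" using H k by (simp add: R_def)
    have "R powr 2 \<le> R powr (2 * l)" using R l by (intro powr_mono) auto
    then have "2 * k * R\<^sup>2 \<le> 2 * k * R powr (2 * l)" using k R by simp
    moreover have "2 * k = (\<beta> - \<gamma>) / 2" by (simp add: k_def)
    ultimately have "exp (2 * k * R\<^sup>2) \<le> exp ((\<beta> - \<gamma>) / 2 * R powr (2 * l))"
      by (simp only: exp_le_cancel_iff)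
    also have "\<dots> \<le> L * (1 + R) powr \<sigma>" using R by (rule main)
    also have "\<dots> \<le> L * (exp (\<sigma>\<^sup>2 / (4 * k)) * exp (k * R\<^sup>2))"
      using L R k by (intro mult_left_mono powr_le_exp_square) auto
    finally have "exp (k * R\<^sup>2) * exp (k * R\<^sup>2) \<le> H * exp (k * R\<^sup>2)"
      by (simp add: H_def mult.assoc flip: exp_add)
    then have "exp (k * R\<^sup>2) \<le> H" by simp
    moreover have "1 + k * R\<^sup>2 \<le> exp (k * R\<^sup>2)" by (rule exp_ge_add_one_self)
    moreover have "k * R * 1 \<le> k * R * R" using k R by (intro mult_left_mono) auto
    moreover have "k * R * R = k * R\<^sup>2" by (simp add: power2_eq_square)
    moreover have "k * R = k + H" using k by (simp add: R_def field_simps)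
    ultimately show False using k by linarith
  qed
  moreover have "\<sigma> \<ge> 0" if "\<beta> = \<gamma>"
  proof (rule ccontr)
    assume \<sigma>: "\<not> \<sigma> \<ge> 0"
    \<comment> \<open>Solves \<open>R powr \<sigma> = 1 / (1 + L)\<close>, which would give
      \<open>1 \<le> L / (1 + L)\<close>.\<close>
    define R where "R = (1 + L) powr (- 1 / \<sigma>)"
    have "(1 + L) powr 0 \<le> (1 + L) powr (- 1 / \<sigma>)" using L \<sigma> by (intro powr_mono) (auto simp: divide_nonpos_neg)
    then have R: "R \<ge> 1" using L by (simp add: R_def)
    have "1 \<le> L * (1 + R) powr \<sigma>" using main[OF R] that by simp
    also have "\<dots> \<le> L * R powr \<sigma>" using R \<sigma> L by (intro mult_left_mono powr_mono2') auto
    also have "R powr \<sigma> = 1 / (1 + L)"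
    proof -
      have "- 1 / \<sigma> * \<sigma> = - 1" using \<sigma> by simp
      then have "R powr \<sigma> = (1 + L) powr (- 1)" unfolding R_def powr_powr by (simp only:)
      also have "\<dots> = 1 / (1 + L)" using L by (subst powr_minus_divide) simp
      finally show ?thesis .
    qed
    finally show False using L by (simp add: field_simps)
  qed
  ultimately show ?thesis
    by (auto simp: \<sigma>_def \<eta>'_def x_def d_def algebra_simps)
qed

section \<open>Monomials with square exponents\<close>

definition freq_vec :: "('n::finite \<Rightarrow> nat) \<Rightarrow> real ^ 'n" where
  "freq_vec j = (\<chi> i. real (j i))"

text \<open>Stationarity of the logarithm of the weighted monomial in \<open>norm (z $ i)\<close>
  reads \<open>(j i)\<^sup>2 = \<beta> * l * norm z powr (2 * l - 2) * (norm (z $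
  i))\<^sup>2\<close>. In these coordinates this is the equation
  \<open>moduli_vec l \<beta> z = freq_vec j\<close>.\<close>

definition moduli_vec :: "real \<Rightarrow> real \<Rightarrow> complex ^ 'n \<Rightarrow> real ^ 'n" where
  "moduli_vec l \<beta> z = (\<chi> i. sqrt (\<beta> * l) * norm z powr (l - 1) * norm (z $ i))"

definition peak_radius :: "real \<Rightarrow> real \<Rightarrow> ('n::finite \<Rightarrow> nat) \<Rightarrow> real" where
  "peak_radius l \<beta> j = (norm (freq_vec j) / sqrt (\<beta> * l)) powr (1 / l)"

text \<open>The maximum over \<open>z\<close> of \<open>|z^(j^2)| exp (- (\<beta> / 2) |z|^(2 l))\<close>, attained where
  \<open>|z|\<close> is \<open>peak_radius l \<beta> j\<close> and \<open>(|z_1|, ..., |z_n|)\<close> is parallel to \<open>j\<close>.\<close>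

definition monomial_peak :: "real \<Rightarrow> real \<Rightarrow> ('n::finite \<Rightarrow> nat) \<Rightarrow> real" where
  "monomial_peak l \<beta> j = (\<Prod>i\<in>UNIV. (peak_radius l \<beta> j * real (j i) / norm (freq_vec j)) ^ (j i)\<^sup>2)
     * exp (- (norm (freq_vec j))\<^sup>2 / (2 * l))"

definition square_monomial :: "('n::finite \<Rightarrow> nat) \<Rightarrow> complex ^ 'n \<Rightarrow> complex" where
  "square_monomial j z = (\<Prod>i\<in>UNIV. z $ i ^ (j i)\<^sup>2)"

lemma norm_moduli_vec:
  assumes "l \<ge> 1" "\<beta> > 0"
  shows "norm (moduli_vec l \<beta> z) = sqrt (\<beta> * l) * norm z powr l"
proof (cases "z = 0")
  case False
  have "moduli_vec l \<beta> z = (sqrt (\<beta> * l) * norm z powr (l - 1)) *\<^sub>R (\<chi> i. norm (z $ i))"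
    by (simp add: moduli_vec_def vec_eq_iff)
  moreover have "norm (\<chi> i. norm (z $ i)) = norm z" by (simp add: norm_vec_def)
  moreover have "norm z powr (l - 1) * norm z = norm z powr l" using False by (simp add: powr_diff)
  ultimately show ?thesis using assms by (simp add: mult.assoc)
qed (simp add: moduli_vec_def zero_vec_def[symmetric])

lemma moduli_vec_direction:
  fixes z :: "complex ^ 'n"
  assumes "l \<ge> 1" "\<beta> > 0" "z \<noteq> 0"
  shows "norm (\<chi> i. norm (z $ i) / norm z) = 1"
    and "moduli_vec l \<beta> z = norm (moduli_vec l \<beta> z) *\<^sub>R (\<chi> i. norm (z $ i) / norm z)"
proof -
  have "(\<chi> i. norm (z $ i) / norm z) = (1 / norm z) *\<^sub>R (\<chi> i. norm (z $ i))"
    by (simp add: vec_eq_iff)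
  moreover have "norm (\<chi> i. norm (z $ i)) = norm z" by (simp add: norm_vec_def)
  ultimately show "norm (\<chi> i. norm (z $ i) / norm z) = 1" using assms by simp
  show "moduli_vec l \<beta> z = norm (moduli_vec l \<beta> z) *\<^sub>R (\<chi> i. norm (z $ i) / norm z)"
    using assms by (simp add: norm_moduli_vec) (simp add: moduli_vec_def vec_eq_iff powr_diff)
qed

lemma norm_vec_power2: "(norm (v :: real ^ 'n))\<^sup>2 = (\<Sum>i\<in>UNIV. (v $ i)\<^sup>2)"
  by (simp add: norm_vec_def L2_set_def sum_nonneg)

lemma norm_freq_vec: "(norm (freq_vec j))\<^sup>2 = (\<Sum>i\<in>UNIV. (real (j i))\<^sup>2)"
  by (simp add: norm_vec_power2 freq_vec_def)

lemma freq_vec_nth [simp]: "freq_vec j $ i = real (j i)"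
  by (simp add: freq_vec_def)

text \<open>Both \<open>freq_vec j\<close> and \<open>N *\<^sub>R u\<close> have norm
  \<open>N\<close>, so their inner product minus \<open>N\<^sup>2\<close> is minus half their
  squared distance. This turns first-order bounds for the logarithm into Gaussian ones.\<close>

lemma sum_freq_vec_unit:
  fixes u :: "real ^ 'n" and j :: "'n \<Rightarrow> nat"
  assumes "norm u = 1"
  defines "N \<equiv> norm (freq_vec j)"
  shows "(\<Sum>i\<in>UNIV. real (j i) * (u $ i * N) - (real (j i))\<^sup>2) = - (norm (freq_vec j - N *\<^sub>R u))\<^sup>2 / 2"
proof -
  have N2: "(\<Sum>i\<in>UNIV. (real (j i))\<^sup>2) = N\<^sup>2" by (simp add: N_def norm_freq_vec)
  have "(\<Sum>i\<in>UNIV. real (j i) * (u $ i * N) - (real (j i))\<^sup>2) = N * (freq_vec j \<bullet> u) - N\<^sup>2"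
    by (simp add: sum_subtractf N2 inner_vec_def sum_distrib_left mult_ac)
  also have "\<dots> = - (norm (freq_vec j - N *\<^sub>R u))\<^sup>2 / 2"
  proof -
    have "freq_vec j \<bullet> freq_vec j = N\<^sup>2" "u \<bullet> u = 1"
      using assms(1) by (simp_all add: N_def power2_norm_eq_inner norm_eq_1)
    moreover have "(norm (freq_vec j - N *\<^sub>R u))\<^sup>2 = freq_vec j \<bullet> freq_vec j - 2 * N * (freq_vec j \<bullet> u) + N\<^sup>2 * (u \<bullet> u)"
      by (simp add: power2_norm_eq_inner inner_diff_left inner_diff_right inner_commute)
         (simp add: power2_eq_square algebra_simps)
    ultimately show ?thesis by simp
  qed
  finally show ?thesis .
qed

lemma freq_vec_eq_0_iff: "freq_vec j = 0 \<longleftrightarrow> (\<forall>i. j i = 0)"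
  by (simp add: freq_vec_def vec_eq_iff)

lemma peak_radius_powr:
  assumes "l \<ge> 1" "\<beta> > 0"
  shows "sqrt (\<beta> * l) * peak_radius l \<beta> j powr l = norm (freq_vec j)"
  using assms by (simp add: peak_radius_def powr_powr)

lemma peak_radius_pos:
  assumes "l \<ge> 1" "\<beta> > 0" "freq_vec j \<noteq> 0"
  shows "peak_radius l \<beta> j > 0"
  using assms by (simp add: peak_radius_def)

text \<open>A coordinate with \<open>j i = 0\<close> contributes a zeroth power, so the value 0 of
  the quotient at \<open>freq_vec j = 0\<close> is harmless.\<close>

lemma monomial_peak_pos:
  assumes "l \<ge> 1" "\<beta> > 0"
  shows "monomial_peak l \<beta> j > 0"
proof -
  have "(peak_radius l \<beta> j * real (j i) / norm (freq_vec j)) ^ (j i)\<^sup>2 > 0" for i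
  proof (cases "j i = 0")
    case False
    then have "freq_vec j \<noteq> 0" by (auto simp: freq_vec_eq_0_iff)
    with False assms peak_radius_pos[OF assms this] show ?thesis by auto
  qed simp
  then show ?thesis by (simp add: monomial_peak_def prod_pos)
qed

lemma entire_square_monomial: "entire (square_monomial j)"
  unfolding square_monomial_def by (intro entire_prod entire_power entire_nth)

text \<open>An exact factorization into the peak value, an angular factor and a radial one. The
  total degree is \<open>N\<^sup>2\<close>, and \<open>y\<close> is the \<open>l\<close>-th power of
  \<open>norm z / peak_radius l \<beta> j\<close>, so the radial exponent vanishes to second order
  at \<open>y = 1\<close>. Angular factors with \<open>j i = 0\<close> are zeroth powers and equal 1
  despite the division by 0.\<close>

lemma square_monomial_split:
  fixes j :: "'n::finite \<Rightarrow> nat" and z :: "complex ^ 'n"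
  assumes l: "l \<ge> 1" and \<beta>: "\<beta> > 0" and j: "freq_vec j \<noteq> 0" and z: "z \<noteq> 0"
  defines "N \<equiv> norm (freq_vec j)"
  defines "y \<equiv> norm (moduli_vec l \<beta> z) / N"
  shows "norm (square_monomial j z) * exp (- (\<beta> / 2) * norm z powr (2 * l)) =
    monomial_peak l \<beta> j * (\<Prod>i\<in>UNIV. (norm (z $ i) / norm z * N / real (j i)) ^ (j i)\<^sup>2)
      * exp (N\<^sup>2 / l * (ln y - (y\<^sup>2 - 1) / 2))"
proof -
  define R r where "R = peak_radius l \<beta> j" and "r = norm z"
  have N: "N > 0" using j by (simp add: N_def)
  have R: "R > 0" unfolding R_def using l \<beta> j by (rule peak_radius_pos)
  have r: "r > 0" using z by (simp add: r_def)
  have s: "sqrt (\<beta> * l) > 0" using l \<beta> by simp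
  have V: "norm (moduli_vec l \<beta> z) = sqrt (\<beta> * l) * r powr l"
    unfolding r_def using l \<beta> by (rule norm_moduli_vec)
  have NR: "N = sqrt (\<beta> * l) * R powr l"
    unfolding N_def R_def using l \<beta> by (simp only: peak_radius_powr)
  have y: "y = (r / R) powr l"
    unfolding y_def V NR using l \<beta> r R by (simp add: powr_divide)
  have y0: "y > 0" using r R by (simp add: y)
  have lny: "ln y = l * ln (r / R)" using r R by (simp add: y ln_powr)
  have y2: "N\<^sup>2 * y\<^sup>2 = \<beta> * l * r powr (2 * l)"
  proof -
    have "N * y = sqrt (\<beta> * l) * r powr l" using N by (simp add: y_def V)
    then have "(N * y)\<^sup>2 = \<beta> * l * (r powr l)\<^sup>2" using l \<beta> by (simp add: power_mult_distrib)
    also have "(r powr l)\<^sup>2 = r powr (2 * l)" by (simp add: power2_eq_square flip: powr_add)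
    finally show ?thesis by (simp add: power_mult_distrib)
  qed
  have "norm (square_monomial j z) = (\<Prod>i\<in>UNIV. norm (z $ i) ^ (j i)\<^sup>2)"
    by (simp add: square_monomial_def norm_power flip: prod_norm)
  also have "\<dots> = (\<Prod>i\<in>UNIV. (R * real (j i) / N) ^ (j i)\<^sup>2 * (norm (z $ i) / r * N / real (j i)) ^ (j i)\<^sup>2 * (r / R) ^ (j i)\<^sup>2)"
  proof (rule prod.cong)
    fix i
    show "norm (z $ i) ^ (j i)\<^sup>2 = (R * real (j i) / N) ^ (j i)\<^sup>2 * (norm (z $ i) / r * N / real (j i)) ^ (j i)\<^sup>2 * (r / R) ^ (j i)\<^sup>2"
    proof (cases "j i = 0")
      case False
      then have "norm (z $ i) = (R * real (j i) / N) * (norm (z $ i) / r * N / real (j i)) * (r / R)"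
        using R r N by simp
      then show ?thesis by (metis power_mult_distrib)
    qed simp
  qed simp
  also have "\<dots> = (\<Prod>i\<in>UNIV. (R * real (j i) / N) ^ (j i)\<^sup>2) * (\<Prod>i\<in>UNIV. (norm (z $ i) / r * N / real (j i)) ^ (j i)\<^sup>2)
      * (r / R) ^ (\<Sum>i\<in>UNIV. (j i)\<^sup>2)"
    by (simp add: prod.distrib power_sum)
  also have "(r / R) ^ (\<Sum>i\<in>UNIV. (j i)\<^sup>2) = exp (N\<^sup>2 / l * ln y)"
  proof -
    have "real (\<Sum>i\<in>UNIV. (j i)\<^sup>2) = N\<^sup>2" by (simp add: N_def norm_freq_vec)
    then have "(r / R) ^ (\<Sum>i\<in>UNIV. (j i)\<^sup>2) = exp (N\<^sup>2 * ln (r / R))"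
      using r R by (simp add: exp_of_nat_mult flip: \<open>_ = N\<^sup>2\<close> del: of_nat_sum)
    then show ?thesis using l by (simp add: lny)
  qed
  finally have "norm (square_monomial j z) * exp (- (\<beta> / 2) * r powr (2 * l))
     = (\<Prod>i\<in>UNIV. (R * real (j i) / N) ^ (j i)\<^sup>2) * (\<Prod>i\<in>UNIV. (norm (z $ i) / r * N / real (j i)) ^ (j i)\<^sup>2)
      * (exp (N\<^sup>2 / l * ln y) * exp (- (\<beta> / 2) * r powr (2 * l)))" by simp
  also have "exp (N\<^sup>2 / l * ln y) * exp (- (\<beta> / 2) * r powr (2 * l))
     = exp (- N\<^sup>2 / (2 * l)) * exp (N\<^sup>2 / l * (ln y - (y\<^sup>2 - 1) / 2))"
  proof -
    have "- (\<beta> / 2) * r powr (2 * l) = - (N\<^sup>2 * y\<^sup>2) / (2 * l)" using l by (simp add: y2)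
    then show ?thesis using l by (simp add: field_simps flip: exp_add)
  qed
  finally show ?thesis
    by (simp add: monomial_peak_def R_def r_def N_def mult_ac)
qed

text \<open>Apply \<open>ln t \<le> t - 1\<close> in both factors: the angular one is at most
  \<open>exp (- a\<^sup>2 / 2)\<close> and the radial one at most
  \<open>exp (- b\<^sup>2 / (2 * l))\<close>, where \<open>a\<close> is the distance of
  \<open>freq_vec j\<close> from the direction of \<open>z\<close> scaled to norm \<open>N\<close>,
  and \<open>b\<close> the difference of the norms. The squared distance is at most
  \<open>2 * a\<^sup>2 + 2 * b\<^sup>2\<close>, whence the rate \<open>1 / (4 * l)\<close>.\<close>

lemma square_monomial_le:
  fixes j :: "'n::finite \<Rightarrow> nat" and z :: "complex ^ 'n"
  assumes l: "l \<ge> 1" and \<beta>: "\<beta> > 0"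
  shows "norm (square_monomial j z) * exp (- (\<beta> / 2) * norm z powr (2 * l)) \<le>
    monomial_peak l \<beta> j * exp (- (1 / (4 * l)) * (norm (freq_vec j - moduli_vec l \<beta> z))\<^sup>2)"
proof (cases "freq_vec j = 0")
  case True
  then have j: "j i = 0" for i by (simp add: freq_vec_eq_0_iff)
  have "(norm (moduli_vec l \<beta> z))\<^sup>2 = \<beta> * l * norm z powr (2 * l)"
    using l \<beta> by (simp add: norm_moduli_vec power_mult_distrib) (simp add: power2_eq_square flip: powr_add)
  then have "(1 / (4 * l)) * (norm (freq_vec j - moduli_vec l \<beta> z))\<^sup>2 = \<beta> / 4 * norm z powr (2 * l)"
    using l by (simp add: True)
  moreover have "\<beta> / 4 * norm z powr (2 * l) \<le> \<beta> / 2 * norm z powr (2 * l)"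
    using \<beta> by (intro mult_right_mono) auto
  ultimately show ?thesis by (simp add: j square_monomial_def monomial_peak_def True)
next
  case j: False
  show ?thesis
  proof (cases "z = 0")
    case True
    obtain i where "j i \<noteq> 0" using j by (auto simp: freq_vec_eq_0_iff)
    then have "square_monomial j z = 0" by (auto simp: True square_monomial_def)
    then show ?thesis using monomial_peak_pos[OF l \<beta>, of j] by simp
  next
    case z: False
    define N V y where "N = norm (freq_vec j)" and "V = norm (moduli_vec l \<beta> z)" and "y = V / N"
    define u :: "real ^ 'n" where "u = (\<chi> i. norm (z $ i) / norm z)"
    have N: "N > 0" using j by (simp add: N_def)
    have V: "V > 0" using z l \<beta> by (simp add: V_def norm_moduli_vec)
    have u: "norm u = 1" and Vu: "moduli_vec l \<beta> z = V *\<^sub>R u"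
      unfolding u_def V_def using l \<beta> z by (rule moduli_vec_direction)+
    have y0: "y > 0" using N V by (simp add: y_def)
    have dir: "(\<Prod>i\<in>UNIV. (norm (z $ i) / norm z * N / real (j i)) ^ (j i)\<^sup>2) \<le> exp (- (norm (freq_vec j - N *\<^sub>R u))\<^sup>2 / 2)"
    proof -
      have "(\<Prod>i\<in>UNIV. (norm (z $ i) / norm z * N / real (j i)) ^ (j i)\<^sup>2)
        \<le> (\<Prod>i\<in>UNIV. exp (real (j i) * (u $ i * N) - (real (j i))\<^sup>2))"
      proof (intro prod_mono conjI)
        fix i
        let ?t = "norm (z $ i) / norm z * N / real (j i)"
        show "0 \<le> ?t ^ (j i)\<^sup>2" using N by simp
        show "?t ^ (j i)\<^sup>2 \<le> exp (real (j i) * (u $ i * N) - (real (j i))\<^sup>2)"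
        proof (cases "j i = 0")
          case False
          have "?t ^ (j i)\<^sup>2 \<le> exp (?t - 1) ^ (j i)\<^sup>2"
            using N exp_ge_add_one_self[of "?t - 1"] by (intro power_mono) auto
          also have "\<dots> = exp ((real (j i))\<^sup>2 * (?t - 1))"
            using exp_of_nat_mult[of "(j i)\<^sup>2" "?t - 1"] by simp
          also have "(real (j i))\<^sup>2 * (?t - 1) = real (j i) * (u $ i * N) - (real (j i))\<^sup>2"
            using False by (simp add: u_def power2_eq_square field_simps)
          finally show ?thesis .
        qed simp
      qed
      also have "\<dots> = exp (\<Sum>i\<in>UNIV. real (j i) * (u $ i * N) - (real (j i))\<^sup>2)" by (simp add: exp_sum)
      also have "(\<Sum>i\<in>UNIV. real (j i) * (u $ i * N) - (real (j i))\<^sup>2) = - (norm (freq_vec j - N *\<^sub>R u))\<^sup>2 / 2"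
        unfolding N_def using u by (rule sum_freq_vec_unit)
      finally show ?thesis .
    qed
    have rad: "N\<^sup>2 / l * (ln y - (y\<^sup>2 - 1) / 2) \<le> - (V - N)\<^sup>2 / (2 * l)"
    proof -
      have "ln y \<le> y - 1" using y0 by (rule ln_le_minus_one)
      then have "N\<^sup>2 / l * (ln y - (y\<^sup>2 - 1) / 2) \<le> N\<^sup>2 / l * (y - 1 - (y\<^sup>2 - 1) / 2)"
        using l by (intro mult_left_mono) auto
      also have "\<dots> = - (V - N)\<^sup>2 / (2 * l)"
        using N l by (simp add: y_def power2_eq_square field_simps)
      finally show ?thesis .
    qed
    have "(norm (freq_vec j - moduli_vec l \<beta> z))\<^sup>2 \<le> 2 * (norm (freq_vec j - N *\<^sub>R u))\<^sup>2 + 2 * (V - N)\<^sup>2"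
    proof -
      have "norm (freq_vec j - moduli_vec l \<beta> z) \<le> norm (freq_vec j - N *\<^sub>R u) + norm ((N - V) *\<^sub>R u)"
        unfolding Vu by (rule order_trans[OF _ norm_triangle_ineq]) (simp add: algebra_simps)
      also have "\<dots> = norm (freq_vec j - N *\<^sub>R u) + \<bar>V - N\<bar>" using u by (simp add: abs_minus_commute)
      finally have "(norm (freq_vec j - moduli_vec l \<beta> z))\<^sup>2 \<le> (norm (freq_vec j - N *\<^sub>R u) + \<bar>V - N\<bar>)\<^sup>2"
        by (intro power_mono) auto
      moreover have "0 \<le> (norm (freq_vec j - N *\<^sub>R u) - \<bar>V - N\<bar>)\<^sup>2" by simp
      ultimately show ?thesis by (simp add: power2_eq_square algebra_simps)
    qed
    then have "(1 / (4 * l)) * (norm (freq_vec j - moduli_vec l \<beta> z))\<^sup>2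
       \<le> (1 / (4 * l)) * (2 * (norm (freq_vec j - N *\<^sub>R u))\<^sup>2 + 2 * (V - N)\<^sup>2)"
      using l by (intro mult_left_mono) auto
    also have "\<dots> = (norm (freq_vec j - N *\<^sub>R u))\<^sup>2 / (2 * l) + (V - N)\<^sup>2 / (2 * l)"
      using l by (simp add: field_simps)
    also have "(norm (freq_vec j - N *\<^sub>R u))\<^sup>2 / (2 * l) \<le> (norm (freq_vec j - N *\<^sub>R u))\<^sup>2 / 2"
      using l by (intro divide_left_mono) auto
    finally have comb: "- (norm (freq_vec j - N *\<^sub>R u))\<^sup>2 / 2 + - (V - N)\<^sup>2 / (2 * l)
      \<le> - (1 / (4 * l)) * (norm (freq_vec j - moduli_vec l \<beta> z))\<^sup>2" by simp
    have "norm (square_monomial j z) * exp (- (\<beta> / 2) * norm z powr (2 * l)) =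
      monomial_peak l \<beta> j * ((\<Prod>i\<in>UNIV. (norm (z $ i) / norm z * N / real (j i)) ^ (j i)\<^sup>2)
      * exp (N\<^sup>2 / l * (ln y - (y\<^sup>2 - 1) / 2)))"
      using square_monomial_split[OF l \<beta> j z] by (simp add: N_def V_def y_def)
    also have "\<dots> \<le> monomial_peak l \<beta> j * (exp (- (norm (freq_vec j - N *\<^sub>R u))\<^sup>2 / 2) * exp (- (V - N)\<^sup>2 / (2 * l)))"
      using monomial_peak_pos[OF l \<beta>, of j] dir rad N
      by (intro mult_left_mono mult_mono) (auto intro!: prod_nonneg)
    also have "\<dots> \<le> monomial_peak l \<beta> j * exp (- (1 / (4 * l)) * (norm (freq_vec j - moduli_vec l \<beta> z))\<^sup>2)"
      using monomial_peak_pos[OF l \<beta>, of j] comb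
      unfolding exp_add[symmetric] by (intro mult_left_mono) auto
    finally show ?thesis .
  qed
qed

lemma ln_ge_quadratic:
  fixes t :: real
  assumes "t \<ge> 1 / 2" shows "ln t \<ge> (t - 1) - 2 * (t - 1)\<^sup>2"
proof (cases "t \<le> 3 / 2")
  case True
  then have "\<bar>t - 1\<bar> \<le> 1 / 2" using assms by linarith
  from abs_ln_one_plus_x_minus_x_bound[OF this] show ?thesis by (simp add: abs_le_iff)
next
  case False
  then have "(t - 1) * (1 / 2) \<le> (t - 1) * (t - 1)" by (intro mult_left_mono) auto
  then have "(t - 1) - 2 * (t - 1)\<^sup>2 \<le> 0" by (simp add: power2_eq_square)
  also have "0 \<le> ln t" using False by simp
  finally show ?thesis .
qed

lemma norm_vec_power2_le_card:
  fixes v :: "real ^ 'n"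
  assumes "\<And>i. \<bar>v $ i\<bar> \<le> 1" shows "(norm v)\<^sup>2 \<le> real CARD('n)"
proof -
  have "(norm v)\<^sup>2 = (\<Sum>i\<in>UNIV. (v $ i)\<^sup>2)" by (rule norm_vec_power2)
  also have "\<dots> \<le> (\<Sum>i\<in>(UNIV :: 'n set). 1)"
    using assms by (intro sum_mono) (simp add: abs_square_le_1)
  finally show ?thesis by simp
qed

lemma norm_mono_vec:
  fixes u v :: "real ^ 'n"
  assumes "\<And>i. 0 \<le> u $ i" "\<And>i. u $ i \<le> v $ i"
  shows "norm u \<le> norm v"
  using assms order_trans[OF assms] unfolding norm_vec_def by (intro L2_set_mono) auto

text \<open>Rounding up moves each coordinate by at most 1, and coordinates above 1 at most double.
  All ratios entering a logarithm are therefore at least \<open>1 / 2\<close>, where a quadratic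
  lower bound for \<open>ln\<close> is available; the upper estimate is then sharp up to a
  constant.\<close>

lemma square_monomial_ge:
  fixes z :: "complex ^ 'n"
  assumes l: "l \<ge> 1" and \<beta>: "\<beta> > 0" and big: "\<And>i. moduli_vec l \<beta> z $ i > 1"
  defines "j \<equiv> (\<lambda>i. nat \<lceil>moduli_vec l \<beta> z $ i\<rceil>)"
  shows "monomial_peak l \<beta> j * exp (- 13 * real CARD('n)) \<le>
      norm (square_monomial j z) * exp (- (\<beta> / 2) * norm z powr (2 * l))"
    and "(norm (freq_vec j - moduli_vec l \<beta> z))\<^sup>2 \<le> real CARD('n)"
proof -
  let ?x = "moduli_vec l \<beta> z"
  define N V y where "N = norm (freq_vec j)" and "V = norm ?x" and "y = V / N"
  define u :: "real ^ 'n" where "u = (\<chi> i. norm (z $ i) / norm z)"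
  have ji: "?x $ i \<le> real (j i)" "real (j i) \<le> ?x $ i + 1" "j i \<ge> 2" for i
    using big[of i] unfolding j_def by linarith+
  show 1: "(norm (freq_vec j - ?x))\<^sup>2 \<le> real CARD('n)"
  proof (rule norm_vec_power2_le_card)
    show "\<bar>(freq_vec j - ?x) $ i\<bar> \<le> 1" for i using ji[of i] by (simp add: freq_vec_def)
  qed
  have z: "z \<noteq> 0" using big by (auto simp: moduli_vec_def dest: spec)
  have j: "freq_vec j \<noteq> 0" using ji(3) unfolding freq_vec_eq_0_iff by (metis not_numeral_le_zero)
  have N: "N > 0" using j by (simp add: N_def)
  have V: "V > 0" using z l \<beta> by (simp add: V_def norm_moduli_vec)
  have u: "norm u = 1" and Vu: "?x = V *\<^sub>R u"
    unfolding u_def V_def using l \<beta> z by (rule moduli_vec_direction)+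
  have u0: "u $ i \<ge> 0" for i by (simp add: u_def)
  have VN: "V \<le> N"
    unfolding V_def N_def using ji(1) big by (intro norm_mono_vec) (auto simp: freq_vec_def intro: less_imp_le order_trans[OF zero_le_one])
  have NV2: "N \<le> 2 * V"
  proof -
    have "N \<le> norm (2 *\<^sub>R ?x)" unfolding N_def
    proof (rule norm_mono_vec)
      show "freq_vec j $ i \<le> (2 *\<^sub>R ?x) $ i" for i using ji[of i] big[of i] by (simp add: freq_vec_def)
    qed (simp add: freq_vec_def)
    then show ?thesis by (simp add: V_def)
  qed
  have dNV: "(N - V)\<^sup>2 \<le> real CARD('n)"
  proof -
    have "\<bar>N - V\<bar> \<le> norm (freq_vec j - ?x)" unfolding N_def V_def by (rule norm_triangle_ineq3)
    then have "(N - V)\<^sup>2 \<le> (norm (freq_vec j - ?x))\<^sup>2" by (metis abs_ge_zero power2_abs power_mono)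
    with 1 show ?thesis by linarith
  qed
  have a: "(norm (freq_vec j - N *\<^sub>R u))\<^sup>2 \<le> 4 * real CARD('n)"
  proof -
    have "norm (freq_vec j - N *\<^sub>R u) \<le> norm (freq_vec j - ?x) + norm ((V - N) *\<^sub>R u)"
      unfolding Vu by (rule order_trans[OF _ norm_triangle_ineq]) (simp add: algebra_simps)
    also have "\<dots> = norm (freq_vec j - ?x) + \<bar>N - V\<bar>" using u by (simp add: abs_minus_commute)
    finally have "(norm (freq_vec j - N *\<^sub>R u))\<^sup>2 \<le> (norm (freq_vec j - ?x) + \<bar>N - V\<bar>)\<^sup>2"
      by (intro power_mono) auto
    moreover have "0 \<le> (norm (freq_vec j - ?x) - \<bar>N - V\<bar>)\<^sup>2" by simp
    moreover have "(norm (freq_vec j - ?x) + \<bar>N - V\<bar>)\<^sup>2 + (norm (freq_vec j - ?x) - \<bar>N - V\<bar>)\<^sup>2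
       = 2 * (norm (freq_vec j - ?x))\<^sup>2 + 2 * (N - V)\<^sup>2"
      by (simp add: power2_eq_square algebra_simps)
    ultimately show ?thesis using 1 dNV by linarith
  qed
  have y: "y \<ge> 1 / 2" using NV2 N by (simp add: y_def field_simps)
  have dir: "exp (- (5 / 2) * (norm (freq_vec j - N *\<^sub>R u))\<^sup>2) \<le> (\<Prod>i\<in>UNIV. (norm (z $ i) / norm z * N / real (j i)) ^ (j i)\<^sup>2)"
  proof -
    define t where "t i = u $ i * N / real (j i)" for i
    have t: "t i \<ge> 1 / 2" for i
    proof -
      have "real (j i) / 2 \<le> ?x $ i" using ji[of i] big[of i] by simp
      also have "\<dots> = V * u $ i" by (simp add: Vu)
      also have "\<dots> \<le> N * u $ i" using VN u0 by (intro mult_right_mono)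
      finally show ?thesis using ji(3)[of i] by (simp add: t_def field_simps)
    qed
    have "(norm (freq_vec j - N *\<^sub>R u))\<^sup>2 = (\<Sum>i\<in>UNIV. (real (j i) - u $ i * N)\<^sup>2)"
      by (simp add: norm_vec_power2 freq_vec_def mult_ac)
    also have "\<dots> = (\<Sum>i\<in>UNIV. (real (j i))\<^sup>2 * (t i - 1)\<^sup>2)"
    proof (intro sum.cong refl)
      fix i
      have "u $ i * N = real (j i) * t i" using ji(3)[of i] by (simp add: t_def)
      then have "(real (j i) - u $ i * N)\<^sup>2 = (real (j i) * (t i - 1))\<^sup>2" by (simp add: power2_eq_square algebra_simps)
      then show "(real (j i) - u $ i * N)\<^sup>2 = (real (j i))\<^sup>2 * (t i - 1)\<^sup>2" by (simp add: power_mult_distrib)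
    qed
    finally have sq: "(norm (freq_vec j - N *\<^sub>R u))\<^sup>2 = (\<Sum>i\<in>UNIV. (real (j i))\<^sup>2 * (t i - 1)\<^sup>2)" .
    have lin: "(\<Sum>i\<in>UNIV. (real (j i))\<^sup>2 * (t i - 1)) = - (norm (freq_vec j - N *\<^sub>R u))\<^sup>2 / 2"
    proof -
      have "(\<Sum>i\<in>UNIV. (real (j i))\<^sup>2 * (t i - 1)) = (\<Sum>i\<in>UNIV. real (j i) * (u $ i * N) - (real (j i))\<^sup>2)"
      proof (intro sum.cong refl)
        fix i
        have "u $ i * N = real (j i) * t i" using ji(3)[of i] by (simp add: t_def)
        then show "(real (j i))\<^sup>2 * (t i - 1) = real (j i) * (u $ i * N) - (real (j i))\<^sup>2"
          by (simp add: power2_eq_square algebra_simps)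
      qed
      also have "\<dots> = - (norm (freq_vec j - N *\<^sub>R u))\<^sup>2 / 2"
        unfolding N_def using u by (rule sum_freq_vec_unit)
      finally show ?thesis .
    qed
    have "- (5 / 2) * (norm (freq_vec j - N *\<^sub>R u))\<^sup>2 = (\<Sum>i\<in>UNIV. (real (j i))\<^sup>2 * (t i - 1)) - 2 * (\<Sum>i\<in>UNIV. (real (j i))\<^sup>2 * (t i - 1)\<^sup>2)"
      unfolding lin sq[symmetric] by simp
    also have "\<dots> = (\<Sum>i\<in>UNIV. (real (j i))\<^sup>2 * ((t i - 1) - 2 * (t i - 1)\<^sup>2))"
      by (simp add: sum_distrib_left algebra_simps flip: sum_subtractf)
    also have "\<dots> \<le> (\<Sum>i\<in>UNIV. (real (j i))\<^sup>2 * ln (t i))"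
      using t by (intro sum_mono mult_left_mono ln_ge_quadratic) auto
    finally have "exp (- (5 / 2) * (norm (freq_vec j - N *\<^sub>R u))\<^sup>2) \<le> exp (\<Sum>i\<in>UNIV. (real (j i))\<^sup>2 * ln (t i))"
      by (simp only: exp_le_cancel_iff)
    also have "\<dots> = (\<Prod>i\<in>UNIV. t i ^ (j i)\<^sup>2)"
    proof -
      have "exp ((real (j i))\<^sup>2 * ln (t i)) = t i ^ (j i)\<^sup>2" for i
        using t[of i] exp_of_nat_mult[of "(j i)\<^sup>2" "ln (t i)"] by simp
      then show ?thesis by (simp add: exp_sum)
    qed
    finally show ?thesis by (simp add: t_def u_def)
  qed
  have rad: "- (5 / 2) * real CARD('n) \<le> N\<^sup>2 / l * (ln y - (y\<^sup>2 - 1) / 2)"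
  proof -
    have "(N - V)\<^sup>2 / l \<le> (N - V)\<^sup>2 / 1" using l by (intro divide_left_mono) auto
    then have "- (5 / 2) * real CARD('n) \<le> - (5 / 2) * ((N - V)\<^sup>2 / l)" using dNV by simp
    also have "\<dots> = N\<^sup>2 / l * ((y - 1) - 2 * (y - 1)\<^sup>2 - (y\<^sup>2 - 1) / 2)"
      using N l by (simp add: y_def power2_eq_square field_simps)
    also have "\<dots> \<le> N\<^sup>2 / l * (ln y - (y\<^sup>2 - 1) / 2)"
      using l ln_ge_quadratic[OF y] by (intro mult_left_mono) auto
    finally show ?thesis .
  qed
  \<comment> \<open>Both factors lose the rate \<open>5 / 2 = 1 / 2 + 2\<close>, the first part from
    the identity for the linear terms, the second from the quadratic bound. The squared distances
    are at most 4 and 1 times the dimension, and \<open>5 / 2 * (4 + 1) \<le> 13\<close>.\<close>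
  have "monomial_peak l \<beta> j * exp (- 13 * real CARD('n))
    \<le> monomial_peak l \<beta> j * (exp (- (5 / 2) * (norm (freq_vec j - N *\<^sub>R u))\<^sup>2) * exp (- (5 / 2) * real CARD('n)))"
    using monomial_peak_pos[OF l \<beta>, of j] a unfolding exp_add[symmetric] by (intro mult_left_mono) auto
  also have "\<dots> \<le> monomial_peak l \<beta> j * ((\<Prod>i\<in>UNIV. (norm (z $ i) / norm z * N / real (j i)) ^ (j i)\<^sup>2)
      * exp (N\<^sup>2 / l * (ln y - (y\<^sup>2 - 1) / 2)))"
    using monomial_peak_pos[OF l \<beta>, of j] dir rad N
    by (intro mult_left_mono mult_mono) (auto intro!: prod_nonneg)
  also have "\<dots> = norm (square_monomial j z) * exp (- (\<beta> / 2) * norm z powr (2 * l))"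
    using square_monomial_split[OF l \<beta> j z] by (simp add: N_def V_def y_def)
  finally show "monomial_peak l \<beta> j * exp (- 13 * real CARD('n)) \<le>
      norm (square_monomial j z) * exp (- (\<beta> / 2) * norm z powr (2 * l))" .
qed

section \<open>Random signs\<close>

definition log_decay :: "real \<Rightarrow> real \<Rightarrow> real \<Rightarrow> real" where
  "log_decay s \<tau> t = (1 + t) powr (- s) * (1 + ln (1 + t)) powr (- \<tau>)"

lemma log_decay_pos: "t \<ge> 0 \<Longrightarrow> log_decay s \<tau> t > 0"
proof -
  assume "t \<ge> 0"
  then have "ln (1 + t) \<ge> 0" by simp
  then have "1 + ln (1 + t) > 0" by linarith
  with \<open>t \<ge> 0\<close> show ?thesis by (simp add: log_decay_def)
qed

text \<open>If the larger argument exceeds 1, the difference of the \<open>l\<close>-th powers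
  dominates; otherwise the difference is at most 1, which the summand 1 covers.\<close>

lemma abs_diff_le_powr_diff:
  fixes a b l :: real
  assumes "a \<ge> 0" "b \<ge> 0" "l \<ge> 1"
  shows "\<bar>a - b\<bar> \<le> 1 + \<bar>a powr l - b powr l\<bar>"
proof -
  have *: "a - b \<le> 1 + (a powr l - b powr l)" if "a \<ge> b" "b \<ge> 0" for a b :: real
  proof (cases "a \<le> 1")
    case True
    have "b powr l \<le> a powr l" using that assms by (intro powr_mono2) auto
    then show ?thesis using that True by linarith
  next
    case False
    have "1 = a powr 0" using False by simp
    also have "\<dots> \<le> a powr (l - 1)" using False assms by (intro powr_mono) auto
    finally have "1 * (a - b) \<le> a powr (l - 1) * (a - b)" using that by (intro mult_right_mono) auto
    moreover have "b powr l \<le> a powr (l - 1) * b"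
    proof (cases "b = 0")
      case False
      then have "b powr l = b powr (l - 1) * b" using that by (simp add: powr_diff)
      also have "\<dots> \<le> a powr (l - 1) * b" using that assms by (intro mult_right_mono powr_mono2) auto
      finally show ?thesis .
    qed simp
    moreover have "a powr l = a powr (l - 1) * a" using False by (simp add: powr_diff)
    ultimately show ?thesis by (simp add: algebra_simps)
  qed
  show ?thesis
    using *[of b a] *[of a b] assms by (cases "a \<ge> b") auto
qed

text \<open>Needed to replace the profile at a peak radius by the profile at \<open>norm z\<close>.
  Peetre's inequality bounds both factors by powers of \<open>1 + \<bar>a - b\<bar>\<close>, the
  logarithmic one because \<open>ln (1 + t)\<close> is 1-Lipschitz. That distance is controlled by
  the one between the scaled \<open>l\<close>-th powers, and a Gaussian of arbitrarily small rate
  \<open>d\<close> absorbs the power.\<close>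

lemma log_decay_ratio:
  assumes l: "l \<ge> 1" and k: "k > 0" and d: "d > 0" and \<tau>: "\<tau> \<ge> 0"
  obtains C where "C > 0"
    "\<And>a b. a \<ge> 0 \<Longrightarrow> b \<ge> 0 \<Longrightarrow>
       log_decay s \<tau> a \<le> C * log_decay s \<tau> b * exp (d * (k * a powr l - k * b powr l)\<^sup>2)"
proof -
  define A where "A = \<bar>s\<bar> + \<tau>"
  define C1 where "C1 = 2 + 1 / k"
  have C1: "C1 > 0" using k by (simp add: C1_def add_pos_nonneg)
  define C where "C = C1 powr A * exp (A\<^sup>2 / (4 * d))"
  show ?thesis
  proof (rule that)
    show "C > 0" using C1 by (simp add: C_def)
    fix a b :: real assume a: "a \<ge> 0" and b: "b \<ge> 0"
    define g where "g = \<bar>k * a powr l - k * b powr l\<bar>"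
    have "\<bar>a powr l - b powr l\<bar> = g / k"
      using k by (simp add: g_def abs_mult flip: right_diff_distrib)
    moreover have "C1 * (1 + g) = 2 + 2 * g + 1 / k + g / k" by (simp add: C1_def algebra_simps add_divide_distrib)
    moreover have "0 \<le> 1 / k" "0 \<le> g" using k by (auto simp: g_def)
    ultimately have ab: "1 + \<bar>a - b\<bar> \<le> C1 * (1 + g)"
      using abs_diff_le_powr_diff[OF a b l] by linarith
    have ln: "ln (1 + a) \<ge> 0" "ln (1 + b) \<ge> 0" using a b by auto
    have lip: "ln (1 + x) - ln (1 + y) \<le> \<bar>x - y\<bar>" if "x \<ge> 0" "y \<ge> 0" for x y :: real
    proof -
      have "ln (1 + x) \<le> ln ((1 + y) * (1 + \<bar>x - y\<bar>))"
      proof (rule ln_mono)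
        have "x \<le> y + \<bar>x - y\<bar>" "0 \<le> y * \<bar>x - y\<bar>" using that by auto
        then show "1 + x \<le> (1 + y) * (1 + \<bar>x - y\<bar>)" by (simp add: distrib_left distrib_right)
      qed (use that in auto)
      also have "\<dots> = ln (1 + y) + ln (1 + \<bar>x - y\<bar>)" using that by (simp add: ln_mult add_pos_nonneg)
      also have "ln (1 + \<bar>x - y\<bar>) \<le> \<bar>x - y\<bar>" by (intro ln_add_one_self_le_self) auto
      finally show ?thesis by simp
    qed
    have "(1 + a) powr (- s) \<le> (1 + \<bar>a - b\<bar>) powr \<bar>- s\<bar> * (1 + b) powr (- s)"
      using a b by (rule peetre_powr)
    moreover have "(1 + ln (1 + a)) powr (- \<tau>) \<le> (1 + \<bar>a - b\<bar>) powr \<tau> * (1 + ln (1 + b)) powr (- \<tau>)"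
    proof -
      have "(1 + ln (1 + a)) powr (- \<tau>) \<le> (1 + \<bar>ln (1 + a) - ln (1 + b)\<bar>) powr \<bar>- \<tau>\<bar> * (1 + ln (1 + b)) powr (- \<tau>)"
        using ln by (rule peetre_powr)
      also have "\<dots> \<le> (1 + \<bar>a - b\<bar>) powr \<tau> * (1 + ln (1 + b)) powr (- \<tau>)"
        using lip[OF a b] lip[OF b a] \<tau> by (intro mult_right_mono) (auto intro!: powr_mono2)
      finally show ?thesis .
    qed
    ultimately have "log_decay s \<tau> a \<le> ((1 + \<bar>a - b\<bar>) powr \<bar>s\<bar> * (1 + b) powr (- s)) * ((1 + \<bar>a - b\<bar>) powr \<tau> * (1 + ln (1 + b)) powr (- \<tau>))"
      unfolding log_decay_def by (intro mult_mono) auto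
    also have "\<dots> = (1 + \<bar>a - b\<bar>) powr A * log_decay s \<tau> b"
      by (simp add: A_def powr_add log_decay_def mult_ac)
    also have "\<dots> \<le> (C1 * (1 + g)) powr A * log_decay s \<tau> b"
      using ab \<tau> b log_decay_pos[OF b, of s \<tau>] by (intro mult_right_mono powr_mono2) (auto simp: A_def)
    also have "(C1 * (1 + g)) powr A = C1 powr A * (1 + g) powr A"
      by (simp add: powr_mult)
    also have "C1 powr A * (1 + g) powr A * log_decay s \<tau> b \<le> C1 powr A * (exp (A\<^sup>2 / (4 * d)) * exp (d * g\<^sup>2)) * log_decay s \<tau> b"
      using d log_decay_pos[OF b, of s \<tau>] by (intro mult_right_mono mult_left_mono powr_le_exp_square) (auto simp: g_def)
    also have "\<dots> = C * log_decay s \<tau> b * exp (d * (k * a powr l - k * b powr l)\<^sup>2)"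
      by (simp add: C_def g_def)
    finally show "log_decay s \<tau> a \<le> C * log_decay s \<tau> b * exp (d * (k * a powr l - k * b powr l)\<^sup>2)" .
  qed
qed

section \<open>Gaussian sums over the lattice\<close>

lemma sum_gauss_nat_le:
  assumes c: "c > (0::real)"
  obtains G where "G > 0" "\<And>t M. t \<ge> 0 \<Longrightarrow> (\<Sum>k\<le>M. exp (- c * (real k - t)\<^sup>2)) \<le> G"
proof -
  define h where "h d = exp (- (c / 2) * (real d)\<^sup>2)" for d
  have h0: "h d > 0" for d by (simp add: h_def)
  have sh: "summable h"
  proof (rule summable_comparison_test')
    show "summable (\<lambda>d. exp (- (c / 2)) ^ d)" using c by (intro summable_geometric) auto
    fix d :: nat
    have "real d \<le> (real d)\<^sup>2" by (cases d) (auto simp: power2_eq_square)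
    then have "exp (- (c / 2) * (real d)\<^sup>2) \<le> exp (real d * - (c / 2))" using c by simp
    also have "\<dots> = exp (- (c / 2)) ^ d" by (rule exp_of_nat_mult)
    finally show "norm (h d) \<le> exp (- (c / 2)) ^ d" by (simp add: h_def)
  qed
  define S where "S = suminf h"
  have S: "S > 0" unfolding S_def using sh h0 by (intro suminf_pos) auto
  have part: "sum (\<lambda>k. h (g k)) K \<le> S" if "finite K" "inj_on g K" for g :: "nat \<Rightarrow> nat" and K
  proof -
    have "sum (\<lambda>k. h (g k)) K = sum h (g ` K)" using that by (simp add: sum.reindex)
    also have "\<dots> \<le> S" unfolding S_def using that sh h0 by (intro sum_le_suminf) (auto intro: less_imp_le)
    finally show ?thesis .
  qed
  show ?thesis
  proof (rule that)
    show "exp c * (S + S) > 0" using S by simp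
    fix t :: real and M :: nat assume t: "t \<ge> 0"
    define m where "m = nat \<lfloor>t\<rfloor>"
    have m: "real m \<le> t" "t \<le> real m + 1" using t unfolding m_def by linarith+
    have tm: "(t - real m)\<^sup>2 \<le> 1" using m by (simp add: abs_square_le_1)
    \<comment> \<open>Moving the centre to an integer costs half the rate and a factor
      \<open>exp c\<close>. Afterwards each side of \<open>m\<close> reindexes injectively into the
      one series \<open>S\<close>, uniformly in \<open>t\<close> and \<open>M\<close>.\<close>
    have gauss: "exp (- c * (real k - t)\<^sup>2) \<le> exp c * exp (- (c / 2) * (real k - real m)\<^sup>2)" for k
    proof -
      have "0 \<le> ((real k - t) - (t - real m))\<^sup>2" by simp
      moreover have "((real k - t) - (t - real m))\<^sup>2 + (real k - real m)\<^sup>2 = 2 * (real k - t)\<^sup>2 + 2 * (t - real m)\<^sup>2"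
        by (simp add: power2_eq_square algebra_simps)
      ultimately have "(real k - real m)\<^sup>2 \<le> 2 * (real k - t)\<^sup>2 + 2" using tm by linarith
      then have "(c / 2) * (real k - real m)\<^sup>2 \<le> (c / 2) * (2 * (real k - t)\<^sup>2 + 2)"
        using c by (intro mult_left_mono) auto
      then have "- c * (real k - t)\<^sup>2 \<le> c + - (c / 2) * (real k - real m)\<^sup>2" by (simp add: algebra_simps)
      then show ?thesis by (simp flip: exp_add)
    qed
    have "(\<Sum>k\<le>M. exp (- c * (real k - t)\<^sup>2)) \<le> (\<Sum>k\<le>M. exp c * exp (- (c / 2) * (real k - real m)\<^sup>2))"
      by (intro sum_mono gauss)
    also have "\<dots> = exp c * (\<Sum>k\<le>M. exp (- (c / 2) * (real k - real m)\<^sup>2))"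
      by (simp add: sum_distrib_left)
    also have "(\<Sum>k\<le>M. exp (- (c / 2) * (real k - real m)\<^sup>2))
       = (\<Sum>k\<in>{..M} \<inter> {..m}. exp (- (c / 2) * (real k - real m)\<^sup>2)) + (\<Sum>k\<in>{..M} - {..m}. exp (- (c / 2) * (real k - real m)\<^sup>2))"
      by (rule sum.Int_Diff) simp
    also have "(\<Sum>k\<in>{..M} \<inter> {..m}. exp (- (c / 2) * (real k - real m)\<^sup>2)) = (\<Sum>k\<in>{..M} \<inter> {..m}. h (m - k))"
      by (intro sum.cong) (auto simp: h_def of_nat_diff power2_commute)
    also have "(\<Sum>k\<in>{..M} - {..m}. exp (- (c / 2) * (real k - real m)\<^sup>2)) = (\<Sum>k\<in>{..M} - {..m}. h (k - m))"
      by (intro sum.cong) (auto simp: h_def of_nat_diff)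
    also have "exp c * ((\<Sum>k\<in>{..M} \<inter> {..m}. h (m - k)) + (\<Sum>k\<in>{..M} - {..m}. h (k - m))) \<le> exp c * (S + S)"
      by (intro mult_left_mono add_mono part) (auto simp: inj_on_def)
    finally show "(\<Sum>k\<le>M. exp (- c * (real k - t)\<^sup>2)) \<le> exp c * (S + S)" .
  qed
qed

text \<open>The Gaussian factors over the coordinates, so the sum over the box is a product of
  one-dimensional sums.\<close>

lemma sum_gauss_freq_le:
  assumes c: "c > (0::real)"
  obtains G where "G > 0"
    "\<And>(v :: real ^ 'n) M. (\<And>i. v $ i \<ge> 0) \<Longrightarrow>
       (\<Sum>j\<in>PiE UNIV (\<lambda>_. {..M}). exp (- c * (norm (freq_vec j - v))\<^sup>2)) \<le> G"
proof -
  obtain G where G: "G > 0" "\<And>t M. t \<ge> 0 \<Longrightarrow> (\<Sum>k\<le>M. exp (- c * (real k - t)\<^sup>2)) \<le> G"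
    using sum_gauss_nat_le[OF c] by metis
  show ?thesis
  proof (rule that)
    show "G ^ CARD('n) > 0" using G by simp
    fix v :: "real ^ 'n" and M :: nat assume v: "\<And>i. v $ i \<ge> 0"
    have "(\<Sum>j\<in>PiE UNIV (\<lambda>_. {..M}). exp (- c * (norm (freq_vec j - v))\<^sup>2))
       = (\<Sum>j\<in>PiE UNIV (\<lambda>_. {..M}). \<Prod>i\<in>UNIV. exp (- c * (real (j i) - v $ i)\<^sup>2))"
      by (simp add: norm_vec_power2 sum_distrib_left exp_sum sum_negf flip: exp_sum)
    also have "\<dots> = (\<Prod>i\<in>UNIV. \<Sum>k\<le>M. exp (- c * (real k - v $ i)\<^sup>2))"
      by (rule prod_sum_PiE[symmetric]) auto
    also have "\<dots> \<le> (\<Prod>i\<in>(UNIV :: 'n set). G)"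
      using v G by (intro prod_mono) (auto intro: sum_nonneg)
    finally show "(\<Sum>j\<in>PiE UNIV (\<lambda>_. {..M}). exp (- c * (norm (freq_vec j - v))\<^sup>2)) \<le> G ^ CARD('n)"
      by simp
  qed
qed

text \<open>The set \<open>E\<close> of positive signs encodes the sign pattern, so that
  expectations are finite sums over \<open>Pow I\<close>.\<close>

definition signed_sum :: "'a set \<Rightarrow> 'a set \<Rightarrow> ('a \<Rightarrow> complex) \<Rightarrow> complex" where
  "signed_sum I E x = (\<Sum>j\<in>I. if j \<in> E then x j else - x j)"

text \<open>Flipping all signs except the one at \<open>k\<close> is an involution; for each sign pattern, the sum or its
  flip has modulus at least \<open>norm (x k)\<close>.\<close>

lemma signed_sum_average:
  assumes I: "finite I" and k: "k \<in> I" and q: "q \<ge> 0"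
  shows "2 ^ card I * norm (x k) powr q \<le> 2 * (\<Sum>E\<in>Pow I. norm (signed_sum I E x) powr q)"
proof -
  define \<phi> where "\<phi> E = (if k \<in> E then insert k (I - E) else I - E - {k})" for E
  have \<phi>: "\<phi> (\<phi> E) = E" "\<phi> E \<in> Pow I" if "E \<in> Pow I" for E
    using that k by (auto simp: \<phi>_def split: if_splits)
  have bij: "(\<Sum>E\<in>Pow I. g (\<phi> E)) = (\<Sum>E\<in>Pow I. g E)" for g :: "'a set \<Rightarrow> real"
    using \<phi> by (intro sum.reindex_bij_witness[of _ \<phi> \<phi>]) blast+
  have flip: "signed_sum I E x + signed_sum I (\<phi> E) x = 2 * (if k \<in> E then x k else - x k)" if E: "E \<in> Pow I" for E
  proof -
    have "signed_sum I E x + signed_sum I (\<phi> E) x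
       = (\<Sum>j\<in>I. if j = k then 2 * (if k \<in> E then x k else - x k) else 0)"
      unfolding signed_sum_def sum.distrib[symmetric] using E
      by (intro sum.cong) (auto simp: \<phi>_def)
    also have "\<dots> = 2 * (if k \<in> E then x k else - x k)" using I k by simp
    finally show ?thesis .
  qed
  have "norm (x k) powr q \<le> norm (signed_sum I E x) powr q + norm (signed_sum I (\<phi> E) x) powr q" if E: "E \<in> Pow I" for E
  proof -
    have "2 * norm (x k) = norm (signed_sum I E x + signed_sum I (\<phi> E) x)"
      unfolding flip[OF E] by (simp add: norm_mult)
    also have "\<dots> \<le> norm (signed_sum I E x) + norm (signed_sum I (\<phi> E) x)" by (rule norm_triangle_ineq)
    finally have "norm (x k) \<le> norm (signed_sum I E x) \<or> norm (x k) \<le> norm (signed_sum I (\<phi> E) x)" by linarith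
    then show ?thesis
    proof
      assume "norm (x k) \<le> norm (signed_sum I E x)"
      then have "norm (x k) powr q \<le> norm (signed_sum I E x) powr q" using q by (intro powr_mono2) auto
      then show ?thesis by (rule order_trans) simp
    next
      assume "norm (x k) \<le> norm (signed_sum I (\<phi> E) x)"
      then have "norm (x k) powr q \<le> norm (signed_sum I (\<phi> E) x) powr q" using q by (intro powr_mono2) auto
      then show ?thesis by (rule order_trans) simp
    qed
  qed
  then have "(\<Sum>E\<in>Pow I. norm (x k) powr q) \<le> (\<Sum>E\<in>Pow I. norm (signed_sum I E x) powr q + norm (signed_sum I (\<phi> E) x) powr q)"
    by (intro sum_mono) auto
  also have "\<dots> = 2 * (\<Sum>E\<in>Pow I. norm (signed_sum I E x) powr q)"
    using bij[of "\<lambda>E. norm (signed_sum I E x) powr q"] by (simp add: sum.distrib)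
  finally show ?thesis using I by (simp add: card_Pow)
qed

text \<open>The coefficients make the maximal weighted modulus of each term equal to the profile
  \<open>H\<close> at the radius where that term peaks. Truncation at \<open>M\<close> keeps this a
  polynomial with finitely many sign patterns.\<close>

definition signed_poly :: "real \<Rightarrow> real \<Rightarrow> (real \<Rightarrow> real) \<Rightarrow> nat \<Rightarrow> ('n::finite \<Rightarrow> nat) set \<Rightarrow> complex ^ 'n \<Rightarrow> complex" where
  "signed_poly l \<beta> H M E z = signed_sum (PiE UNIV (\<lambda>_. {..M})) E
     (\<lambda>j. of_real (H (peak_radius l \<beta> j) / monomial_peak l \<beta> j) * square_monomial j z)"

lemma entire_signed_poly: "entire (signed_poly l \<beta> H M (E :: ('n::finite \<Rightarrow> nat) set))"
  unfolding signed_poly_def signed_sum_def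
proof (rule entire_sum)
  fix j :: "'n \<Rightarrow> nat"
  let ?c = "complex_of_real (H (peak_radius l \<beta> j) / monomial_peak l \<beta> j)"
  have "(\<lambda>z. if j \<in> E then ?c * square_monomial j z else - (?c * square_monomial j z))
     = (\<lambda>z. (if j \<in> E then ?c else - ?c) * square_monomial j z)" by auto
  then show "entire (\<lambda>z. if j \<in> E then ?c * square_monomial j z else - (?c * square_monomial j z))"
    by (simp only:) (intro entire_mult entire_const entire_square_monomial)
qed

lemma peak_radius_nonneg: "peak_radius l \<beta> j \<ge> 0"
  by (simp add: peak_radius_def)

lemma peak_radius_diff_le:
  assumes l: "l \<ge> 1" and \<beta>: "\<beta> > 0"
  shows "(sqrt (\<beta> * l) * peak_radius l \<beta> j powr l - sqrt (\<beta> * l) * norm z powr l)\<^sup>2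
     \<le> (norm (freq_vec j - moduli_vec l \<beta> z))\<^sup>2"
proof -
  have "\<bar>norm (freq_vec j) - norm (moduli_vec l \<beta> z)\<bar> \<le> norm (freq_vec j - moduli_vec l \<beta> z)"
    by (rule norm_triangle_ineq3)
  then have "\<bar>norm (freq_vec j) - norm (moduli_vec l \<beta> z)\<bar>\<^sup>2 \<le> (norm (freq_vec j - moduli_vec l \<beta> z))\<^sup>2"
    by (intro power_mono) auto
  then show ?thesis
    unfolding peak_radius_powr[OF l \<beta>] norm_moduli_vec[OF l \<beta>, symmetric] by simp
qed

lemma signed_poly_upper:
  assumes l: "l \<ge> 1" and \<beta>: "\<beta> > 0" and \<tau>: "\<tau> \<ge> 0"
  obtains C where "C > 0"
    "\<And>M E (z :: complex ^ 'n). norm (signed_poly l \<beta> (log_decay s \<tau>) M E z) * exp (- (\<beta> / 2) * norm z powr (2 * l))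
       \<le> C * log_decay s \<tau> (norm z)"
proof -
  define k where "k = sqrt (\<beta> * l)"
  have k: "k > 0" using l \<beta> by (simp add: k_def)
  \<comment> \<open>Half of the decay rate \<open>1 / (4 * l)\<close> of a monomial: one half pays
    for moving the profile, the other makes the sum over the lattice bounded.\<close>
  define d where "d = 1 / (8 * l)"
  have d: "d > 0" using l by (simp add: d_def)
  obtain C where C: "C > 0" "\<And>a b. a \<ge> 0 \<Longrightarrow> b \<ge> 0 \<Longrightarrow>
       log_decay s \<tau> a \<le> C * log_decay s \<tau> b * exp (d * (k * a powr l - k * b powr l)\<^sup>2)"
    using log_decay_ratio[OF l k d \<tau>] by metis
  obtain G where G: "G > 0" "\<And>(v :: real ^ 'n) M. (\<And>i. v $ i \<ge> 0) \<Longrightarrow>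
       (\<Sum>j\<in>PiE UNIV (\<lambda>_. {..M}). exp (- d * (norm (freq_vec j - v))\<^sup>2)) \<le> G"
    using sum_gauss_freq_le[OF d, where 'n='n] by metis
  show ?thesis
  proof (rule that)
    show "C * G > 0" using C G by simp
    fix M E and z :: "complex ^ 'n"
    let ?I = "PiE UNIV (\<lambda>_. {..M}) :: ('n \<Rightarrow> nat) set"
    let ?e = "exp (- (\<beta> / 2) * norm z powr (2 * l))" and ?H = "log_decay s \<tau>"
    let ?x = "\<lambda>j. of_real (?H (peak_radius l \<beta> j) / monomial_peak l \<beta> j) * square_monomial j z"
    have H: "?H (norm z) > 0" by (rule log_decay_pos) simp
    have "norm (signed_poly l \<beta> ?H M E z) \<le> (\<Sum>j\<in>?I. norm (?x j))"
      unfolding signed_poly_def signed_sum_def by (rule sum_norm_le) auto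
    then have "norm (signed_poly l \<beta> ?H M E z) * ?e \<le> (\<Sum>j\<in>?I. norm (?x j)) * ?e"
      by (intro mult_right_mono) auto
    also have "\<dots> = (\<Sum>j\<in>?I. norm (?x j) * ?e)" by (rule sum_distrib_right)
    also have "\<dots> \<le> (\<Sum>j\<in>?I. C * ?H (norm z) * exp (- d * (norm (freq_vec j - moduli_vec l \<beta> z))\<^sup>2))"
    proof (rule sum_mono)
      fix j :: "'n \<Rightarrow> nat"
      let ?g = "(norm (freq_vec j - moduli_vec l \<beta> z))\<^sup>2" and ?R = "peak_radius l \<beta> j"
      have pk: "monomial_peak l \<beta> j > 0" using l \<beta> by (rule monomial_peak_pos)
      have HR: "?H ?R > 0" by (intro log_decay_pos peak_radius_nonneg)
      have "norm (?x j) * ?e = ?H ?R / monomial_peak l \<beta> j * (norm (square_monomial j z) * ?e)"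
        using pk HR by (simp add: norm_mult norm_divide)
      also have "\<dots> \<le> ?H ?R / monomial_peak l \<beta> j * (monomial_peak l \<beta> j * exp (- (1 / (4 * l)) * ?g))"
        using pk HR l \<beta> by (intro mult_left_mono square_monomial_le) auto
      also have "\<dots> = ?H ?R * exp (- (1 / (4 * l)) * ?g)" using pk by simp
      also have "\<dots> \<le> (C * ?H (norm z) * exp (d * ?g)) * exp (- (1 / (4 * l)) * ?g)"
      proof (rule mult_right_mono)
        have "?H ?R \<le> C * ?H (norm z) * exp (d * (k * ?R powr l - k * norm z powr l)\<^sup>2)"
          by (intro C(2) peak_radius_nonneg) simp
        also have "\<dots> \<le> C * ?H (norm z) * exp (d * ?g)"
          using peak_radius_diff_le[OF l \<beta>, of j z] d C(1) H
          by (intro mult_left_mono) (auto simp: k_def)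
        finally show "?H ?R \<le> C * ?H (norm z) * exp (d * ?g)" .
      qed simp
      also have "\<dots> = C * ?H (norm z) * (exp (d * ?g) * exp (- (1 / (4 * l)) * ?g))" by simp
      also have "exp (d * ?g) * exp (- (1 / (4 * l)) * ?g) = exp (- d * ?g)"
        by (simp add: d_def field_simps flip: exp_add)
      finally show "norm (?x j) * ?e \<le> C * ?H (norm z) * exp (- d * ?g)" .
    qed
    also have "\<dots> = C * ?H (norm z) * (\<Sum>j\<in>?I. exp (- d * (norm (freq_vec j - moduli_vec l \<beta> z))\<^sup>2))"
      by (rule sum_distrib_left[symmetric])
    also have "\<dots> \<le> C * ?H (norm z) * G"
      using C(1) H l \<beta> by (intro mult_left_mono G(2)) (auto simp: moduli_vec_def)
    finally show "norm (signed_poly l \<beta> ?H M E z) * ?e \<le> C * G * ?H (norm z)" by (simp add: mult_ac)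
  qed
qed

lemma signed_poly_lower:
  assumes l: "l \<ge> 1" and \<beta>: "\<beta> > 0" and \<tau>: "\<tau> \<ge> 0" and q: "q \<ge> 0"
  obtains c where "c > 0"
    "\<And>M (z :: complex ^ 'n). (\<And>i. moduli_vec l \<beta> z $ i > 1) \<Longrightarrow> norm (moduli_vec l \<beta> z) \<le> real M \<Longrightarrow>
      c * 2 ^ card (PiE UNIV (\<lambda>_. {..M}) :: ('n \<Rightarrow> nat) set) * log_decay s \<tau> (norm z) powr q
       \<le> (\<Sum>E\<in>Pow (PiE UNIV (\<lambda>_. {..M})). (norm (signed_poly l \<beta> (log_decay s \<tau>) M E z)
           * exp (- (\<beta> / 2) * norm z powr (2 * l))) powr q)"
proof -
  define k where "k = sqrt (\<beta> * l)"
  have k: "k > 0" using l \<beta> by (simp add: k_def)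
  obtain C where C: "C > 0" "\<And>a b. a \<ge> 0 \<Longrightarrow> b \<ge> 0 \<Longrightarrow>
       log_decay s \<tau> a \<le> C * log_decay s \<tau> b * exp (1 * (k * a powr l - k * b powr l)\<^sup>2)"
    using log_decay_ratio[OF l k zero_less_one \<tau>] by metis
  \<comment> \<open>13 comes from the nearby monomial; 1 comes from moving the profile over a
    squared distance of at most \<open>real CARD('n)\<close>.\<close>
  define c where "c = exp (- 14 * real CARD('n)) / C"
  have c: "c > 0" using C by (simp add: c_def)
  show ?thesis
  proof (rule that)
    show "c powr q / 2 > 0" using c by simp
    fix M and z :: "complex ^ 'n"
    assume big: "\<And>i. moduli_vec l \<beta> z $ i > 1" and M: "norm (moduli_vec l \<beta> z) \<le> real M"
    let ?I = "PiE UNIV (\<lambda>_. {..M}) :: ('n \<Rightarrow> nat) set"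
    let ?e = "exp (- (\<beta> / 2) * norm z powr (2 * l))" and ?H = "log_decay s \<tau>"
    let ?x = "\<lambda>j. of_real (?H (peak_radius l \<beta> j) / monomial_peak l \<beta> j) * square_monomial j z"
    have H: "?H (norm z) > 0" by (rule log_decay_pos) simp
    define j where "j = (\<lambda>i. nat \<lceil>moduli_vec l \<beta> z $ i\<rceil>)"
    \<comment> \<open>\<open>M\<close> is an integer above every coordinate, so rounding up does not
      leave the truncated index set.\<close>
    have jI: "j \<in> ?I"
    proof -
      have "moduli_vec l \<beta> z $ i \<le> real M" for i
        using M component_le_norm_cart[of "moduli_vec l \<beta> z" i] by simp
      then show ?thesis by (auto simp: j_def PiE_def extensional_def nat_le_iff ceiling_le_iff)
    qed
    have fin: "finite ?I" by (intro finite_PiE) auto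
    have pk: "monomial_peak l \<beta> j > 0" using l \<beta> by (rule monomial_peak_pos)
    let ?R = "peak_radius l \<beta> j"
    have HR: "?H ?R > 0" by (intro log_decay_pos peak_radius_nonneg)
    have "?H (norm z) \<le> C * ?H ?R * exp (1 * (k * norm z powr l - k * ?R powr l)\<^sup>2)"
      by (intro C(2) peak_radius_nonneg) simp
    also have "\<dots> \<le> C * ?H ?R * exp (real CARD('n))"
      using peak_radius_diff_le[OF l \<beta>, of j z] square_monomial_ge(2)[OF l \<beta> big] C(1) HR
      by (intro mult_left_mono) (auto simp: k_def j_def power2_commute)
    finally have HH: "?H (norm z) / C * exp (- real CARD('n)) \<le> ?H ?R"
      using C(1) by (simp add: exp_minus field_simps)
    have "c * ?H (norm z) = ?H (norm z) / C * exp (- real CARD('n)) * exp (- 13 * real CARD('n))"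
      by (simp add: c_def flip: exp_add)
    also have "\<dots> \<le> ?H ?R * exp (- 13 * real CARD('n))"
      by (intro mult_right_mono HH) simp
    also have "\<dots> = ?H ?R / monomial_peak l \<beta> j * (monomial_peak l \<beta> j * exp (- 13 * real CARD('n)))"
      using pk by simp
    also have "\<dots> \<le> ?H ?R / monomial_peak l \<beta> j * (norm (square_monomial j z) * ?e)"
      using pk HR square_monomial_ge(1)[OF l \<beta> big] unfolding j_def by (intro mult_left_mono) auto
    also have "\<dots> = norm (?x j) * ?e" using pk HR by (simp add: norm_mult norm_divide)
    finally have "(c * ?H (norm z)) powr q \<le> (norm (?x j) * ?e) powr q"
      using c H q by (intro powr_mono2) auto
    then have "c powr q * ?H (norm z) powr q \<le> norm (?x j) powr q * ?e powr q"
      by (simp only: powr_mult)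
    then have "2 ^ card ?I * (c powr q * ?H (norm z) powr q) \<le> (2 ^ card ?I * norm (?x j) powr q) * ?e powr q"
      by (simp add: mult.assoc)
    also have "\<dots> \<le> (2 * (\<Sum>E\<in>Pow ?I. norm (signed_poly l \<beta> ?H M E z) powr q)) * ?e powr q"
      unfolding signed_poly_def
      using signed_sum_average[OF fin jI q, of ?x] by (intro mult_right_mono) auto
    also have "\<dots> = 2 * (\<Sum>E\<in>Pow ?I. (norm (signed_poly l \<beta> ?H M E z) * ?e) powr q)"
      by (simp only: powr_mult sum_distrib_right mult.assoc)
    finally show "c powr q / 2 * 2 ^ card ?I * ?H (norm z) powr q
       \<le> (\<Sum>E\<in>Pow ?I. (norm (signed_poly l \<beta> ?H M E z) * ?e) powr q)"
      by (simp add: mult_ac)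
  qed
qed

section \<open>Necessity for q smaller than p\<close>

text \<open>For finite \<open>p = P\<close> the \<open>P\<close>-th power of the weighted profile is
  \<open>(1 + norm z) powr (- 2n)\<close> times the power \<open>- P / Q\<close> of the logarithm.
  On dyadic shells the volume cancels the first factor and \<open>\<Sum>m. m powr (- P / Q)\<close>
  remains, which converges because \<open>P > Q\<close>. The exponent \<open>1 / Q\<close> is chosen
  so that the \<open>Q\<close>-th power is just divergent.\<close>

lemma fock_le_log_decay:
  fixes \<beta> \<rho> l :: real
  assumes p: "1 \<le> p" and Q: "Q \<ge> 1" and Qp: "ereal Q < p" and C: "C > 0"
  defines "s \<equiv> \<rho> + 2 * real CARD('n) * real_of_ereal (1 / p)"
  obtains B where "B > 0"
    "\<And>f :: complex ^ 'n \<Rightarrow> complex. entire f \<Longrightarrow>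
      (\<And>z. norm (f z) * exp (- (\<beta> / 2) * norm z powr (2 * l)) \<le> C * log_decay s (1 / Q) (norm z)) \<Longrightarrow>
      fock_le l p \<beta> \<rho> f B"
  using p
proof (cases rule: ereal_ge_one_cases)
  case infinite
  show ?thesis
  proof (rule that[OF C])
    fix f :: "complex ^ 'n \<Rightarrow> complex"
    assume f: "entire f" "\<And>z. norm (f z) * exp (- (\<beta> / 2) * norm z powr (2 * l)) \<le> C * log_decay s (1 / Q) (norm z)"
    have "fock_weighted l \<beta> \<rho> f z \<le> C" for z
    proof -
      have "ln (1 + norm z) \<ge> 0" by simp
      then have "(1 + ln (1 + norm z)) powr (- (1 / Q)) \<le> (1 + ln (1 + norm z)) powr 0"
        using Q by (intro powr_mono) auto
      then have L: "(1 + ln (1 + norm z)) powr (- (1 / Q)) \<le> 1"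
        using \<open>ln (1 + norm z) \<ge> 0\<close> by simp
      have "fock_weighted l \<beta> \<rho> f z = norm (f z) * exp (- (\<beta> / 2) * norm z powr (2 * l)) * (1 + norm z) powr \<rho>"
        by (simp add: fock_weighted_def)
      also have "\<dots> \<le> C * log_decay s (1 / Q) (norm z) * (1 + norm z) powr \<rho>"
        using f by (intro mult_right_mono) auto
      also have "\<dots> = C * (1 + ln (1 + norm z)) powr (- (1 / Q))"
        by (simp add: log_decay_def s_def infinite powr_minus)
      also have "\<dots> \<le> C * 1" using C L by (intro mult_left_mono) auto
      finally show ?thesis by simp
    qed
    then show "fock_le l p \<beta> \<rho> f C" using f by (simp add: fock_le_def infinite)
  qed
next
  case (finite P)
  define D where "D = DIM(complex ^ 'n)"
  define V where "V = unit_ball_vol (real D)"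
  have V: "V \<ge> 0" by (simp add: V_def)
  define a where "a = P / Q"
  have a: "a > 1" using Qp finite Q by (simp add: a_def)
  define g where "g t = t powr (- real D) * (1 + ln t) powr (- a)" for t
  let ?I = "\<integral>\<^sup>+x. ennreal (g (1 + norm (x :: complex ^ 'n))) \<partial>lborel"
  have "?I \<le> (\<Sum>m. ennreal (g (2 ^ m)) * ennreal (V * (2 ^ Suc m) ^ D))"
    unfolding V_def D_def
  proof (rule nn_integral_radial_le)
    fix s t :: real assume st: "1 \<le> s" "s \<le> t"
    have "0 \<le> ln s" "ln s \<le> ln t" using st by auto
    then have "0 < 1 + ln s" "1 + ln s \<le> 1 + ln t" by linarith+
    then show "g t \<le> g s" unfolding g_def using st a by (intro mult_mono powr_mono2') auto
  qed
  also have "\<dots> \<le> (\<Sum>m. ennreal (V * 2 ^ D * (ln 2 powr (- a) * real (Suc m) powr (- a))))"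
  proof (intro suminf_le summableI)
    fix m :: nat
    have e: "g (2 ^ m) * (V * (2 ^ Suc m) ^ D) = V * 2 ^ D * (1 + ln (2 ^ m)) powr (- a)"
    proof -
      have "((2::real) ^ m) powr (- real D) = 1 / (2 ^ m) ^ D"
        by (simp add: powr_minus powr_realpow field_simps)
      then show ?thesis by (simp add: g_def power_mult_distrib)
    qed
    have "ln 2 \<le> (1 :: real)" using ln_le_minus_one[of 2] by simp
    then have "ln 2 * real (Suc m) \<le> 1 + ln (2 ^ m)" by (simp add: ln_realpow algebra_simps)
    then have "(1 + ln (2 ^ m)) powr (- a) \<le> (ln 2 * real (Suc m)) powr (- a)"
      using a by (intro powr_mono2') auto
    also have "\<dots> = ln 2 powr (- a) * real (Suc m) powr (- a)" by (rule powr_mult)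
    finally have "g (2 ^ m) * (V * (2 ^ Suc m) ^ D) \<le> V * 2 ^ D * (ln 2 powr (- a) * real (Suc m) powr (- a))"
      unfolding e using V by (intro mult_left_mono) auto
    moreover have "g (2 ^ m) \<ge> 0" by (simp add: g_def)
    ultimately show "ennreal (g (2 ^ m)) * ennreal (V * (2 ^ Suc m) ^ D)
       \<le> ennreal (V * 2 ^ D * (ln 2 powr (- a) * real (Suc m) powr (- a)))"
      using V by (subst ennreal_mult[symmetric]) (auto intro!: ennreal_leI)
  qed
  also have "\<dots> < \<infinity>"
  proof -
    have "summable (\<lambda>m. real m powr (- a))" using a by (simp add: summable_real_powr_iff)
    then have "summable (\<lambda>m. real (Suc m) powr (- a))" by (subst summable_Suc_iff)
    then have "(\<Sum>m. ennreal (V * 2 ^ D * (ln 2 powr (- a) * real (Suc m) powr (- a)))) \<noteq> top"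
      using V by (intro ennreal_suminf_neq_top summable_mult) auto
    then show ?thesis by (simp add: less_top)
  qed
  finally obtain R where R: "?I = ennreal R" "R \<ge> 0" by (cases ?I) auto
  show ?thesis
  proof (rule that)
    show "1 + C powr P * R > 0" using R by (simp add: add_pos_nonneg)
    fix f :: "complex ^ 'n \<Rightarrow> complex"
    assume f: "entire f" "\<And>z. norm (f z) * exp (- (\<beta> / 2) * norm z powr (2 * l)) \<le> C * log_decay s (1 / Q) (norm z)"
    have "(\<integral>\<^sup>+z. ennreal (fock_weighted l \<beta> \<rho> f z powr P) \<partial>lborel)
       \<le> (\<integral>\<^sup>+z. ennreal (C powr P) * ennreal (g (1 + norm (z :: complex ^ 'n))) \<partial>lborel)"
    proof (rule nn_integral_mono)
      fix z :: "complex ^ 'n"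
      let ?L = "1 + ln (1 + norm z)"
      have "fock_weighted l \<beta> \<rho> f z = norm (f z) * exp (- (\<beta> / 2) * norm z powr (2 * l)) * (1 + norm z) powr \<rho>"
        by (simp add: fock_weighted_def)
      also have "\<dots> \<le> C * log_decay s (1 / Q) (norm z) * (1 + norm z) powr \<rho>"
        using f by (intro mult_right_mono) auto
      also have "\<dots> = C * ((1 + norm z) powr (- s + \<rho>) * ?L powr (- (1 / Q)))"
        by (simp only: log_decay_def powr_add mult_ac)
      also have "- s + \<rho> = - real D / P"
        using finite by (simp add: s_def D_def real_of_ereal_inverse)
      finally have "fock_weighted l \<beta> \<rho> f z powr P \<le> (C * ((1 + norm z) powr (- real D / P) * ?L powr (- (1 / Q)))) powr P"
        using finite by (intro powr_mono2) auto
      also have "\<dots> = C powr P * g (1 + norm z)"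
      proof -
        have "- real D / P * P = - real D" "- (1 / Q) * P = - a" using finite by (auto simp: a_def)
        then show ?thesis by (simp only: powr_mult powr_powr g_def)
      qed
      finally show "ennreal (fock_weighted l \<beta> \<rho> f z powr P) \<le> ennreal (C powr P) * ennreal (g (1 + norm z))"
        by (simp add: ennreal_leI g_def flip: ennreal_mult)
    qed
    also have "\<dots> = ennreal (C powr P) * ?I"
      unfolding g_def by (intro nn_integral_cmult) measurable
    also have "\<dots> = ennreal (C powr P * R)" using R by (simp flip: ennreal_mult)
    finally show "fock_le l p \<beta> \<rho> f (1 + C powr P * R)"
      using f finite R by (simp add: fock_le_finiteI)
  qed
qed

text \<open>Instead of whole shells, disjoint balls are used on which every coordinate is comparable
  to \<open>2 ^ m\<close>: the lower bound for a monomial needs all coordinates of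
  \<open>moduli_vec\<close> above 1. The volume cancels the power of \<open>1 + norm z\<close>, and
  the logarithm leaves a term of the harmonic series.\<close>

lemma nn_integral_log_shell_ge:
  assumes l: "l \<ge> 1" and \<beta>: "\<beta> > 0"
  obtains c and S :: "nat \<Rightarrow> (complex ^ 'n) set" where "c > 0"
    "\<And>m. S m \<in> sets borel" "\<And>m m' z. z \<in> S m \<Longrightarrow> z \<in> S m' \<Longrightarrow> m = m'"
    "\<And>m z i. z \<in> S m \<Longrightarrow> moduli_vec l \<beta> z $ i > 1"
    "\<And>k. \<exists>M. \<forall>m<k. \<forall>z\<in>S m. norm (moduli_vec l \<beta> z) \<le> real M"
    "\<And>m. ennreal (c / real (Suc m)) \<le> (\<integral>\<^sup>+z\<in>S m.
       ennreal ((1 + norm z) powr (- 2 * real CARD('n)) * (1 + ln (1 + norm z)) powr (- 1)) \<partial>lborel)"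
proof -
  define k where "k = sqrt (\<beta> * l)"
  have k: "k > 0" using l \<beta> by (simp add: k_def)
  \<comment> \<open>\<open>k * \<mu> \<ge> 1\<close> makes the scaled moduli exceed 1 already on the
    first ball.\<close>
  define \<mu> where "\<mu> = max 1 (1 / k)"
  have \<mu>: "\<mu> \<ge> 1" "k * \<mu> \<ge> 1" using k by (auto simp: \<mu>_def max_def field_simps)
  \<comment> \<open>With entries 4 and radius \<open>r m\<close> every coordinate has modulus
    between \<open>3 * r m\<close> and \<open>5 * r m\<close>; the next ball starts beyond
    \<open>6 * r m\<close>, which gives disjointness.\<close>
  define a :: "complex ^ 'n" where "a = (\<chi> i. 4)"
  define D where "D = DIM(complex ^ 'n)"
  define V where "V = unit_ball_vol (real D)"
  have V: "V > 0" unfolding V_def by (intro unit_ball_vol_pos) simp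
  define r where "r m = \<mu> * 2 ^ m" for m :: nat
  have r: "r m \<ge> 1" for m
    using mult_mono[of 1 \<mu> 1 "2 ^ m"] \<mu> by (simp add: r_def)
  define S where "S m = ball (r m *\<^sub>R a) (r m)" for m
  define K where "K = norm a + 2"
  have K: "K \<ge> 1" by (simp add: K_def)
  have comp: "3 * r m < norm (z $ i)" "norm (z $ i) < 5 * r m" if "z \<in> S m" for z :: "complex ^ 'n" and m i
  proof -
    have "norm ((z - r m *\<^sub>R a) $ i) < r m"
      using that Finite_Cartesian_Product.norm_nth_le[of "z - r m *\<^sub>R a" i] by (simp add: S_def dist_norm norm_minus_commute)
    moreover have "(z - r m *\<^sub>R a) $ i = z $ i - of_real (4 * r m)"
      by (simp add: a_def) (simp add: scaleR_conv_of_real)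
    ultimately have *: "norm (z $ i - of_real (4 * r m)) < r m" by simp
    have n: "norm (of_real (4 * r m) :: complex) = 4 * r m" using r[of m] by simp
    show "3 * r m < norm (z $ i)" "norm (z $ i) < 5 * r m"
      using * norm_triangle_ineq2[of "of_real (4 * r m)" "z $ i"] norm_triangle_ineq2[of "z $ i" "of_real (4 * r m)"]
      unfolding n by (auto simp: norm_minus_commute)
  qed
  have nz: "1 \<le> norm z" "norm z \<le> r m * (norm a + 1)" if "z \<in> S m" for z m
  proof -
    have "3 * r m < norm z" using comp(1)[OF that, of undefined] Finite_Cartesian_Product.norm_nth_le[of z undefined] by linarith
    then show "1 \<le> norm z" using r[of m] by linarith
    have "norm (z - r m *\<^sub>R a) < r m" using that by (simp add: S_def dist_norm norm_minus_commute)
    moreover have "norm z \<le> norm (z - r m *\<^sub>R a) + norm (r m *\<^sub>R a)"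
      using norm_triangle_ineq[of "z - r m *\<^sub>R a" "r m *\<^sub>R a"] by simp
    ultimately show "norm z \<le> r m * (norm a + 1)" using r[of m] by (simp add: distrib_left)
  qed
  define L where "L = ln (\<mu> * K)"
  have "1 \<le> \<mu> * K" using mult_mono[of 1 \<mu> 1 K] \<mu> K by simp
  then have L: "L \<ge> 0" by (simp add: L_def)
  define c where "c = V * K powr (- real D) / (2 + L)"
  have c: "c > 0" using V K L by (simp add: c_def)
  show ?thesis
  proof (rule that[OF c])
    show "S m \<in> sets borel" for m by (simp add: S_def)
    show "m = m'" if z: "z \<in> S m" "z \<in> S m'" for m m' z
    proof -
      have *: False if "m < m'" "z \<in> S m" "z \<in> S m'" for m m'
      proof -
        have "(2::real) ^ Suc m \<le> 2 ^ m'" using that by (intro power_increasing) auto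
        then have "\<mu> * (2 * 2 ^ m) \<le> \<mu> * 2 ^ m'" using \<mu> by (intro mult_left_mono) auto
        then have "2 * r m \<le> r m'" by (simp add: r_def)
        then show False
          using comp(2)[OF that(2), of undefined] comp(1)[OF that(3), of undefined] r[of m] by linarith
      qed
      show ?thesis using *[of m m'] *[of m' m] z by (cases m m' rule: linorder_cases) auto
    qed
    show "moduli_vec l \<beta> z $ i > 1" if "z \<in> S m" for m i and z :: "complex ^ 'n"
    proof -
      have "\<mu> * 1 \<le> r m" unfolding r_def using \<mu> by (intro mult_left_mono) auto
      then have "k * \<mu> \<le> k * r m" using k by (intro mult_left_mono) auto
      then have "1 < k * (3 * r m)" using \<mu> by linarith
      also have "\<dots> \<le> k * norm (z $ i)" using comp(1)[OF that, of i] k by (intro mult_left_mono) auto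
      also have "\<dots> = k * (1 * norm (z $ i))" by simp
      also have "\<dots> \<le> k * (norm z powr (l - 1) * norm (z $ i))"
        using k nz(1)[OF that] l by (intro mult_left_mono mult_right_mono ge_one_powr_ge_zero) auto
      finally show ?thesis by (simp add: moduli_vec_def k_def mult.assoc)
    qed
    show "\<exists>M. \<forall>m<n. \<forall>z\<in>S m. norm (moduli_vec l \<beta> z) \<le> real M" for n
    proof (intro exI allI impI ballI)
      fix m z assume m: "m < n" and z: "z \<in> S m"
      have "r m \<le> r n" unfolding r_def using m \<mu> by (intro mult_left_mono power_increasing) auto
      then have "r m * (norm a + 1) \<le> r n * (norm a + 1)" by (intro mult_right_mono) auto
      then have "norm z \<le> r n * (norm a + 1)" using nz(2)[OF z] by linarith
      then have "k * norm z powr l \<le> k * (r n * (norm a + 1)) powr l"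
        using k l by (intro mult_left_mono powr_mono2) auto
      also have "\<dots> \<le> real (nat \<lceil>k * (r n * (norm a + 1)) powr l\<rceil>)" by (rule real_nat_ceiling_ge)
      finally show "norm (moduli_vec l \<beta> z) \<le> real (nat \<lceil>k * (r n * (norm a + 1)) powr l\<rceil>)"
        unfolding norm_moduli_vec[OF l \<beta>] k_def .
    qed
    fix m
    let ?g = "\<lambda>z :: complex ^ 'n. (1 + norm z) powr (- 2 * real CARD('n)) * (1 + ln (1 + norm z)) powr (- 1)"
    define y where "y = (r m * K) powr (- real D) * (1 + ln (r m * K)) powr (- 1)"
    have y0: "y \<ge> 0" by (simp add: y_def)
    have gy: "y \<le> ?g z" if z: "z \<in> S m" for z
    proof -
      have le: "1 + norm z \<le> r m * K" using nz(2)[OF z] r[of m] by (simp add: K_def distrib_left)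
      then have "ln (1 + norm z) \<le> ln (r m * K)" by (intro ln_mono) (use r[of m] K in auto)
      moreover have "0 \<le> ln (1 + norm z)" by simp
      ultimately have "(1 + ln (r m * K)) powr (- 1) \<le> (1 + ln (1 + norm z)) powr (- 1)"
        by (intro powr_mono2') linarith+
      moreover have "(r m * K) powr (- real D) \<le> (1 + norm z) powr (- real D)"
        using le by (intro powr_mono2') auto
      moreover have "- real D = - 2 * real CARD('n)" by (simp add: D_def)
      ultimately show ?thesis unfolding y_def by (intro mult_mono) auto
    qed
    have "ennreal (c / real (Suc m)) \<le> ennreal (y * (V * r m ^ D))"
    proof (rule ennreal_leI)
      have lnr: "ln (r m * K) = L + real m * ln 2"
        using \<mu> K by (simp add: L_def r_def ln_mult ln_realpow mult_ac)
      have "ln 2 \<le> (1 :: real)" using ln_le_minus_one[of 2] by simp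
      then have "real m * ln 2 \<le> real m * 1" by (intro mult_left_mono) auto
      then have "1 + ln (r m * K) \<le> (2 + L) * real (Suc m)"
        unfolding lnr using L by (simp add: algebra_simps add_increasing)
      moreover have "0 < 1 + ln (r m * K)" unfolding lnr using L by (simp add: add_pos_nonneg)
      ultimately have "1 / ((2 + L) * real (Suc m)) \<le> 1 / (1 + ln (r m * K))"
        by (intro divide_left_mono) auto
      also have "\<dots> = (1 + ln (r m * K)) powr (- 1)"
        using \<open>0 < 1 + ln (r m * K)\<close> by (subst powr_minus_divide) simp
      finally have le: "V * K powr (- real D) * (1 / ((2 + L) * real (Suc m))) \<le> V * K powr (- real D) * (1 + ln (r m * K)) powr (- 1)"
        using V by (intro mult_left_mono) auto
      have "r m powr (- real D) * r m ^ D = 1"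
        using r[of m] by (simp add: powr_minus powr_realpow)
      then have "y * (V * r m ^ D) = V * K powr (- real D) * (1 + ln (r m * K)) powr (- 1)"
        by (simp add: y_def powr_mult)
      then show "c / real (Suc m) \<le> y * (V * r m ^ D)"
        using le by (simp add: c_def)
    qed
    also have "\<dots> = ennreal y * emeasure lborel (S m)"
      using y0 V r[of m] by (simp add: S_def emeasure_ball V_def D_def ennreal_mult)
    also have "\<dots> = (\<integral>\<^sup>+z\<in>S m. ennreal y \<partial>lborel)"
      by (simp add: nn_integral_cmult_indicator S_def)
    also have "\<dots> \<le> (\<integral>\<^sup>+z\<in>S m. ennreal (?g z) \<partial>lborel)"
      using gy by (intro nn_integral_mono) (auto simp: indicator_def intro!: ennreal_leI)
    finally show "ennreal (c / real (Suc m)) \<le> (\<integral>\<^sup>+z\<in>S m. ennreal (?g z) \<partial>lborel)" .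
  qed
qed

text \<open>The upper bound holds for each sign pattern, so all the polynomials have source norms,
  and by the embedding target norms, bounded by the same constant. Averaging the target integrals
  over the signs then bounds the partial sums of the harmonic series.\<close>

lemma fock_embeds_necessary_gt:
  assumes l: "l \<ge> 1" and \<beta>: "\<beta> > 0" and p: "1 \<le> p" and q: "1 \<le> q" and qp: "q < p"
    and emb: "embeds (fock_space l p \<beta> \<rho> :: (complex ^ 'n \<Rightarrow> complex) set) (fock_norm l p \<beta> \<rho>)
                (fock_space l q \<beta> \<eta>) (fock_norm l q \<beta> \<eta>)"
  shows "2 * real CARD('n) * (real_of_ereal (1 / q) - real_of_ereal (1 / p)) < \<rho> - \<eta>"
proof (rule ccontr)
  assume neg: "\<not> ?thesis"
  obtain Q where Q: "q = ereal Q" "Q \<ge> 1"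
    using q qp by (cases q) auto
  define D where "D = 2 * real CARD('n)"
  define s where "s = \<rho> + 2 * real CARD('n) * real_of_ereal (1 / p)"
  have "s - \<eta> \<le> D / Q" using neg Q by (simp add: s_def D_def real_of_ereal_inverse algebra_simps)
  then have "(s - \<eta>) * Q \<le> D" using Q by (simp add: field_simps)
  \<comment> \<open>This is how the negated conclusion is used: the \<open>Q\<close>-th power of the
    weighted profile is at least \<open>?g\<close>, the function with divergent integral.\<close>
  then have sQ: "- D \<le> (\<eta> - s) * Q" by (simp add: algebra_simps)
  let ?H = "log_decay s (1 / Q)"
  have \<tau>: "1 / Q \<ge> 0" and Q0: "Q \<ge> 0" using Q by auto
  obtain C where C: "C > 0"
    "\<And>M E (z :: complex ^ 'n). norm (signed_poly l \<beta> ?H M E z) * exp (- (\<beta> / 2) * norm z powr (2 * l))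
       \<le> C * ?H (norm z)"
    using signed_poly_upper[OF l \<beta> \<tau>, where 'n='n and s=s] by metis
  obtain c where c: "c > 0"
    "\<And>M (z :: complex ^ 'n). (\<And>i. moduli_vec l \<beta> z $ i > 1) \<Longrightarrow> norm (moduli_vec l \<beta> z) \<le> real M \<Longrightarrow>
      c * 2 ^ card (PiE UNIV (\<lambda>_. {..M}) :: ('n \<Rightarrow> nat) set) * ?H (norm z) powr Q
       \<le> (\<Sum>E\<in>Pow (PiE UNIV (\<lambda>_. {..M})). (norm (signed_poly l \<beta> ?H M E z)
           * exp (- (\<beta> / 2) * norm z powr (2 * l))) powr Q)"
    using signed_poly_lower[OF l \<beta> \<tau> Q0, where 'n='n and s=s] by metis
  obtain B where B: "B > 0"
    "\<And>f :: complex ^ 'n \<Rightarrow> complex. entire f \<Longrightarrow>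
      (\<And>z. norm (f z) * exp (- (\<beta> / 2) * norm z powr (2 * l)) \<le> C * ?H (norm z)) \<Longrightarrow>
      fock_le l p \<beta> \<rho> f B"
    using fock_le_log_decay[OF p Q(2) _ C(1), where 'n='n and \<rho>=\<rho> and \<beta>=\<beta> and l=l] qp Q unfolding s_def by metis
  obtain C1 where C1: "C1 > 0"
    "\<And>f :: complex ^ 'n \<Rightarrow> complex. \<And>B. B > 0 \<Longrightarrow> fock_le l p \<beta> \<rho> f B \<Longrightarrow> fock_le l q \<beta> \<eta> f (C1 * B)"
    using embeds_fockD[OF emb p q] by metis
  obtain c' and S :: "nat \<Rightarrow> (complex ^ 'n) set" where S: "c' > 0"
    "\<And>m. S m \<in> sets borel" "\<And>m m' z. z \<in> S m \<Longrightarrow> z \<in> S m' \<Longrightarrow> m = m'"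
    "\<And>m z i. z \<in> S m \<Longrightarrow> moduli_vec l \<beta> z $ i > 1"
    "\<And>k. \<exists>M. \<forall>m<k. \<forall>z\<in>S m. norm (moduli_vec l \<beta> z) \<le> real M"
    "\<And>m. ennreal (c' / real (Suc m)) \<le> (\<integral>\<^sup>+z\<in>S m.
       ennreal ((1 + norm z) powr (- 2 * real CARD('n)) * (1 + ln (1 + norm z)) powr (- 1)) \<partial>lborel)"
  proof (rule nn_integral_log_shell_ge[OF l \<beta>, where 'n='n])
  qed (rule that)
  define K where "K = (C1 * B) powr Q"
  let ?g = "\<lambda>z :: complex ^ 'n. (1 + norm z) powr (- D) * (1 + ln (1 + norm z)) powr (- 1)"
  have [measurable]: "S m \<in> sets borel" for m by (rule S)
  \<comment> \<open>The truncation \<open>M\<close> grows with \<open>n\<close>, but the number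
    \<open>2 ^ card ?I\<close> of sign patterns occurs on both sides and cancels, so the bound is
    uniform.\<close>
  have "(\<Sum>m<n. c' / real (Suc m)) \<le> K / c" for n
  proof -
    obtain M where M: "\<And>m z. m < n \<Longrightarrow> z \<in> S m \<Longrightarrow> norm (moduli_vec l \<beta> z) \<le> real M"
      using S(5)[of n] by blast
    let ?I = "PiE UNIV (\<lambda>_. {..M}) :: ('n \<Rightarrow> nat) set"
    let ?F = "\<lambda>E. signed_poly l \<beta> ?H M E :: complex ^ 'n \<Rightarrow> complex"
    let ?W = "\<lambda>E. fock_weighted l \<beta> \<eta> (?F E)"
    have fin: "finite ?I" by (intro finite_PiE) auto
    have [measurable]: "?W E \<in> borel_measurable borel" for E
      by (intro fock_weighted_measurable entire_signed_poly)
    have int: "(\<integral>\<^sup>+z. ennreal (?W E z powr Q) \<partial>lborel) \<le> ennreal K" for E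
    proof -
      have "fock_le l p \<beta> \<rho> (?F E) B" by (intro B(2) entire_signed_poly C(2))
      then have "fock_le l q \<beta> \<eta> (?F E) (C1 * B)" by (intro C1(2) B(1))
      then show ?thesis by (simp add: fock_le_def Q K_def)
    qed
    have pw: "c * 2 ^ card ?I * (\<Sum>m<n. ?g z * indicator (S m) z) \<le> (\<Sum>E\<in>Pow ?I. ?W E z powr Q)" for z
    proof (cases "\<exists>m<n. z \<in> S m")
      case False
      then have "(\<Sum>m<n. ?g z * indicator (S m) z) = 0" by (intro sum.neutral) auto
      then show ?thesis by (auto intro!: sum_nonneg)
    next
      case True
      then obtain m where m: "m < n" "z \<in> S m" by blast
      have other: "indicator (S m') z = (0 :: real)" if "m' \<in> {..<n} - {m}" for m'
        using S(3)[OF m(2), of m'] that by (auto simp: indicator_def)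
      have "(\<Sum>m<n. ?g z * indicator (S m) z) = (\<Sum>m'\<in>{m}. ?g z * indicator (S m') z)"
        by (rule sum.mono_neutral_right) (simp_all add: m other)
      also have "\<dots> = ?g z" using m by simp
      also have "\<dots> \<le> (1 + norm z) powr (\<eta> * Q) * ?H (norm z) powr Q"
      proof -
        have "?H (norm z) powr Q = (1 + norm z) powr (- s * Q) * (1 + ln (1 + norm z)) powr (- 1)"
          using Q by (simp add: log_decay_def powr_mult powr_powr)
        then have eq: "(1 + norm z) powr (\<eta> * Q) * ?H (norm z) powr Q
          = (1 + norm z) powr (\<eta> * Q + - s * Q) * (1 + ln (1 + norm z)) powr (- 1)"
          by (simp only: powr_add mult.assoc)
        have "(1 + norm z) powr (- D) \<le> (1 + norm z) powr (\<eta> * Q + - s * Q)"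
          using sQ by (intro powr_mono) (auto simp: algebra_simps)
        then show ?thesis unfolding eq by (rule mult_right_mono) simp
      qed
      finally have "c * 2 ^ card ?I * (\<Sum>m<n. ?g z * indicator (S m) z)
        \<le> c * 2 ^ card ?I * ((1 + norm z) powr (\<eta> * Q) * ?H (norm z) powr Q)"
        using c(1) by (intro mult_left_mono) auto
      also have "\<dots> = (c * 2 ^ card ?I * ?H (norm z) powr Q) * (1 + norm z) powr (\<eta> * Q)" by simp
      also have "\<dots> \<le> (\<Sum>E\<in>Pow ?I. (norm (?F E z) * exp (- (\<beta> / 2) * norm z powr (2 * l))) powr Q) * (1 + norm z) powr (\<eta> * Q)"
        using S(4)[OF m(2)] M[OF m] by (intro mult_right_mono c(2)) auto
      also have "\<dots> = (\<Sum>E\<in>Pow ?I. (norm (?F E z) * exp (- (\<beta> / 2) * norm z powr (2 * l))) powr Q * (1 + norm z) powr (\<eta> * Q))"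
        by (rule sum_distrib_right)
      also have "\<dots> = (\<Sum>E\<in>Pow ?I. ?W E z powr Q)"
        by (intro sum.cong refl) (simp only: fock_weighted_def powr_mult powr_powr mult_ac)
      finally show ?thesis .
    qed
    have "ennreal (c * 2 ^ card ?I) * ennreal (\<Sum>m<n. c' / real (Suc m))
       = ennreal (c * 2 ^ card ?I) * (\<Sum>m<n. ennreal (c' / real (Suc m)))"
      using S(1) by (subst sum_ennreal) auto
    also have "\<dots> \<le> ennreal (c * 2 ^ card ?I) * (\<Sum>m<n. \<integral>\<^sup>+z\<in>S m. ennreal (?g z) \<partial>lborel)"
      using S(6) by (intro mult_left_mono sum_mono) (auto simp: D_def)
    also have "\<dots> = (\<integral>\<^sup>+z. ennreal (c * 2 ^ card ?I) * (\<Sum>m<n. ennreal (?g z) * indicator (S m) z) \<partial>lborel)"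
      by (subst nn_integral_sum[symmetric], measurable) (rule nn_integral_cmult[symmetric], measurable)
    also have "\<dots> \<le> (\<integral>\<^sup>+z. (\<Sum>E\<in>Pow ?I. ennreal (?W E z powr Q)) \<partial>lborel)"
    proof (rule nn_integral_mono)
      fix z
      have "ennreal (c * 2 ^ card ?I) * (\<Sum>m<n. ennreal (?g z) * indicator (S m) z)
         = ennreal (c * 2 ^ card ?I) * (\<Sum>m<n. ennreal (?g z * indicator (S m) z))"
        by (intro arg_cong2[where f="(*)"] sum.cong refl) (auto simp: indicator_def)
      also have "\<dots> = ennreal (c * 2 ^ card ?I * (\<Sum>m<n. ?g z * indicator (S m) z))"
        using c(1) by (subst sum_ennreal) (auto simp: ennreal_mult sum_nonneg)
      also have "\<dots> \<le> ennreal (\<Sum>E\<in>Pow ?I. ?W E z powr Q)" by (intro ennreal_leI pw)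
      also have "\<dots> = (\<Sum>E\<in>Pow ?I. ennreal (?W E z powr Q))" by (subst sum_ennreal) auto
      finally show "ennreal (c * 2 ^ card ?I) * (\<Sum>m<n. ennreal (?g z) * indicator (S m) z)
        \<le> (\<Sum>E\<in>Pow ?I. ennreal (?W E z powr Q))" .
    qed
    also have "\<dots> = (\<Sum>E\<in>Pow ?I. \<integral>\<^sup>+z. ennreal (?W E z powr Q) \<partial>lborel)"
      by (rule nn_integral_sum) measurable
    also have "\<dots> \<le> (\<Sum>E\<in>Pow ?I. ennreal K)" by (intro sum_mono int)
    also have "\<dots> = ennreal (2 ^ card ?I * K)"
      using fin by (simp add: card_Pow K_def ennreal_mult ennreal_of_nat_eq_real_of_nat)
    finally have "ennreal (c * 2 ^ card ?I * (\<Sum>m<n. c' / real (Suc m))) \<le> ennreal (2 ^ card ?I * K)"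
      using c(1) S(1) by (subst ennreal_mult) (auto intro!: sum_nonneg)
    then have "c * 2 ^ card ?I * (\<Sum>m<n. c' / real (Suc m)) \<le> 2 ^ card ?I * K"
      by (subst (asm) ennreal_le_iff) (auto simp: K_def)
    then have "2 ^ card ?I * (c * (\<Sum>m<n. c' / real (Suc m))) \<le> 2 ^ card ?I * K" by (simp add: mult_ac)
    then have "c * (\<Sum>m<n. c' / real (Suc m)) \<le> K" by (subst (asm) mult_le_cancel_left_pos) auto
    then show ?thesis using c(1) by (simp add: field_simps)
  qed
  then have "summable (\<lambda>m. c' / real (Suc m))"
    using S(1) by (intro summableI_nonneg_bounded) auto
  then have "summable (\<lambda>m. (1 / c') * (c' / real (Suc m)))" by (rule summable_mult)
  then have "summable (\<lambda>m. inverse (real (Suc m)))" using S(1) by (simp add: inverse_eq_divide)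
  then have "summable (\<lambda>m. inverse (real m))" by (subst (asm) summable_Suc_iff)
  then show False using not_summable_harmonic[where 'a=real] by simp
qed

theorem theorem1p3:
  fixes l \<beta> \<gamma> \<rho> \<eta> :: real and p q :: ereal
  assumes "l \<ge> 1" and "\<beta> > 0" and "\<gamma> > 0"
    and "1 \<le> p" and "1 \<le> q"
  shows "embeds (fock_space l p \<beta> \<rho> :: (complex ^ 'n \<Rightarrow> complex) set) (fock_norm l p \<beta> \<rho>)
                (fock_space l q \<gamma> \<eta>) (fock_norm l q \<gamma> \<eta>) \<longleftrightarrow>
     \<beta> < \<gamma> \<or>
     (\<beta> = \<gamma> \<and> q \<ge> p \<and>
        2 * real CARD('n) * (l - 1) * (real_of_ereal (1 / p) - real_of_ereal (1 / q)) \<le> \<rho> - \<eta>) \<or>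
     (\<beta> = \<gamma> \<and> q < p \<and>
        2 * real CARD('n) * (real_of_ereal (1 / q) - real_of_ereal (1 / p)) < \<rho> - \<eta>)"
    (is "?emb \<longleftrightarrow> ?R")
proof
  assume emb: ?emb
  \<comment> \<open>Peak functions settle the order of \<open>\<beta>\<close> and
    \<open>\<gamma>\<close> for all \<open>p\<close> and \<open>q\<close>. For \<open>q < p\<close>
    the inequality they give has a nonpositive left-hand side, so the random sums are used for the
    sharp condition.\<close>
  show ?R
    using fock_embeds_necessary[OF assms emb] fock_embeds_necessary_gt[OF assms(1,2,4,5)] emb
    by (cases "q < p") (auto simp: not_less)
next
  assume ?R
  then show ?emb
    using fock_embeds_less[OF assms(1,2,4,5)] fock_embeds_le[OF assms(1,2,4)] fock_embeds_gt[OF assms(4,5)]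
    by blast
qed

end
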